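(* Assume there are constants $0<C_-\le C_+$ such that for all $(\alpha,\beta,i,j,k,l)\in\Omega$, $$C_-\frac{\sqrt{|\mathbf g|^2-2\widetilde\Delta I^{\alpha\beta}_{kl,ij}}}{|\mathbf g|\varphi_i^\alpha\varphi_j^\beta}\le\sigma^{\alpha\beta}_{ij,kl}\le C_+\frac{\sqrt{|\mathbf g|^2-2\widetilde\Delta I^{\alpha\beta}_{kl,ij}}}{|\mathbf g|\varphi_i^\alpha\varphi_j^\beta}\quad\text{whenever }|\mathbf g|^2>2\widetilde\Delta I^{\alpha\beta}_{kl,ij}$$ (in particular this covers $\sigma^{\alpha\beta}_{ij,kl}=C_{\alpha\beta}\sqrt{|\mathbf g|^2-2\widetilde\Delta I^{\alpha\beta}_{kl,ij}}/(|\mathbf g|\varphi_i^\alpha\varphi_j^\beta)$ with constants $C_{\alpha\beta}>0$). Then $\mathcal L=\Lambda-K$, where $K$ is compact on $(L^2(d\boldsymbol\xi))^r$, each $\nu_{\alpha,i}$ depends only on $|\boldsymbol\xi|$, and there exist $0<\nu_-<\nu_+$ such that for all $\alpha\in\{1,..,s\}$, $i\in\{1,..,r_\alpha\}$ and $\boldsymbol\xi\in\mathbb R^3$, $$\nu_-(1+|\boldsymbol\xi|)\le\nu_{\alpha,i}(|\boldsymbol\xi|)\le\nu_+(1+|\boldsymbol\xi|).$$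
   Context: Setup. Fix integers $s\ge1$, $r_1,\dots,r_s\ge1$, $r=\sum_\alpha r_\alpha$; masses $m_\alpha>0$; internal energies $I_1^\alpha,\dots,I_{r_\alpha}^\alpha\ge0$ and positive weights $\varphi_1^\alpha,\dots,\varphi_{r_\alpha}^\alpha>0$ for $\alpha\in\{1,\dots,s\}$. Let $\Omega=\{(\alpha,\beta,i,j,k,l):\alpha,\beta\in\{1,\dots,s\},\ i,k\in\{1,\dots,r_\alpha\},\ j,l\in\{1,\dots,r_\beta\}\}$. For velocities $\boldsymbol\xi,\boldsymbol\xi_*,\boldsymbol\xi',\boldsymbol\xi_*'\in\mathbb R^3$ put $\mathbf g=\boldsymbol\xi-\boldsymbol\xi_*$, $\mathbf g'=\boldsymbol\xi'-\boldsymbol\xi_*'$, $\cos\theta=\mathbf g\cdot\mathbf g'/(|\mathbf g||\mathbf g'|)$, $\Delta I^{\alpha\beta}_{kl,ij}=I_k^\alpha+I_l^\beta-I_i^\alpha-I_j^\beta$ and $\widetilde\Delta I^{\alpha\beta}_{kl,ij}=\frac{m_\alpha+m_\beta}{m_\alpha m_\beta}\Delta I^{\alpha\beta}_{kl,ij}$. Scattering cross sections are measurable functions $\widetilde\sigma_{\alpha\beta}:\mathbb R_+\times[-1,1]\times\{1,..,r_\alpha\}^2\times\{1,..,r_\beta\}^2\to\mathbb R_+$, written $\sigma^{\alpha\beta}_{ij,kl}=\sigma^{\alpha\beta}_{ij,kl}(|\mathbf g|,\cos\theta)=\widetilde\sigma_{\alpha\beta}(|\mathbf g|,\cos\theta,i,j,k,l)$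 and $\sigma^{\alpha\beta}_{kl,ij}=\widetilde\sigma_{\alpha\beta}(|\mathbf g'|,\cos\theta,k,l,i,j)$, positive a.e., satisfying (for pairs obeying the conservation laws below) the microreversibility $\varphi_i^\alpha\varphi_j^\beta|\mathbf g|^2\sigma^{\alpha\beta}_{ij,kl}(|\mathbf g|,\cos\theta)=\varphi_k^\alpha\varphi_l^\beta|\mathbf g'|^2\sigma^{\alpha\beta}_{kl,ij}(|\mathbf g'|,\cos\theta)$, and the symmetries $\sigma^{\alpha\beta}_{kl,ij}=\sigma^{\beta\alpha}_{lk,ji}$, $\sigma^{\alpha\alpha}_{ij,kl}(|\mathbf g|,-\cos\theta)=\sigma^{\alpha\alpha}_{ij,kl}(|\mathbf g|,\cos\theta)$, $\sigma^{\alpha\alpha}_{ij,kl}=\sigma^{\alpha\alpha}_{ji,kl}=\sigma^{\alpha\alpha}_{ji,lk}$. The transition probabilities (distributions in the velocities) are $$W_{\alpha\beta}(\boldsymbol\xi,\boldsymbol\xi_*,I_i^\alpha,I_j^\beta|\boldsymbol\xi',\boldsymbol\xi_*',I_k^\alpha,I_l^\beta)=(m_\alpha+m_\beta)^2m_\alpha m_\beta\,\varphi_k^\alpha\varphi_l^\beta\,\sigma^{\alpha\beta}_{kl,ij}\frac{|\mathbf g'|}{|\mathbf g|}\,\delta_3(m_\alpha\boldsymbol\xi+m_\beta\boldsymbol\xi_*-m_\alpha\boldsymbol\xi'-m_\beta\boldsymbol\xi_*')\,\delta_1\!\Big(\tfrac12(m_\alpha|\boldsymbol\xi|^2+m_\beta|\boldsymbol\xi_*|^2-m_\alpha|\boldsymbol\xi'|^2-m_\beta|\boldsymbol\xi_*'|^2)-\Delta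 I^{\alpha\beta}_{kl,ij}\Big),$$ with $\delta_3,\delta_1$ the Dirac delta on $\mathbb R^3$, $\mathbb R$. Maxwellian: for fixed $n_\alpha>0$, $M_{\alpha,i}(\boldsymbol\xi)=\frac{n_\alpha\varphi_i^\alpha m_\alpha^{3/2}}{(2\pi)^{3/2}q_\alpha}e^{-m_\alpha|\boldsymbol\xi|^2/2-I_i^\alpha}$ with $q_\alpha=\sum_{i=1}^{r_\alpha}\varphi_i^\alpha e^{-I_i^\alpha}$; abbreviations $M_{\beta,j*}=M_{\beta,j}(\boldsymbol\xi_* )$, $M'_{\alpha,k}=M_{\alpha,k}(\boldsymbol\xi')$, $M'_{\beta,l*}=M_{\beta,l}(\boldsymbol\xi_*')$, and likewise for $h$. Collision frequencies: $$\nu_{\alpha,i}(\boldsymbol\xi)=\sum_{\beta=1}^s\sum_{k=1}^{r_\alpha}\sum_{j,l=1}^{r_\beta}\int_{(\mathbb R^3)^3}\frac{M_{\beta,j*}}{\varphi_i^\alpha\varphi_j^\beta}W_{\alpha\beta}(\boldsymbol\xi,\boldsymbol\xi_*,I_i^\alpha,I_j^\beta|\boldsymbol\xi',\boldsymbol\xi_*',I_k^\alpha,I_l^\beta)\,d\boldsymbol\xi_*d\boldsymbol\xi'd\boldsymbol\xi_*';$$ $\Lambda$ is the multiplication operator $(\Lambda h)_{\alpha,i}=\nu_{\alpha,i}h_{\alpha,i}$ on $(L^2(d\boldsymbol\xi))^r$ with its maximal domain. $K$ has components $$K_{\alpha,i}(h)=\sum_{\beta=1}^s\sum_{k=1}^{r_\alpha}\sum_{j,l=1}^{r_\beta}\int_{(\mathbb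 R^3)^3}\Big(\frac{h'_{\alpha,k}}{(M'_{\alpha,k})^{1/2}}+\frac{h'_{\beta,l*}}{(M'_{\beta,l*})^{1/2}}-\frac{h_{\beta,j*}}{M_{\beta,j*}^{1/2}}\Big)\Big(\frac{M_{\beta,j*}M'_{\alpha,k}M'_{\beta,l*}}{\varphi_i^\alpha\varphi_j^\beta\varphi_k^\alpha\varphi_l^\beta}\Big)^{1/2}W_{\alpha\beta}(\boldsymbol\xi,\boldsymbol\xi_*,I_i^\alpha,I_j^\beta|\boldsymbol\xi',\boldsymbol\xi_*',I_k^\alpha,I_l^\beta)\,d\boldsymbol\xi_*d\boldsymbol\xi'd\boldsymbol\xi_*',$$ and the linearized collision operator is $\mathcal L=\Lambda-K$. *)

theory Defs
  imports "HOL-Analysis.Analysis"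
begin

(* Indices are 0-based: species alpha < s, internal state i < r alpha.
   m alpha = mass, Ie alpha i = internal energy I_i^alpha, phi alpha i = weight,
   nd alpha = number density n_alpha,
   sig alpha beta a c i j k l = tilde-sigma_{alpha beta}(a, c, i, j, k, l). *)

type_synonym vel = "real^3"

definition partfun :: "(nat \<Rightarrow> nat) \<Rightarrow> (nat \<Rightarrow> nat \<Rightarrow> real) \<Rightarrow> (nat \<Rightarrow> nat \<Rightarrow> real) \<Rightarrow> nat \<Rightarrow> real" where
  "partfun r phi Ie \<alpha> = (\<Sum>i<r \<alpha>. phi \<alpha> i * exp (- Ie \<alpha> i))"

definition maxw :: "(nat \<Rightarrow> nat) \<Rightarrow> (nat \<Rightarrow> real) \<Rightarrow> (nat \<Rightarrow> real) \<Rightarrow> (nat \<Rightarrow> nat \<Rightarrow> real)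
    \<Rightarrow> (nat \<Rightarrow> nat \<Rightarrow> real) \<Rightarrow> nat \<Rightarrow> nat \<Rightarrow> vel \<Rightarrow> real" where
  "maxw r m nd phi Ie \<alpha> i \<xi> =
     nd \<alpha> * phi \<alpha> i * m \<alpha> powr (3/2) / ((2 * pi) powr (3/2) * partfun r phi Ie \<alpha>)
     * exp (- m \<alpha> * (norm \<xi>)\<^sup>2 / 2 - Ie \<alpha> i)"

definition dItil :: "(nat \<Rightarrow> real) \<Rightarrow> (nat \<Rightarrow> nat \<Rightarrow> real) \<Rightarrow> nat \<Rightarrow> nat \<Rightarrow> nat \<Rightarrow> nat \<Rightarrow> nat \<Rightarrow> nat \<Rightarrow> real" where
  "dItil m Ie \<alpha> \<beta> i j k l =
     (m \<alpha> + m \<beta>) / (m \<alpha> * m \<beta>) * (Ie \<alpha> k + Ie \<beta> l - Ie \<alpha> i - Ie \<beta> j)"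

(* integral over the unit sphere S^2 w.r.t. surface measure, via
   int_{S^2} f d omega = 3 * int_{|x|<1} f(x/|x|) dx *)
definition sphere_int :: "(vel \<Rightarrow> real) \<Rightarrow> real" where
  "sphere_int f = 3 * (LINT x : ball 0 1 | lborel. f (x /\<^sub>R norm x))"

(* Evaluation of the distributional integral
     int int W_{alpha beta}(xi, xs, I_i, I_j | xi', xs', I_k, I_l) F(xi', xs') dxi' dxs'
   obtained by integrating out the Dirac deltas: with G the centre-of-mass velocity,
   g = xi - xs, rho0 = sqrt(|g|^2 - 2 tilde Delta I), xi' = G + m_beta/(m_alpha+m_beta) rho0 omega,
   xs' = G - m_alpha/(m_alpha+m_beta) rho0 omega, cos theta = g.omega/|g|, it equals
   phi_k phi_l int_{S^2} sigma_{kl,ij}(rho0, cos theta) rho0^2/|g| F(xi',xs') d omega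
   if |g|^2 > 2 tilde Delta I, and 0 otherwise. *)
definition collint :: "(nat \<Rightarrow> real) \<Rightarrow> (nat \<Rightarrow> nat \<Rightarrow> real) \<Rightarrow> (nat \<Rightarrow> nat \<Rightarrow> real)
    \<Rightarrow> (nat \<Rightarrow> nat \<Rightarrow> real \<Rightarrow> real \<Rightarrow> nat \<Rightarrow> nat \<Rightarrow> nat \<Rightarrow> nat \<Rightarrow> real)
    \<Rightarrow> nat \<Rightarrow> nat \<Rightarrow> nat \<Rightarrow> nat \<Rightarrow> nat \<Rightarrow> nat \<Rightarrow> vel \<Rightarrow> vel \<Rightarrow> (vel \<Rightarrow> vel \<Rightarrow> real) \<Rightarrow> real" where
  "collint m Ie phi sig \<alpha> \<beta> i j k l \<xi> \<xi>s F =
     (let g = \<xi> - \<xi>s; dI = dItil m Ie \<alpha> \<beta> i j k l; M = m \<alpha> + m \<beta>;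
          G = (1 / M) *\<^sub>R (m \<alpha> *\<^sub>R \<xi> + m \<beta> *\<^sub>R \<xi>s)
      in if g \<noteq> 0 \<and> (norm g)\<^sup>2 > 2 * dI then
           (let \<rho> = sqrt ((norm g)\<^sup>2 - 2 * dI) in
            phi \<alpha> k * phi \<beta> l *
            sphere_int (\<lambda>\<omega>. sig \<alpha> \<beta> \<rho> ((g \<bullet> \<omega>) / norm g) k l i j * \<rho>\<^sup>2 / norm g
               * F (G + (m \<beta> / M * \<rho>) *\<^sub>R \<omega>) (G - (m \<alpha> / M * \<rho>) *\<^sub>R \<omega>)))
         else 0)"

definition collfreq :: "nat \<Rightarrow> (nat \<Rightarrow> nat) \<Rightarrow> (nat \<Rightarrow> real) \<Rightarrow> (nat \<Rightarrow> real) \<Rightarrow> (nat \<Rightarrow> nat \<Rightarrow> real)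
    \<Rightarrow> (nat \<Rightarrow> nat \<Rightarrow> real) \<Rightarrow> (nat \<Rightarrow> nat \<Rightarrow> real \<Rightarrow> real \<Rightarrow> nat \<Rightarrow> nat \<Rightarrow> nat \<Rightarrow> nat \<Rightarrow> real)
    \<Rightarrow> nat \<Rightarrow> nat \<Rightarrow> vel \<Rightarrow> real" where
  "collfreq s r m nd phi Ie sig \<alpha> i \<xi> =
     (\<Sum>\<beta><s. \<Sum>k<r \<alpha>. \<Sum>j<r \<beta>. \<Sum>l<r \<beta>.
        LINT \<xi>s | lborel. maxw r m nd phi Ie \<beta> j \<xi>s / (phi \<alpha> i * phi \<beta> j)
           * collint m Ie phi sig \<alpha> \<beta> i j k l \<xi> \<xi>s (\<lambda>_ _. 1))"

definition Kop :: "nat \<Rightarrow> (nat \<Rightarrow> nat) \<Rightarrow> (nat \<Rightarrow> real) \<Rightarrow> (nat \<Rightarrow> real) \<Rightarrow> (nat \<Rightarrow> nat \<Rightarrow> real)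
    \<Rightarrow> (nat \<Rightarrow> nat \<Rightarrow> real) \<Rightarrow> (nat \<Rightarrow> nat \<Rightarrow> real \<Rightarrow> real \<Rightarrow> nat \<Rightarrow> nat \<Rightarrow> nat \<Rightarrow> nat \<Rightarrow> real)
    \<Rightarrow> (nat \<Rightarrow> nat \<Rightarrow> vel \<Rightarrow> real) \<Rightarrow> nat \<Rightarrow> nat \<Rightarrow> vel \<Rightarrow> real" where
  "Kop s r m nd phi Ie sig h \<alpha> i \<xi> =
     (let M = maxw r m nd phi Ie in
     (\<Sum>\<beta><s. \<Sum>k<r \<alpha>. \<Sum>j<r \<beta>. \<Sum>l<r \<beta>.
        LINT \<xi>s | lborel. collint m Ie phi sig \<alpha> \<beta> i j k l \<xi> \<xi>s
          (\<lambda>\<xi>' \<xi>s'. (h \<alpha> k \<xi>' / sqrt (M \<alpha> k \<xi>') + h \<beta> l \<xi>s' / sqrt (M \<beta> l \<xi>s')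
                        - h \<beta> j \<xi>s / sqrt (M \<beta> j \<xi>s))
             * sqrt (M \<beta> j \<xi>s * M \<alpha> k \<xi>' * M \<beta> l \<xi>s'
                     / (phi \<alpha> i * phi \<beta> j * phi \<alpha> k * phi \<beta> l)))))"

definition Lam :: "nat \<Rightarrow> (nat \<Rightarrow> nat) \<Rightarrow> (nat \<Rightarrow> real) \<Rightarrow> (nat \<Rightarrow> real) \<Rightarrow> (nat \<Rightarrow> nat \<Rightarrow> real)
    \<Rightarrow> (nat \<Rightarrow> nat \<Rightarrow> real) \<Rightarrow> (nat \<Rightarrow> nat \<Rightarrow> real \<Rightarrow> real \<Rightarrow> nat \<Rightarrow> nat \<Rightarrow> nat \<Rightarrow> nat \<Rightarrow> real)
    \<Rightarrow> (nat \<Rightarrow> nat \<Rightarrow> vel \<Rightarrow> real) \<Rightarrow> nat \<Rightarrow> nat \<Rightarrow> vel \<Rightarrow> real" where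
  "Lam s r m nd phi Ie sig h \<alpha> i \<xi> = collfreq s r m nd phi Ie sig \<alpha> i \<xi> * h \<alpha> i \<xi>"

definition Lop :: "nat \<Rightarrow> (nat \<Rightarrow> nat) \<Rightarrow> (nat \<Rightarrow> real) \<Rightarrow> (nat \<Rightarrow> real) \<Rightarrow> (nat \<Rightarrow> nat \<Rightarrow> real)
    \<Rightarrow> (nat \<Rightarrow> nat \<Rightarrow> real) \<Rightarrow> (nat \<Rightarrow> nat \<Rightarrow> real \<Rightarrow> real \<Rightarrow> nat \<Rightarrow> nat \<Rightarrow> nat \<Rightarrow> nat \<Rightarrow> real)
    \<Rightarrow> (nat \<Rightarrow> nat \<Rightarrow> vel \<Rightarrow> real) \<Rightarrow> nat \<Rightarrow> nat \<Rightarrow> vel \<Rightarrow> real" where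
  "Lop s r m nd phi Ie sig h \<alpha> i \<xi> = Lam s r m nd phi Ie sig h \<alpha> i \<xi> - Kop s r m nd phi Ie sig h \<alpha> i \<xi>"

definition L2fun :: "(vel \<Rightarrow> real) \<Rightarrow> bool" where
  "L2fun f \<longleftrightarrow> f \<in> borel_measurable lborel \<and> integrable lborel (\<lambda>x. (f x)\<^sup>2)"

definition L2vec :: "nat \<Rightarrow> (nat \<Rightarrow> nat) \<Rightarrow> (nat \<Rightarrow> nat \<Rightarrow> vel \<Rightarrow> real) \<Rightarrow> bool" where
  "L2vec s r h \<longleftrightarrow> (\<forall>\<alpha><s. \<forall>i<r \<alpha>. L2fun (h \<alpha> i))"

definition L2norm :: "nat \<Rightarrow> (nat \<Rightarrow> nat) \<Rightarrow> (nat \<Rightarrow> nat \<Rightarrow> vel \<Rightarrow> real) \<Rightarrow> real" where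
  "L2norm s r h = sqrt (\<Sum>\<alpha><s. \<Sum>i<r \<alpha>. LINT x | lborel. (h \<alpha> i x)\<^sup>2)"

definition compact_L2op :: "nat \<Rightarrow> (nat \<Rightarrow> nat)
    \<Rightarrow> ((nat \<Rightarrow> nat \<Rightarrow> vel \<Rightarrow> real) \<Rightarrow> (nat \<Rightarrow> nat \<Rightarrow> vel \<Rightarrow> real)) \<Rightarrow> bool" where
  "compact_L2op s r T \<longleftrightarrow>
     (\<forall>h. L2vec s r h \<longrightarrow> L2vec s r (T h)) \<and>
     (\<forall>(hs :: nat \<Rightarrow> nat \<Rightarrow> nat \<Rightarrow> vel \<Rightarrow> real) (B::real). (\<forall>n. L2vec s r (hs n) \<and> L2norm s r (hs n) \<le> B) \<longrightarrow>
        (\<exists>sub g. strict_mono sub \<and> L2vec s r g \<and>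
           (\<lambda>n. L2norm s r (\<lambda>\<alpha> i x. T (hs (sub n)) \<alpha> i x - g \<alpha> i x)) \<longlonglongrightarrow> 0))"

end

theory Submission
  imports Defs "HOL-Library.Diagonal_Subsequence"
begin

text \<open>The upper bound on the cross sections and microreversibility show that, after integrating out the
  Dirac deltas, the collision kernel is comparable with $\rho = \sqrt{|g|^2 - 2\widetilde\Delta I}$. So
  $\nu_{\alpha,i}$ is comparable with $\int M(\xi_*)|\xi-\xi_*|\,d\xi_*$, and $K$ is a sum of a
  Hilbert--Schmidt loss term and of gain terms $h \mapsto \int b(\xi,y)\,h(Z(\xi,y))\,dy$ with $b \ge 0$.

  A gain term is compact because, up to an operator of small norm, it is bounded pointwise by $L^2$
  norms. The small part is controlled by the Schur test: its row sums decay like $1/(1+|\xi|)$, since a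
  Gaussian integrates over a sphere of radius $\rho$ to $O(\rho^{-2})$, and its column sums are bounded
  after a translation of $\xi$ at fixed $(g,\omega)$. The main part lives on $|\xi|,|\xi_*|\le R$; there
  the law of the post-collisional velocity has density $O(1/|z|)$, which lies in $L^2$ near the origin. A
  functional with such a bound converges along weakly convergent sequences, and dominated convergence
  turns this into norm convergence. Working with positive kernels makes any regularity of the cross
  sections superfluous and avoids Carleman's representation.\<close>

section \<open>Weak and strong convergence in $L^2$\<close>

text \<open>Division by the square roots of the Maxwellians leaves a gain term with Gaussians in
  \<open>\<xi>s\<close> and in the one post-collisional velocity at which \<open>h\<close> is not
  evaluated. No Gaussian in \<open>\<xi>\<close> itself survives, so decay in \<open>\<xi>\<close>
  can only come from the angular average. The Schur test can live on that: the square of the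
  operator norm is at most the product of the row and column bounds, so small rows and merely
  bounded columns suffice. In the loss term conservation of energy trades the two outgoing Gaussians
  for incoming ones, hence the easier treatment. The lower bound on the frequencies rests on a
  single channel, the collision of a species with itself without change of state: its energy gap is
  0, no threshold removes slow pairs, and the other channels contribute nonnegatively. A Bochner
  integral is 0 by default when its integrand is not integrable. The splitting of \<open>K\<close>
  into gain and loss integrals is therefore an identity almost everywhere, and integrability is
  carried along with every bound.\<close>

lemma L2fun_iff:
  "L2fun f \<longleftrightarrow> f \<in> borel_measurable borel \<and> (\<integral>\<^sup>+x. ennreal ((f x)\<^sup>2) \<partial>lborel) < \<infinity>"
  unfolding L2fun_def by (auto simp: integrable_iff_bounded)

lemma L2fun_measurable [measurable_dest]: "L2fun f \<Longrightarrow> f \<in> borel_measurable borel"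
  by (simp add: L2fun_iff)

lemma L2fun_sq_integrable: "L2fun f \<Longrightarrow> integrable lborel (\<lambda>x. (f x)\<^sup>2)"
  by (simp add: L2fun_def)

lemma L2fun_nn_integral:
  assumes "L2fun f"
  shows "(\<integral>\<^sup>+x. ennreal ((f x)\<^sup>2) \<partial>lborel) = ennreal (LINT x|lborel. (f x)\<^sup>2)"
  using assms by (intro nn_integral_eq_integral) (auto simp: L2fun_def)

lemma L2fun_mult_integrable:
  assumes [measurable]: "L2fun f" "L2fun g"
  shows "integrable lborel (\<lambda>x. f x * g x)"
proof (rule Bochner_Integration.integrable_bound)
  show "integrable lborel (\<lambda>x. (f x)\<^sup>2 + (g x)\<^sup>2)"
    using assms by (intro Bochner_Integration.integrable_add L2fun_sq_integrable)
  show "AE x in lborel. norm (f x * g x) \<le> norm ((f x)\<^sup>2 + (g x)\<^sup>2)"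
  proof (rule AE_I2)
    fix x
    have "0 \<le> (\<bar>f x\<bar> - \<bar>g x\<bar>)\<^sup>2 + (f x)\<^sup>2 + (g x)\<^sup>2" by simp
    then show "norm (f x * g x) \<le> norm ((f x)\<^sup>2 + (g x)\<^sup>2)"
      by (simp add: power2_diff abs_mult)
  qed
qed simp

lemma L2fun_cmult:
  assumes "L2fun f"
  shows "L2fun (\<lambda>x. c * f x)"
  using assms unfolding L2fun_def by (auto simp: power_mult_distrib)

lemma L2fun_add:
  assumes [measurable]: "L2fun f" "L2fun g"
  shows "L2fun (\<lambda>x. f x + g x)"
proof -
  have "integrable lborel (\<lambda>x. (f x)\<^sup>2 + (g x)\<^sup>2 + 2 * (f x * g x))"
    using assms
    by (intro Bochner_Integration.integrable_add L2fun_sq_integrable integrable_mult_right L2fun_mult_integrable)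
  then show ?thesis
    unfolding L2fun_def by (auto simp: power2_sum mult.assoc)
qed

lemma L2fun_diff: "L2fun f \<Longrightarrow> L2fun g \<Longrightarrow> L2fun (\<lambda>x. f x - g x)"
  using L2fun_add[of f "\<lambda>x. -1 * g x"] L2fun_cmult[of g "-1"] by simp

lemma L2fun_zero: "L2fun (\<lambda>x. 0)"
  by (simp add: L2fun_def)

lemma L2fun_sum: "(\<And>i. i \<in> I \<Longrightarrow> L2fun (f i)) \<Longrightarrow> L2fun (\<lambda>x. \<Sum>i\<in>I. f i x)"
  by (induction I rule: infinite_finite_induct) (auto intro: L2fun_add L2fun_zero)

text \<open>Measurability of \<open>g\<close> is a hypothesis of its own, because Borel
  measurability does not pass along almost everywhere equality.\<close>

lemma L2fun_cong_AE:
  assumes [measurable]: "L2fun f" "g \<in> borel_measurable borel" and "AE x in lborel. f x = g x"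
  shows "L2fun g"
proof -
  have "(\<integral>\<^sup>+x. ennreal ((f x)\<^sup>2) \<partial>lborel) = (\<integral>\<^sup>+x. ennreal ((g x)\<^sup>2) \<partial>lborel)"
    using assms(3) by (intro nn_integral_cong_AE) auto
  then show ?thesis using assms by (simp add: L2fun_iff)
qed

lemma L2_Cauchy_Schwarz:
  assumes [measurable]: "L2fun f" "L2fun g"
  shows "(LINT x|lborel. f x * g x)\<^sup>2 \<le> (LINT x|lborel. (f x)\<^sup>2) * (LINT x|lborel. (g x)\<^sup>2)"
proof -
  have "ennreal ((LINT x|lborel. \<bar>f x\<bar> * \<bar>g x\<bar>)\<^sup>2)
      = (\<integral>\<^sup>+x. ennreal \<bar>f x\<bar> * ennreal \<bar>g x\<bar> \<partial>lborel)\<^sup>2"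
    using L2fun_mult_integrable[OF assms]
    by (simp add: ennreal_mult[symmetric] abs_mult[symmetric] nn_integral_eq_integral ennreal_power)
  also have "\<dots> \<le> (\<integral>\<^sup>+x. (ennreal \<bar>f x\<bar>)\<^sup>2 \<partial>lborel) * (\<integral>\<^sup>+x. (ennreal \<bar>g x\<bar>)\<^sup>2 \<partial>lborel)"
    by (rule Cauchy_Schwarz_nn_integral) simp_all
  also have "\<dots> = ennreal ((LINT x|lborel. (f x)\<^sup>2) * (LINT x|lborel. (g x)\<^sup>2))"
    by (simp add: ennreal_power L2fun_nn_integral[OF assms(1)] L2fun_nn_integral[OF assms(2)] ennreal_mult)
  finally have 1: "(LINT x|lborel. \<bar>f x\<bar> * \<bar>g x\<bar>)\<^sup>2 \<le> (LINT x|lborel. (f x)\<^sup>2) * (LINT x|lborel. (g x)\<^sup>2)"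
    by (subst (asm) ennreal_le_iff) auto
  have "\<bar>LINT x|lborel. f x * g x\<bar> \<le> (LINT x|lborel. \<bar>f x\<bar> * \<bar>g x\<bar>)"
    unfolding abs_mult[symmetric] by (rule integral_abs_bound)
  then have "(LINT x|lborel. f x * g x)\<^sup>2 \<le> (LINT x|lborel. \<bar>f x\<bar> * \<bar>g x\<bar>)\<^sup>2"
    by (rule power2_le_iff_abs_le[THEN iffD2, rotated]) (auto intro!: integral_nonneg_AE)
  then show ?thesis using 1 by linarith
qed

lemma L2_sq_diff_le:
  assumes "L2fun f" "L2fun g"
  shows "(LINT x|lborel. (f x - g x)\<^sup>2) \<le> 2 * (LINT x|lborel. (f x)\<^sup>2) + 2 * (LINT x|lborel. (g x)\<^sup>2)"
proof -
  have "(LINT x|lborel. (f x - g x)\<^sup>2) \<le> (LINT x|lborel. 2 * (f x)\<^sup>2 + 2 * (g x)\<^sup>2)"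
  proof (rule integral_mono)
    fix x
    have "0 \<le> (f x + g x)\<^sup>2" by simp
    then show "(f x - g x)\<^sup>2 \<le> 2 * (f x)\<^sup>2 + 2 * (g x)\<^sup>2"
      unfolding power2_sum power2_diff by linarith
  qed (use assms L2fun_diff[OF assms] in \<open>auto intro!: Bochner_Integration.integrable_add simp: L2fun_sq_integrable\<close>)
  also have "\<dots> = 2 * (LINT x|lborel. (f x)\<^sup>2) + 2 * (LINT x|lborel. (g x)\<^sup>2)"
    using assms by (subst Bochner_Integration.integral_add) (auto simp: L2fun_sq_integrable)
  finally show ?thesis .
qed

lemma L2_sq_add_le:
  assumes "L2fun f" "L2fun g"
  shows "(LINT x|lborel. (f x + g x)\<^sup>2) \<le> 2 * (LINT x|lborel. (f x)\<^sup>2) + 2 * (LINT x|lborel. (g x)\<^sup>2)"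
  using L2_sq_diff_le[OF assms(1) L2fun_cmult[OF assms(2), of "-1"]] by simp

section \<open>Completeness and weak sequential compactness of L2\<close>

definition L2Cauchy :: "(nat \<Rightarrow> vel \<Rightarrow> real) \<Rightarrow> bool" where
  "L2Cauchy f \<longleftrightarrow> (\<forall>n. L2fun (f n)) \<and>
     (\<forall>e>0. \<exists>N. \<forall>m\<ge>N. \<forall>n\<ge>N. (LINT x|lborel. (f m x - f n x)\<^sup>2) \<le> e)"

text \<open>The weak limit is never named: convergence of all pairings is what the compactness
  argument consumes. The norm bound is included because it feeds the dominating function and the
  approximation of test functions.\<close>

definition L2weak :: "(nat \<Rightarrow> vel \<Rightarrow> real) \<Rightarrow> bool" where
  "L2weak h \<longleftrightarrow> (\<forall>n. L2fun (h n)) \<and> (\<exists>B. \<forall>n. (LINT x|lborel. (h n x)\<^sup>2) \<le> B) \<and>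
     (\<forall>k. L2fun k \<longrightarrow> convergent (\<lambda>n. LINT x|lborel. k x * h n x))"

text \<open>Riesz--Fischer. Along a fast subsequence the squared increments have integral at most
  4^(-k). Weighting them by 2^k keeps the sum of the integrals finite and forces almost everywhere a
  bound of order 2^(-k/2) on the increments themselves, so the subsequence converges pointwise.
  Fatou then measures the distance of the full sequence to that limit.\<close>

lemma L2Cauchy_complete:
  assumes "L2Cauchy f"
  shows "\<exists>g. L2fun g \<and> (\<lambda>n. LINT x|lborel. (f n x - g x)\<^sup>2) \<longlonglongrightarrow> 0"
proof -
  have L2[simp]: "L2fun (f n)" for n using assms by (simp add: L2Cauchy_def)
  note [measurable] = L2fun_measurable[OF L2]
  have "\<forall>k. \<exists>N. \<forall>m\<ge>N. \<forall>n\<ge>N. (LINT x|lborel. (f m x - f n x)\<^sup>2) \<le> (1/4)^k"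
    using assms unfolding L2Cauchy_def by (meson zero_less_power zero_less_divide_1_iff zero_less_numeral)
  then obtain N where N: "\<And>k m n. m \<ge> N k \<Longrightarrow> n \<ge> N k \<Longrightarrow> (LINT x|lborel. (f m x - f n x)\<^sup>2) \<le> (1/4)^k"
    by metis
  \<comment> \<open>Partial sums make \<open>s k\<close> dominate \<open>N k\<close> without a
    monotone choice of \<open>N\<close>; the summand \<open>k\<close> makes \<open>s\<close>
    unbounded.\<close>
  define s where "s k = (\<Sum>i\<le>k. N i) + k" for k
  have sN: "s k \<ge> N k" "s (Suc k) \<ge> N k" for k
    unfolding s_def using member_le_sum[of k "{..k}" N] member_le_sum[of k "{..Suc k}" N] by (auto intro: trans_le_add1)
  have sk: "s k \<ge> k" for k by (simp add: s_def)
  define d where "d k x = f (s (Suc k)) x - f (s k) x" for k x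
  have [measurable]: "d k \<in> borel_measurable borel" for k
    unfolding d_def by measurable
  have d: "(\<integral>\<^sup>+x. ennreal ((d k x)\<^sup>2) \<partial>lborel) \<le> ennreal ((1/4)^k)" for k
    unfolding d_def using sN[of k]
    by (subst L2fun_nn_integral) (auto intro!: L2fun_diff N ennreal_leI)
  have "(\<integral>\<^sup>+x. (\<Sum>k. ennreal (2^k * (d k x)\<^sup>2)) \<partial>lborel) = (\<Sum>k. \<integral>\<^sup>+x. ennreal (2^k * (d k x)\<^sup>2) \<partial>lborel)"
    by (rule nn_integral_suminf) measurable
  also have "\<dots> \<le> (\<Sum>k. ennreal ((1/2)^k))"
  proof (rule suminf_le)
    fix k
    have "(\<integral>\<^sup>+x. ennreal (2^k * (d k x)\<^sup>2) \<partial>lborel) = ennreal (2^k) * (\<integral>\<^sup>+x. ennreal ((d k x)\<^sup>2) \<partial>lborel)"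
      by (simp add: ennreal_mult nn_integral_cmult)
    also have "\<dots> \<le> ennreal (2^k) * ennreal ((1/4)^k)"
      by (intro mult_left_mono d) simp
    also have "\<dots> = ennreal ((1/2)^k)"
      by (simp add: ennreal_mult[symmetric] power_mult_distrib[symmetric])
    finally show "(\<integral>\<^sup>+x. ennreal (2^k * (d k x)\<^sup>2) \<partial>lborel) \<le> ennreal ((1/2)^k)" .
  qed simp_all
  also have "\<dots> = ennreal (\<Sum>k. (1/2)^k)"
    by (rule suminf_ennreal2) (auto intro: summable_geometric)
  also have "\<dots> < \<infinity>" by simp
  finally have fin: "(\<integral>\<^sup>+x. (\<Sum>k. ennreal (2^k * (d k x)\<^sup>2)) \<partial>lborel) < \<infinity>" .
  have "AE x in lborel. (\<Sum>k. ennreal (2^k * (d k x)\<^sup>2)) \<noteq> \<infinity>"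
  proof (rule nn_integral_PInf_AE)
    show "(\<lambda>x. \<Sum>k. ennreal (2^k * (d k x)\<^sup>2)) \<in> borel_measurable lborel" by measurable
    show "(\<integral>\<^sup>+x. (\<Sum>k. ennreal (2^k * (d k x)\<^sup>2)) \<partial>lborel) \<noteq> \<infinity>" using fin by (rule less_imp_neq)
  qed
  then have conv: "AE x in lborel. convergent (\<lambda>k. f (s k) x)"
  proof eventually_elim
    case (elim x)
    define S where "S = enn2real (\<Sum>k. ennreal (2^k * (d k x)\<^sup>2))"
    have S: "2^k * (d k x)\<^sup>2 \<le> S" for k
    proof -
      have le: "u k \<le> suminf u" for u :: "nat \<Rightarrow> ennreal"
        using sum_le_suminf[of u "{k}"] by simp
      have "ennreal (2^k * (d k x)\<^sup>2) \<le> (\<Sum>k. ennreal (2^k * (d k x)\<^sup>2))"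
        by (rule le)
      also have "\<dots> = ennreal S" 
        unfolding S_def using elim by (intro ennreal_enn2real[symmetric]) (simp only: top.not_eq_extremum infinity_ennreal_def)
      finally show ?thesis by (subst (asm) ennreal_le_iff) (simp_all add: S_def enn2real_nonneg)
    qed
    have "summable (\<lambda>k. d k x)"
    proof (rule summable_comparison_test')
      show "summable (\<lambda>k. sqrt S * (sqrt (1/2))^k)"
        by (intro summable_mult summable_geometric) (simp add: real_sqrt_divide)
      fix k :: nat assume "k \<ge> 0"
      have "(d k x)\<^sup>2 \<le> S * (1/2)^k"
        using S[of k] by (simp add: field_simps)
      then have "sqrt ((d k x)\<^sup>2) \<le> sqrt (S * (1/2)^k)" by (rule real_sqrt_le_mono)
      then show "norm (d k x) \<le> sqrt S * (sqrt (1/2))^k"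
        unfolding real_sqrt_abs real_sqrt_mult real_sqrt_power[of "1/2"] by simp
    qed
    then have "convergent (\<lambda>n. (\<Sum>k<n. d k x))" by (simp add: summable_iff_convergent)
    then have "convergent (\<lambda>n. (\<Sum>k<n. d k x) + f (s 0) x)" by (intro convergent_add convergent_const)
    moreover have "(\<Sum>k<n. d k x) + f (s 0) x = f (s n) x" for n
      unfolding d_def by (subst sum_lessThan_telescope) simp
    ultimately show ?case by simp
  qed
  define g where "g x = lim (\<lambda>k. f (s k) x)" for x
  have [measurable]: "g \<in> borel_measurable borel" unfolding g_def by measurable
  \<comment> \<open>Fatou along the subsequence. It is stated with \<open>nn_integral\<close>
    because \<open>g\<close> is not yet known to lie in L2; that is deduced from this bound.\<close>
  have bnd: "(\<integral>\<^sup>+x. ennreal ((f n x - g x)\<^sup>2) \<partial>lborel) \<le> ennreal e"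
    if e: "\<And>m. m \<ge> M \<Longrightarrow> (LINT x|lborel. (f n x - f m x)\<^sup>2) \<le> e" for n M e
  proof -
    have "(\<integral>\<^sup>+x. ennreal ((f n x - g x)\<^sup>2) \<partial>lborel)
        = (\<integral>\<^sup>+x. liminf (\<lambda>k. ennreal ((f n x - f (s k) x)\<^sup>2)) \<partial>lborel)"
    proof (rule nn_integral_cong_AE, use conv in eventually_elim)
      case (elim x)
      then have "(\<lambda>k. f (s k) x) \<longlonglongrightarrow> g x" unfolding g_def by (simp add: convergent_LIMSEQ_iff)
      then have "(\<lambda>k. ennreal ((f n x - f (s k) x)\<^sup>2)) \<longlonglongrightarrow> ennreal ((f n x - g x)\<^sup>2)"
        by (intro tendsto_intros)
      from lim_imp_Liminf[OF _ this] show ?case by simp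
    qed
    also have "\<dots> \<le> liminf (\<lambda>k. \<integral>\<^sup>+x. ennreal ((f n x - f (s k) x)\<^sup>2) \<partial>lborel)"
      by (rule nn_integral_liminf) simp
    also have "\<dots> \<le> ennreal e"
    proof (rule Liminf_le)
      show "\<forall>\<^sub>F k in sequentially. (\<integral>\<^sup>+x. ennreal ((f n x - f (s k) x)\<^sup>2) \<partial>lborel) \<le> ennreal e"
        unfolding eventually_sequentially
        using sk by (intro exI[of _ M] allI impI, subst L2fun_nn_integral)
          (auto intro!: L2fun_diff ennreal_leI e intro: order_trans)
    qed simp
    finally show ?thesis .
  qed
  have g: "L2fun g"
  proof -
    from assms obtain M where M: "\<And>m n. m \<ge> M \<Longrightarrow> n \<ge> M \<Longrightarrow> (LINT x|lborel. (f m x - f n x)\<^sup>2) \<le> 1"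
      unfolding L2Cauchy_def by (metis zero_less_one)
    have "(\<integral>\<^sup>+x. ennreal ((f M x - g x)\<^sup>2) \<partial>lborel) \<le> ennreal 1"
      by (rule bnd[where M=M]) (intro M order.refl)
    also have "\<dots> < \<infinity>" by simp
    finally have "(\<integral>\<^sup>+x. ennreal ((f M x - g x)\<^sup>2) \<partial>lborel) < \<infinity>" .
    then have "L2fun (\<lambda>x. f M x - g x)" by (simp add: L2fun_iff)
    from L2fun_diff[OF L2[of M] this] show ?thesis by simp
  qed
  have "(\<lambda>n. LINT x|lborel. (f n x - g x)\<^sup>2) \<longlonglongrightarrow> 0"
  proof (rule LIMSEQ_I)
    fix e :: real assume "e > 0"
    with assms obtain M where M: "\<And>m n. m \<ge> M \<Longrightarrow> n \<ge> M \<Longrightarrow> (LINT x|lborel. (f m x - f n x)\<^sup>2) \<le> e/2"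
      unfolding L2Cauchy_def by (metis half_gt_zero)
    have "(LINT x|lborel. (f n x - g x)\<^sup>2) \<le> e/2" if "n \<ge> M" for n
    proof -
      have "(\<integral>\<^sup>+x. ennreal ((f n x - g x)\<^sup>2) \<partial>lborel) \<le> ennreal (e/2)"
        by (rule bnd[where M=M]) (intro M that)
      then show ?thesis using \<open>e > 0\<close> g
        by (subst (asm) L2fun_nn_integral) (auto intro: L2fun_diff)
    qed
    then show "\<exists>no. \<forall>n\<ge>no. norm ((LINT x|lborel. (f n x - g x)\<^sup>2) - 0) < e"
      using \<open>e > 0\<close> by (intro exI[of _ M]) fastforce
  qed
  with g show ?thesis by blast
qed

text \<open>By Cauchy--Schwarz and the common norm bound, the pairings with \<open>k\<close> and
  with \<open>k'\<close> differ by at most e/4 uniformly in \<open>n\<close>, so the Cauchy property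
  is inherited from the approximating test function.\<close>

lemma L2weak_test_approx:
  assumes L2: "\<And>n. L2fun (h n)" and B: "\<And>n. (LINT x|lborel. (h n x)\<^sup>2) \<le> B"
    and k: "L2fun k"
    and approx: "\<And>e. e > 0 \<Longrightarrow> \<exists>k'. L2fun k' \<and> (LINT x|lborel. (k x - k' x)\<^sup>2) \<le> e \<and>
          convergent (\<lambda>n. LINT x|lborel. k' x * h n x)"
  shows "convergent (\<lambda>n. LINT x|lborel. k x * h n x)"
proof -
  have "Cauchy (\<lambda>n. LINT x|lborel. k x * h n x)"
  proof (rule CauchyI')
    fix e :: real assume e: "e > 0"
    have B0: "B \<ge> 0" using B[of 0] by (rule order_trans[rotated]) (auto intro: integral_nonneg_AE)
    \<comment> \<open>Chosen so that \<open>e' * B\<close> is at most (e/4)^2; the added 1 covers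
      \<open>B = 0\<close>.\<close>
    define e' where "e' = (e/4)\<^sup>2 / (B + 1)"
    have "e' > 0" using e B0 by (simp add: e'_def)
    from approx[OF this] obtain k' where k': "L2fun k'" "(LINT x|lborel. (k x - k' x)\<^sup>2) \<le> e'"
      "convergent (\<lambda>n. LINT x|lborel. k' x * h n x)" by blast
    have close: "\<bar>(LINT x|lborel. k x * h n x) - (LINT x|lborel. k' x * h n x)\<bar> \<le> e/4" for n
    proof -
      have eq: "(LINT x|lborel. k x * h n x) - (LINT x|lborel. k' x * h n x) = (LINT x|lborel. (k x - k' x) * h n x)"
        using L2fun_mult_integrable[OF k L2[of n]] L2fun_mult_integrable[OF k'(1) L2[of n]]
        by (subst Bochner_Integration.integral_diff[symmetric]) (auto simp: left_diff_distrib)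
      have "(LINT x|lborel. (k x - k' x) * h n x)\<^sup>2 \<le> (LINT x|lborel. (k x - k' x)\<^sup>2) * (LINT x|lborel. (h n x)\<^sup>2)"
        by (intro L2_Cauchy_Schwarz L2fun_diff k k' L2)
      also have "\<dots> \<le> e' * B"
        using k'(2) B[of n] \<open>e' > 0\<close> by (intro mult_mono) auto
      also have "\<dots> \<le> (e/4)\<^sup>2"
        using B0 e unfolding e'_def by (simp add: field_simps)
      finally show ?thesis unfolding eq using e by (simp add: power2_le_iff_abs_le)
    qed
    from k'(3) have "Cauchy (\<lambda>n. LINT x|lborel. k' x * h n x)" by (simp add: Cauchy_convergent_iff)
    then obtain M where M: "\<And>m n. m \<ge> M \<Longrightarrow> n \<ge> M \<Longrightarrow>
        dist (LINT x|lborel. k' x * h m x) (LINT x|lborel. k' x * h n x) < e/4"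
      using e unfolding Cauchy_def by (meson divide_pos_pos zero_less_numeral)
    show "\<exists>M. \<forall>m\<ge>M. \<forall>n>m. dist (LINT x|lborel. k x * h m x) (LINT x|lborel. k x * h n x) < e"
    proof (intro exI[of _ M] allI impI)
      fix m n assume "m \<ge> M" "n > m"
      then have "dist (LINT x|lborel. k' x * h m x) (LINT x|lborel. k' x * h n x) < e/4" by (intro M) auto
      then show "dist (LINT x|lborel. k x * h m x) (LINT x|lborel. k x * h n x) < e"
        using close[of m] close[of n] e unfolding dist_real_def by linarith
    qed
  qed
  then show ?thesis by (simp add: Cauchy_convergent_iff)
qed

lemma L2fun_indicator:
  assumes "A \<in> sets borel" "emeasure lborel A < \<infinity>"
  shows "L2fun (indicator A)"
proof -
  have "(\<lambda>x. (indicator A x :: real)\<^sup>2) = indicator A" by (auto simp: indicator_def)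
  moreover have "integrable lborel (indicator A :: vel \<Rightarrow> real)"
    using assms by (intro integrable_real_indicator) auto
  ultimately show ?thesis using assms(1) unfolding L2fun_def by simp
qed

lemma emeasure_lborel_Int_ball_finite:
  fixes c :: "'a::euclidean_space"
  shows "emeasure lborel (A \<inter> ball c R) < \<infinity>"
proof -
  have "emeasure lborel (A \<inter> ball c R) \<le> emeasure lborel (ball c R)" by (rule emeasure_mono) auto
  then show ?thesis using emeasure_lborel_ball_finite[of c R] by (rule le_less_trans)
qed

lemma L2fun_indicator_ball:
  assumes "A \<in> sets borel"
  shows "L2fun (indicator (A \<inter> ball 0 R))"
  by (rule L2fun_indicator) (use assms in \<open>auto intro: emeasure_lborel_Int_ball_finite[unfolded infinity_ennreal_def]\<close>)

text \<open>Weak convergence on a bounded sequence is tested on a countable intersection-stable family of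
  sets first, then on Borel sets of finite measure, simple functions, and all of $L^2$.\<close>

lemma L2weak_from_sets:
  assumes L2: "\<And>n. L2fun (h n)" and B: "\<And>n. (LINT x|lborel. (h n x)\<^sup>2) \<le> B"
    and G: "Int_stable G" "sigma_sets UNIV G = sets (borel :: vel measure)"
    and UG: "UNIV \<in> G"
    and conv: "\<And>A N. A \<in> G \<Longrightarrow> convergent (\<lambda>n. LINT x|lborel. indicator (A \<inter> ball 0 (real N)) x * h n x)"
  shows "L2weak h"
proof -
  have GP: "G \<subseteq> Pow UNIV" by simp
  have sets: "convergent (\<lambda>n. LINT x|lborel. indicator (A \<inter> ball 0 (real N)) x * h n x)"
    if A: "A \<in> sigma_sets UNIV G" for A N
    using G(1) GP A
  proof (induction rule: sigma_sets_induct_disjoint)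
    case (basic A) then show ?case by (rule conv)
  next
    case empty then show ?case by (simp add: convergent_const)
  next
    case (compl A)
    have [measurable]: "A \<in> sets borel" using compl(1) G(2) by simp
    have i: "L2fun (indicator (X \<inter> ball 0 (real N)))" if "X \<in> sets borel" for X :: "vel set"
      using that by (rule L2fun_indicator_ball)
    \<comment> \<open>The complement is taken inside the ball, whose own pairing converges because
      \<open>UNIV\<close> belongs to \<open>G\<close>.\<close>
    have "(LINT x|lborel. indicator ((UNIV - A) \<inter> ball 0 (real N)) x * h n x)
        = (LINT x|lborel. indicator (UNIV \<inter> ball 0 (real N)) x * h n x) - (LINT x|lborel. indicator (A \<inter> ball 0 (real N)) x * h n x)" for n
    proof -
      have "(LINT x|lborel. indicator ((UNIV - A) \<inter> ball 0 (real N)) x * h n x)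
        = (LINT x|lborel. indicator (UNIV \<inter> ball 0 (real N)) x * h n x - indicator (A \<inter> ball 0 (real N)) x * h n x)"
        by (rule Bochner_Integration.integral_cong) (auto simp: indicator_def)
      also have "\<dots> = (LINT x|lborel. indicator (UNIV \<inter> ball 0 (real N)) x * h n x) - (LINT x|lborel. indicator (A \<inter> ball 0 (real N)) x * h n x)"
        by (intro Bochner_Integration.integral_diff L2fun_mult_integrable i L2) measurable
      finally show ?thesis .
    qed
    then show ?case using conv[OF UG, of N] compl(2) by (auto intro: convergent_diff)
  next
    case (union A)
    have Am [measurable]: "A i \<in> sets borel" for i using union(2) G(2) by auto
    define U where "U k = (\<Union>i<k. A i) \<inter> ball 0 (real N)" for k
    have Um [measurable]: "U k \<in> sets borel" for k by (simp add: U_def)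
    let ?V = "(\<Union>i. A i) \<inter> ball 0 (real N)"
    have UL: "L2fun (indicator (U k))" for k
      unfolding U_def by (rule L2fun_indicator_ball) measurable
    have VL: "L2fun (indicator ?V)"
      by (rule L2fun_indicator_ball) measurable
    show ?case
    proof (rule L2weak_test_approx[OF L2 B])
      fix e :: real assume "e > 0"
      \<comment> \<open>Inside a ball of finite measure the finite unions approximate the countable
        union in L2.\<close>
      have "(\<lambda>k. LINT x|lborel. (indicator ?V x - indicator (U k) x)\<^sup>2) \<longlonglongrightarrow> (LINT x|lborel. (indicator ?V (x::vel) - indicator ?V x)\<^sup>2 :: real)"
      proof (rule integral_dominated_convergence[where w="indicator (ball 0 (real N))"])
        show "AE x in lborel. (\<lambda>k. (indicator ?V x - indicator (U k) x)\<^sup>2 :: real) \<longlonglongrightarrow> (indicator ?V x - indicator ?V x)\<^sup>2"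
        proof (rule AE_I2, intro tendsto_intros)
          fix x :: vel
          have eq: "?V = (\<Union>k. U k)" unfolding U_def by auto
          have "incseq U" unfolding U_def by (intro monoI Int_mono UN_mono) auto
          then show "(\<lambda>k. indicator (U k) x :: real) \<longlonglongrightarrow> indicator ?V x" unfolding eq
            by (rule LIMSEQ_indicator_incseq)
        qed
        show "integrable lborel (indicator (ball 0 (real N)) :: vel \<Rightarrow> real)"
          by (intro integrable_real_indicator emeasure_lborel_ball_finite) measurable
      qed (auto simp: indicator_def U_def)
      then obtain k where "\<bar>LINT x|lborel. (indicator ?V x - indicator (U k) x)\<^sup>2\<bar> < e"
        using LIMSEQ_D[OF _ \<open>e > 0\<close>] by fastforce
      moreover have "convergent (\<lambda>n. LINT x|lborel. indicator (U k) x * h n x)"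
      proof -
        have "(LINT x|lborel. indicator (U k) x * h n x) = (\<Sum>i<k. LINT x|lborel. indicator (A i \<inter> ball 0 (real N)) x * h n x)" for n
        proof -
          have "(LINT x|lborel. indicator (U k) x * h n x) = (LINT x|lborel. (\<Sum>i<k. indicator (A i \<inter> ball 0 (real N)) x * h n x))"
          proof (rule Bochner_Integration.integral_cong)
            fix x
            have "indicator (\<Union>i<k. A i) x = (\<Sum>i<k. indicator (A i) x :: real)"
              using union(1) by (intro indicator_UN_disjoint) (auto simp: disjoint_family_on_def)
            then show "indicator (U k) x * h n x = (\<Sum>i<k. indicator (A i \<inter> ball 0 (real N)) x * h n x)"
              by (simp only: U_def indicator_inter_arith sum_distrib_right)
          qed simp
          also have "\<dots> = (\<Sum>i<k. LINT x|lborel. indicator (A i \<inter> ball 0 (real N)) x * h n x)"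
            by (intro Bochner_Integration.integral_sum L2fun_mult_integrable L2 L2fun_indicator_ball Am)
          finally show ?thesis .
        qed
        then show ?thesis by (simp add: convergent_sum union(3))
      qed
      ultimately show "\<exists>k'. L2fun k' \<and> (LINT x|lborel. (indicator ?V x - k' x)\<^sup>2) \<le> e \<and>
          convergent (\<lambda>n. LINT x|lborel. k' x * h n x)"
        using UL[of k] by (intro exI[of _ "indicator (U k)"]) auto
    qed (rule VL)
  qed
  have "convergent (\<lambda>n. LINT x|lborel. k x * h n x)" if k: "L2fun k" for k
  proof (rule L2weak_test_approx[OF L2 B k])
    fix e :: real assume "e > 0"
    note [measurable] = L2fun_measurable[OF k]
    obtain F where F: "\<And>i. simple_function lborel (F i)" "\<And>x. (\<lambda>i. F i x) \<longlonglongrightarrow> k x"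
       "\<And>i x. dist (F i x) 0 \<le> 2 * dist (k x) 0"
      using borel_measurable_implies_sequence_metric[of k lborel 0] by auto
    have [measurable]: "F i \<in> borel_measurable borel" for i
      using borel_measurable_simple_function[OF F(1)] by simp
    define f where "f N x = F N x * indicator (ball 0 (real N)) x" for N x
    have [measurable]: "f N \<in> borel_measurable borel" for N unfolding f_def by (intro borel_measurable_times borel_measurable_indicator) auto
    \<comment> \<open>The simple approximants satisfy |F| <= 2 |k|, hence |k - f| <= 3 |k|, which
      explains the factor 9.\<close>
    have "(\<lambda>N. LINT x|lborel. (k x - f N x)\<^sup>2) \<longlonglongrightarrow> (LINT x|lborel. (k x - k x)\<^sup>2)"
    proof (rule integral_dominated_convergence[where w="\<lambda>x. 9 * (k x)\<^sup>2"])
      show "integrable lborel (\<lambda>x. 9 * (k x)\<^sup>2)" using L2fun_sq_integrable[OF k] by simp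
      show "AE x in lborel. (\<lambda>N. (k x - f N x)\<^sup>2) \<longlonglongrightarrow> (k x - k x)\<^sup>2"
      proof (rule AE_I2, intro tendsto_intros)
        fix x :: vel
        have "(\<lambda>N. f N x) \<longlonglongrightarrow> k x * 1" unfolding f_def
        proof (intro tendsto_mult F(2))
          obtain N0 where N0: "norm x < real N0" using reals_Archimedean2 by blast
          show "(\<lambda>N. indicator (ball 0 (real N)) x) \<longlonglongrightarrow> (1::real)"
            by (rule tendsto_eventually, unfold eventually_sequentially, rule exI[of _ N0])
              (use N0 in \<open>auto simp: indicator_def\<close>)
        qed
        then show "(\<lambda>N. f N x) \<longlonglongrightarrow> k x" by simp
      qed
      fix N
      show "AE x in lborel. norm ((k x - f N x)\<^sup>2) \<le> 9 * (k x)\<^sup>2"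
      proof (rule AE_I2)
        fix x
        have "\<bar>f N x\<bar> \<le> 2 * \<bar>k x\<bar>" using F(3)[of N x] by (auto simp: f_def indicator_def)
        then have "\<bar>k x - f N x\<bar> \<le> \<bar>3 * k x\<bar>" by linarith
        then have "(k x - f N x)\<^sup>2 \<le> (3 * k x)\<^sup>2" by (rule abs_le_square_iff[THEN iffD1])
        then show "norm ((k x - f N x)\<^sup>2) \<le> 9 * (k x)\<^sup>2" by (simp add: power_mult_distrib)
      qed
    qed measurable
    then obtain N where N: "\<bar>LINT x|lborel. (k x - f N x)\<^sup>2\<bar> < e"
      using LIMSEQ_D[OF _ \<open>e > 0\<close>] by fastforce
    have finr: "finite (range (F N))" using F(1)[of N] by (simp add: simple_function_def)
    have im [measurable]: "F N -` {y} \<in> sets borel" for y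
      using F(1)[of N] by (auto dest: simple_functionD(2)[of _ _ "{y}"])
    have feq: "f N x = (\<Sum>y\<in>range (F N). y * indicator (F N -` {y} \<inter> ball 0 (real N)) x)" for x
    proof -
      have "(\<Sum>y\<in>range (F N). y * indicator (F N -` {y} \<inter> ball 0 (real N)) x)
         = (\<Sum>y\<in>range (F N). if y = F N x then F N x * indicator (ball 0 (real N)) x else 0)"
        by (intro sum.cong) (auto simp: indicator_def)
      also have "\<dots> = f N x" using finr by (simp add: f_def)
      finally show ?thesis by simp
    qed
    have iL: "L2fun (indicator (F N -` {y} \<inter> ball 0 (real N)))" for y
      by (rule L2fun_indicator_ball[OF im])
    have fL: "L2fun (f N)" unfolding feq by (intro L2fun_sum L2fun_cmult iL)
    have "(LINT x|lborel. f N x * h n x) = (\<Sum>y\<in>range (F N). y * (LINT x|lborel. indicator (F N -` {y} \<inter> ball 0 (real N)) x * h n x))" for n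
      unfolding feq sum_distrib_right mult.assoc
      by (subst Bochner_Integration.integral_sum) (auto intro!: L2fun_mult_integrable L2 iL integrable_mult_right)
    then have "convergent (\<lambda>n. LINT x|lborel. f N x * h n x)"
      using sets[of "F N -` {_}" N] im G(2) by (auto intro!: convergent_sum convergent_mult convergent_const)
    with N fL show "\<exists>k'. L2fun k' \<and> (LINT x|lborel. (k x - k' x)\<^sup>2) \<le> e \<and>
          convergent (\<lambda>n. LINT x|lborel. k' x * h n x)"
      by (intro exI[of _ "f N"]) auto
  qed
  with L2 B show ?thesis unfolding L2weak_def by blast
qed

text \<open>Finite intersections of a countable basis; the empty intersection contributes
  \<open>UNIV\<close>. Countability permits the diagonal argument, stability under intersection the
  induction over disjoint unions.\<close>

lemma countable_Int_stable_borel: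
  obtains G :: "'a::second_countable_topology set set"
  where "countable G" "Int_stable G" "UNIV \<in> G" "sigma_sets UNIV G = sets borel"
proof -
  obtain B :: "'a set set" where B: "countable B" "topological_basis B"
    using ex_countable_basis by blast
  define G where "G = Inter ` {F. finite F \<and> F \<subseteq> B}"
  have 1: "countable G" unfolding G_def by (intro countable_image countable_Collect_finite_subset B)
  have 2: "Int_stable G"
    unfolding Int_stable_def G_def
  proof safe
    fix F F' assume "finite F" "F \<subseteq> B" "finite F'" "F' \<subseteq> B"
    then show "\<Inter> F \<inter> \<Inter> F' \<in> Inter ` {F. finite F \<and> F \<subseteq> B}"
      by (intro image_eqI[of _ _ "F \<union> F'"]) auto
  qed
  have 3: "UNIV \<in> G" unfolding G_def by (rule image_eqI[of _ _ "{}"]) auto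
  have "B \<subseteq> G" unfolding G_def
  proof
    fix b assume "b \<in> B" then show "b \<in> Inter ` {F. finite F \<and> F \<subseteq> B}" by (intro image_eqI[of _ _ "{b}"]) auto
  qed
  moreover have "G \<subseteq> sets borel"
    unfolding G_def using topological_basis_open[OF B(2)] by (auto intro!: borel_open open_Inter)
  ultimately have "B \<subseteq> G" "G \<subseteq> sets borel" by auto
  have 4: "sigma_sets UNIV G = sets borel"
  proof (intro antisym)
    show "sigma_sets UNIV G \<subseteq> sets borel"
      using sets.sigma_sets_subset[OF \<open>G \<subseteq> sets borel\<close>] by simp
    have "sets borel = sigma_sets UNIV B"
      unfolding borel_eq_countable_basis[OF B] by (rule sets_measure_of) simp
    also have "\<dots> \<subseteq> sigma_sets UNIV G" by (rule sigma_sets_mono') fact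
    finally show "sets borel \<subseteq> sigma_sets UNIV G" .
  qed
  from 1 2 3 4 show ?thesis by (rule that)
qed

text \<open>Sequential Banach--Alaoglu for a bounded sequence: the pairings with countably many
  bounded test sets are bounded real sequences, and one diagonal subsequence makes all of them
  converge.\<close>

lemma L2weak_subsequence:
  fixes h :: "nat \<Rightarrow> vel \<Rightarrow> real"
  assumes L2: "\<And>n. L2fun (h n)" and B: "\<And>n. (LINT x|lborel. (h n x)\<^sup>2) \<le> B"
  shows "\<exists>sub. strict_mono sub \<and> L2weak (\<lambda>n. h (sub n))"
proof -
  obtain G :: "vel set set" where G: "countable G" "Int_stable G" "UNIV \<in> G" "sigma_sets UNIV G = sets borel"
    by (rule countable_Int_stable_borel)
  \<comment> \<open>The index \<open>i\<close> encodes a pair: a member of \<open>G\<close> and the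
    radius of the ball.\<close>
  define c where "c i n = (LINT x|lborel. indicator (from_nat_into G (fst (prod_decode i)) \<inter> ball 0 (real (snd (prod_decode i)))) x * h n x)" for i n
  have Gb: "A \<in> sets borel" if "A \<in> G" for A using G(4) that by (metis sigma_sets.Basic)
  have "bounded (range (c i))" for i
  proof -
    let ?A = "from_nat_into G (fst (prod_decode i)) \<inter> ball 0 (real (snd (prod_decode i)))"
    have "from_nat_into G (fst (prod_decode i)) \<in> sets borel" using Gb from_nat_into[of G] G(3) by auto
    note I0 = L2fun_indicator_ball[OF this]
    have I: "L2fun (indicator ?A)"
      using I0 by simp
    have "(c i n)\<^sup>2 \<le> (LINT x|lborel. (indicator ?A x)\<^sup>2) * B" for n
      unfolding c_def
      by (rule order_trans[OF L2_Cauchy_Schwarz[OF I L2]]) (intro mult_left_mono B, auto intro: integral_nonneg_AE)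
    then have "\<bar>c i n\<bar> \<le> sqrt ((LINT x|lborel. (indicator ?A x)\<^sup>2) * B)" for n
      by (metis real_sqrt_abs real_sqrt_le_mono)
    then show ?thesis by (intro boundedI) auto
  qed
  then have cc: "\<exists>r'. strict_mono r' \<and> convergent (\<lambda>n. c i (s (r' n)))" for i and s :: "nat \<Rightarrow> nat"
  proof -
    have "bounded (range (\<lambda>n. c i (s n)))" using \<open>bounded (range (c i))\<close> by (rule bounded_subset) auto
    then obtain l r where "strict_mono r" "((\<lambda>n. c i (s n)) \<circ> r) \<longlonglongrightarrow> l" using bounded_imp_convergent_subsequence by blast
    then show ?thesis unfolding convergent_def o_def by blast
  qed
  interpret S: subseqs "\<lambda>i s. convergent (\<lambda>n. c i (s n))"
    by unfold_locales (use cc in \<open>auto simp: o_def\<close>)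
  have conv: "convergent (\<lambda>n. c i (S.diagseq n))" for i
  proof -
    \<comment> \<open>The diagonal sequence refines the \<open>i\<close>-th extraction only from
      index \<open>Suc i\<close> on, so convergence is shown for the shifted sequence and the shift
      is removed afterwards.\<close>
    have "convergent (\<lambda>n. c i ((S.diagseq \<circ> ((+) (Suc i))) n))"
    proof (rule S.diagseq_holds)
      fix r s :: "nat \<Rightarrow> nat" and n assume "strict_mono r" "convergent (\<lambda>na. c n (s na))"
      then show "convergent (\<lambda>na. c n ((s \<circ> r) na))"
        using convergent_subseq_convergent[of "\<lambda>na. c n (s na)" r] by (simp add: o_def)
    qed
    then have "convergent (\<lambda>n. c i (S.diagseq (n + Suc i)))" by (simp add: add.commute)
    then show ?thesis by (subst (asm) convergent_ignore_initial_segment)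
  qed
  have "L2weak (\<lambda>n. h (S.diagseq n))"
  proof (rule L2weak_from_sets[OF L2 B G(2,4,3)])
    fix A N assume "A \<in> G"
    then obtain a where a: "from_nat_into G a = A" using from_nat_into_surj[OF G(1)] by blast
    show "convergent (\<lambda>n. LINT x|lborel. indicator (A \<inter> ball 0 (real N)) x * h (S.diagseq n) x)"
      using conv[of "prod_encode (a, N)"] by (simp add: c_def a)
  qed
  then show ?thesis using S.subseq_diagseq by blast
qed

lemma L2weak_subseq:
  assumes "L2weak h" "strict_mono sub"
  shows "L2weak (\<lambda>n. h (sub n))"
proof -
  have "convergent (\<lambda>n. LINT x|lborel. k x * h (sub n) x)" if "L2fun k" for k
    using convergent_subseq_convergent[of "\<lambda>n. LINT x|lborel. k x * h n x" sub] assms that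
    by (simp add: L2weak_def o_def)
  then show ?thesis using assms(1) unfolding L2weak_def by blast
qed

text \<open>Components are treated one at a time; those already handled stay weakly convergent under
  further thinning.\<close>

lemma L2weak_subsequence_finite:
  fixes h :: "nat \<Rightarrow> 'i \<Rightarrow> vel \<Rightarrow> real"
  assumes "finite I" and L2: "\<And>n i. i \<in> I \<Longrightarrow> L2fun (h n i)"
    and B: "\<And>n i. i \<in> I \<Longrightarrow> (LINT x|lborel. (h n i x)\<^sup>2) \<le> B"
  shows "\<exists>sub. strict_mono sub \<and> (\<forall>i\<in>I. L2weak (\<lambda>n. h (sub n) i))"
  using assms
proof (induction I)
  case empty then show ?case by (intro exI[of _ id]) (auto simp: strict_mono_def)
next
  case (insert j I)
  then obtain s where s: "strict_mono s" "\<forall>i\<in>I. L2weak (\<lambda>n. h (s n) i)" by auto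
  have "\<exists>t. strict_mono t \<and> L2weak (\<lambda>n. h (s (t n)) j)"
    by (rule L2weak_subsequence[of "\<lambda>n. h (s n) j" B]) (use insert in auto)
  then obtain t where t: "strict_mono t" "L2weak (\<lambda>n. h (s (t n)) j)" by blast
  have "L2weak (\<lambda>n. h ((s \<circ> t) n) i)" if "i \<in> insert j I" for i
    using that t(2) s(2) L2weak_subseq[of "\<lambda>n. h (s n) i" t, OF _ t(1)] by auto
  then show ?case
    using strict_mono_o[OF s(1) t(1)] by blast
qed

section \<open>Stability of norm convergence under limits, sums and almost everywhere
  equality\<close>

lemma L2Cauchy_tendsto:
  assumes "\<And>n. L2fun (f n)" "L2fun g" "(\<lambda>n. LINT x|lborel. (f n x - g x)\<^sup>2) \<longlonglongrightarrow> 0"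
  shows "L2Cauchy f"
  unfolding L2Cauchy_def
proof (intro conjI allI impI assms(1))
  fix e :: real assume "e > 0"
  then obtain N where N: "\<And>n. n \<ge> N \<Longrightarrow> \<bar>LINT x|lborel. (f n x - g x)\<^sup>2\<bar> < e/4"
    using LIMSEQ_D[OF assms(3), of "e/4"] by auto
  have "(LINT x|lborel. (f m x - f n x)\<^sup>2) \<le> e" if "m \<ge> N" "n \<ge> N" for m n
    using L2_sq_diff_le[of "\<lambda>x. f m x - g x" "\<lambda>x. f n x - g x"] N[OF that(1)] N[OF that(2)] assms(1,2)
    by (simp add: L2fun_diff)
  then show "\<exists>N. \<forall>m\<ge>N. \<forall>n\<ge>N. (LINT x|lborel. (f m x - f n x)\<^sup>2) \<le> e" by blast
qed

text \<open>The error is uniform in \<open>n\<close>. This is how norm convergence of the images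
  survives when an operator is replaced by one close to it in operator norm.\<close>

lemma L2Cauchy_approx:
  assumes L2: "\<And>n. L2fun (f n)"
    and approx: "\<And>e. e > 0 \<Longrightarrow> \<exists>f'. L2Cauchy f' \<and> (\<forall>n. (LINT x|lborel. (f n x - f' n x)\<^sup>2) \<le> e)"
  shows "L2Cauchy f"
  unfolding L2Cauchy_def
proof (intro conjI allI impI L2)
  fix e :: real assume e: "e > 0"
  \<comment> \<open>With 1/16 here and 1/4 below, the two applications of (a + b)^2 <= 2 a^2 + 2 b^2
    add up to e/2 + e/2.\<close>
  then obtain f' where f': "L2Cauchy f'" and close: "\<And>n. (LINT x|lborel. (f n x - f' n x)\<^sup>2) \<le> e/16"
    using approx[of "e/16"] by auto
  have L2': "L2fun (f' n)" for n using f' by (simp add: L2Cauchy_def)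
  obtain N where N: "\<And>m n. m \<ge> N \<Longrightarrow> n \<ge> N \<Longrightarrow> (LINT x|lborel. (f' m x - f' n x)\<^sup>2) \<le> e/4"
    using f' e unfolding L2Cauchy_def by (meson divide_pos_pos zero_less_numeral)
  have "(LINT x|lborel. (f m x - f n x)\<^sup>2) \<le> e" if "m \<ge> N" "n \<ge> N" for m n
  proof -
    have "(LINT x|lborel. (f m x - f n x)\<^sup>2)
        = (LINT x|lborel. ((f' m x - f' n x) + ((f m x - f' m x) - (f n x - f' n x)))\<^sup>2)"
      by (simp add: algebra_simps)
    also have "\<dots> \<le> 2 * (LINT x|lborel. (f' m x - f' n x)\<^sup>2) + 2 * (LINT x|lborel. ((f m x - f' m x) - (f n x - f' n x))\<^sup>2)"
      by (intro L2_sq_add_le L2fun_diff L2 L2')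
    finally have 1: "(LINT x|lborel. (f m x - f n x)\<^sup>2) \<le>
        2 * (LINT x|lborel. (f' m x - f' n x)\<^sup>2) + 2 * (LINT x|lborel. ((f m x - f' m x) - (f n x - f' n x))\<^sup>2)" .
    have "(LINT x|lborel. ((f m x - f' m x) - (f n x - f' n x))\<^sup>2)
        \<le> 2 * (LINT x|lborel. (f m x - f' m x)\<^sup>2) + 2 * (LINT x|lborel. (f n x - f' n x)\<^sup>2)"
      by (intro L2_sq_diff_le L2fun_diff L2 L2')
    with 1 show ?thesis using N[OF that] close[of m] close[of n] by linarith
  qed
  then show "\<exists>N. \<forall>m\<ge>N. \<forall>n\<ge>N. (LINT x|lborel. (f m x - f n x)\<^sup>2) \<le> e" by blast
qed

lemma L2Cauchy_add:
  assumes f: "L2Cauchy f" and g: "L2Cauchy g"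
  shows "L2Cauchy (\<lambda>n x. f n x + g n x)"
  unfolding L2Cauchy_def
proof (intro conjI allI impI)
  have L2: "L2fun (f n)" "L2fun (g n)" for n using f g by (auto simp: L2Cauchy_def)
  then show "L2fun (\<lambda>x. f n x + g n x)" for n by (intro L2fun_add)
  fix e :: real assume e: "e > 0"
  obtain N where N: "\<And>m n. m \<ge> N \<Longrightarrow> n \<ge> N \<Longrightarrow> (LINT x|lborel. (f m x - f n x)\<^sup>2) \<le> e/4"
    using f e unfolding L2Cauchy_def by (meson divide_pos_pos zero_less_numeral)
  obtain M where M: "\<And>m n. m \<ge> M \<Longrightarrow> n \<ge> M \<Longrightarrow> (LINT x|lborel. (g m x - g n x)\<^sup>2) \<le> e/4"
    using g e unfolding L2Cauchy_def by (meson divide_pos_pos zero_less_numeral)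
  have "(LINT x|lborel. ((f m x + g m x) - (f n x + g n x))\<^sup>2) \<le> e" if "m \<ge> max M N" "n \<ge> max M N" for m n
  proof -
    have "(LINT x|lborel. ((f m x + g m x) - (f n x + g n x))\<^sup>2) = (LINT x|lborel. ((f m x - f n x) + (g m x - g n x))\<^sup>2)"
      by (simp add: algebra_simps)
    also have "\<dots> \<le> 2 * (LINT x|lborel. (f m x - f n x)\<^sup>2) + 2 * (LINT x|lborel. (g m x - g n x)\<^sup>2)"
      by (intro L2_sq_add_le L2fun_diff L2)
    finally show ?thesis using N[of m n] M[of m n] that by simp
  qed
  then show "\<exists>N. \<forall>m\<ge>N. \<forall>n\<ge>N. (LINT x|lborel. ((f m x + g m x) - (f n x + g n x))\<^sup>2) \<le> e" by blast
qed

lemma L2Cauchy_uminus: "L2Cauchy f \<Longrightarrow> L2Cauchy (\<lambda>n x. - f n x)"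
  using L2fun_cmult[of _ "-1"] by (simp add: L2Cauchy_def power2_commute)

lemma L2Cauchy_zero: "L2Cauchy (\<lambda>n x. 0)"
  by (auto simp: L2Cauchy_def L2fun_zero)

lemma L2Cauchy_sum: "(\<And>i. i \<in> I \<Longrightarrow> L2Cauchy (f i)) \<Longrightarrow> L2Cauchy (\<lambda>n x. \<Sum>i\<in>I. f i n x)"
  by (induction I rule: infinite_finite_induct) (auto intro: L2Cauchy_add L2Cauchy_zero)

lemma L2Cauchy_cong_AE:
  assumes f: "L2Cauchy f" and [measurable]: "\<And>n. g n \<in> borel_measurable borel"
    and eq: "\<And>n. AE x in lborel. f n x = g n x"
  shows "L2Cauchy g"
  unfolding L2Cauchy_def
proof (intro conjI allI impI)
  have L2: "L2fun (f n)" for n using f by (auto simp: L2Cauchy_def)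
  note [measurable] = L2fun_measurable[OF L2]
  show L2g: "L2fun (g n)" for n by (rule L2fun_cong_AE[OF L2 _ eq]) measurable
  fix e :: real assume e: "e > 0"
  have "(LINT x|lborel. (g m x - g n x)\<^sup>2) = (LINT x|lborel. (f m x - f n x)\<^sup>2)" for m n
    by (rule integral_cong_AE) (use eq[of m] eq[of n] in auto)
  then show "\<exists>N. \<forall>m\<ge>N. \<forall>n\<ge>N. (LINT x|lborel. (g m x - g n x)\<^sup>2) \<le> e"
    using f e by (simp add: L2Cauchy_def)
qed

text \<open>The step from pointwise to norm convergence. The pointwise hypothesis will be met
  because each value \<open>f n x\<close> is a pairing of a weakly convergent sequence with a fixed
  test function.\<close>

lemma L2Cauchy_dominated:
  assumes L2: "\<And>n. L2fun (f n)" and conv: "AE x in lborel. convergent (\<lambda>n. f n x)"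
    and w: "integrable lborel w" and dom: "\<And>n. AE x in lborel. (f n x)\<^sup>2 \<le> w x"
  shows "L2Cauchy f"
proof -
  note [measurable] = L2fun_measurable[OF L2]
  define g where "g x = lim (\<lambda>n. f n x)" for x
  have [measurable]: "g \<in> borel_measurable borel" unfolding g_def by measurable
  have lim: "AE x in lborel. (\<lambda>n. f n x) \<longlonglongrightarrow> g x"
    using conv by eventually_elim (simp add: g_def convergent_LIMSEQ_iff)
  have dom': "AE x in lborel. \<forall>n. (f n x)\<^sup>2 \<le> w x" using dom by (simp add: AE_all_countable)
  have gw: "AE x in lborel. (g x)\<^sup>2 \<le> w x"
    using lim dom'
  proof eventually_elim
    case (elim x)
    show ?case by (rule tendsto_upperbound[OF tendsto_power[OF elim(1)]]) (use elim(2) in auto)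
  qed
  have "integrable lborel (\<lambda>x. (g x)\<^sup>2)"
    by (rule Bochner_Integration.integrable_bound[OF w]) (use gw in \<open>auto elim: eventually_mono\<close>)
  then have g: "L2fun g" by (simp add: L2fun_def)
  have "(\<lambda>n. LINT x|lborel. (f n x - g x)\<^sup>2) \<longlonglongrightarrow> (LINT x|(lborel :: vel measure). 0)"
  proof (rule integral_dominated_convergence[where w="\<lambda>x. 4 * w x"])
    show "integrable lborel (\<lambda>x. 4 * w x)" using w by simp
    show "AE x in lborel. (\<lambda>n. (f n x - g x)\<^sup>2) \<longlonglongrightarrow> 0"
      using lim
    proof eventually_elim
      case (elim x)
      then have "(\<lambda>n. (f n x - g x)\<^sup>2) \<longlonglongrightarrow> (g x - g x)\<^sup>2" by (intro tendsto_intros)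
      then show ?case by simp
    qed
    fix n
    show "AE x in lborel. norm ((f n x - g x)\<^sup>2) \<le> 4 * w x"
      using gw dom'
    proof eventually_elim
      case (elim x)
      have "0 \<le> (f n x + g x)\<^sup>2" by simp
      then have "(f n x - g x)\<^sup>2 \<le> 2 * (f n x)\<^sup>2 + 2 * (g x)\<^sup>2" unfolding power2_sum power2_diff by linarith
      with elim(1) elim(2)[rule_format, of n] show ?case by simp
    qed
  qed measurable
  then show ?thesis using L2Cauchy_tendsto[OF L2 g] by simp
qed

text \<open>Riesz representation of a positive functional, obtained from Radon--Nikodym because the
  functional is given by a measure.\<close>

lemma L2_functional_density:
  fixes \<beta> :: "'y::euclidean_space \<Rightarrow> ennreal" and \<zeta> :: "'y \<Rightarrow> vel"
  assumes [measurable]: "\<beta> \<in> borel_measurable borel" "\<zeta> \<in> borel_measurable borel"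
    and c: "c < \<infinity>"
    and bound: "\<And>f. f \<in> borel_measurable borel \<Longrightarrow>
      (\<integral>\<^sup>+y. \<beta> y * f (\<zeta> y) \<partial>lborel)\<^sup>2 \<le> c * (\<integral>\<^sup>+x. (f x)\<^sup>2 \<partial>lborel)"
  shows "\<exists>k. L2fun k \<and> (\<forall>x. k x \<ge> 0) \<and>
    (\<forall>f \<in> borel_measurable borel. (\<integral>\<^sup>+y. \<beta> y * f (\<zeta> y) \<partial>lborel) = (\<integral>\<^sup>+x. ennreal (k x) * f x \<partial>lborel))"
proof -
  define N where "N = distr (density lborel \<beta>) (borel :: vel measure) \<zeta>"
  have Nint: "(\<integral>\<^sup>+x. f x \<partial>N) = (\<integral>\<^sup>+y. \<beta> y * f (\<zeta> y) \<partial>lborel)" if [measurable]: "f \<in> borel_measurable borel" for f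
    unfolding N_def by (subst nn_integral_distr) (auto simp: nn_integral_density)
  have sN [measurable_cong]: "sets N = sets borel" by (simp add: N_def)
  \<comment> \<open>The L2 bound applied to the indicator of a Lebesgue null set shows that the set
    is null for \<open>N\<close>.\<close>
  have ac: "absolutely_continuous lborel N"
    unfolding absolutely_continuous_def
  proof
    fix A :: "vel set" assume A: "A \<in> null_sets lborel"
    then have [measurable]: "A \<in> sets borel" by auto
    have "(\<integral>\<^sup>+y. \<beta> y * indicator A (\<zeta> y) \<partial>lborel)\<^sup>2 \<le> c * (\<integral>\<^sup>+x. (indicator A x)\<^sup>2 \<partial>lborel)"
      by (rule bound) measurable
    also have "(\<integral>\<^sup>+x. (indicator A x :: ennreal)\<^sup>2 \<partial>lborel) = (\<integral>\<^sup>+x. indicator A x \<partial>lborel)"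
      by (intro nn_integral_cong) (auto simp: indicator_def)
    also have "\<dots> = 0" using A by auto
    finally have "(\<integral>\<^sup>+y. \<beta> y * indicator A (\<zeta> y) \<partial>lborel) = 0" by simp
    then have "(\<integral>\<^sup>+x. indicator A x \<partial>N) = 0" by (subst Nint) auto
    then show "A \<in> null_sets N" by (auto simp: null_sets_def sN)
  qed
  define k0 where "k0 = RN_deriv lborel N"
  have [measurable]: "k0 \<in> borel_measurable borel" unfolding k0_def using borel_measurable_RN_deriv[of lborel N] by simp
  have dN: "density lborel k0 = N"
    unfolding k0_def by (rule sigma_finite_measure.density_RN_deriv) (auto intro: sigma_finite_lborel ac simp: sN)
  have rep: "(\<integral>\<^sup>+y. \<beta> y * f (\<zeta> y) \<partial>lborel) = (\<integral>\<^sup>+x. k0 x * f x \<partial>lborel)" if [measurable]: "f \<in> borel_measurable borel" for f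
    by (subst Nint[symmetric], simp, subst dN[symmetric]) (simp add: nn_integral_density)
  \<comment> \<open>The density truncated in height and in support has a finite L2 norm. Testing the
    functional with this truncation bounds \<open>q * q\<close> by \<open>c * q\<close>, and
    finiteness permits the cancellation of one \<open>q\<close>; the truncation is removed by
    Fatou.\<close>
  define f where "f n x = min (k0 x) (of_nat n) * indicator (ball 0 (real n)) x" for n :: nat and x
  have [measurable]: "f n \<in> borel_measurable borel" for n
    unfolding f_def by (intro borel_measurable_times_ennreal borel_measurable_min borel_measurable_indicator) auto
  have q: "(\<integral>\<^sup>+x. (f n x)\<^sup>2 \<partial>lborel) \<le> c" for n
  proof -
    define q where "q = (\<integral>\<^sup>+x. (f n x)\<^sup>2 \<partial>lborel)"
    have "q \<le> (\<integral>\<^sup>+x. (of_nat n)\<^sup>2 * indicator (ball (0::vel) (real n)) x \<partial>lborel)"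
      unfolding q_def f_def by (intro nn_integral_mono) (auto simp: indicator_def intro!: power_mono_ennreal)
    also have "\<dots> = (of_nat n)\<^sup>2 * emeasure lborel (ball (0::vel) (real n))"
      by (subst nn_integral_cmult_indicator) auto
    also have "\<dots> < \<infinity>"
      using emeasure_lborel_ball_finite[of "0::vel" "real n"] by (auto simp: ennreal_mult_less_top power_less_top_ennreal of_nat_less_top)
    finally have qfin: "q < \<infinity>" .
    have "q \<le> (\<integral>\<^sup>+x. k0 x * f n x \<partial>lborel)"
      unfolding q_def power2_eq_square by (intro nn_integral_mono mult_right_mono) (auto simp: f_def indicator_def)
    then have "q\<^sup>2 \<le> (\<integral>\<^sup>+x. k0 x * f n x \<partial>lborel)\<^sup>2" by (rule power_mono_ennreal)
    also have "\<dots> = (\<integral>\<^sup>+y. \<beta> y * f n (\<zeta> y) \<partial>lborel)\<^sup>2" by (subst rep) auto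
    also have "\<dots> \<le> c * q" unfolding q_def by (rule bound) simp
    finally have "q * q \<le> c * q" by (simp add: power2_eq_square)
    then have "q * q \<le> q * c" by (subst mult.commute[of q c])
    then have "q \<le> c" if "q \<noteq> 0"
      using qfin that ennreal_mult_le_mult_iff[of q q c] by (simp add: less_imp_neq)
    then show ?thesis unfolding q_def[symmetric] by (cases "q = 0") auto
  qed
  have "(\<integral>\<^sup>+x. (k0 x)\<^sup>2 \<partial>lborel) \<le> c"
  proof -
    have "(\<integral>\<^sup>+x. (k0 x)\<^sup>2 \<partial>lborel) = (\<integral>\<^sup>+x. liminf (\<lambda>n. (f n x)\<^sup>2) \<partial>lborel)"
    proof (rule nn_integral_cong)
      fix x :: vel
      have 1: "(\<lambda>n. min (k0 x) (of_nat n)) \<longlonglongrightarrow> min (k0 x) top"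
        by (intro tendsto_min tendsto_const of_nat_tendsto_top_ennreal)
      obtain N0 where N0: "norm x < real N0" using reals_Archimedean2 by blast
      have "\<forall>\<^sub>F n in sequentially. min (k0 x) (of_nat n) = f n x"
        unfolding eventually_sequentially by (rule exI[of _ N0]) (use N0 in \<open>auto simp: f_def indicator_def\<close>)
      from Lim_transform_eventually[OF 1 this] have "(\<lambda>n. f n x) \<longlonglongrightarrow> k0 x" by simp
      then have "(\<lambda>n. f n x * f n x) \<longlonglongrightarrow> k0 x * k0 x"
        by (intro tendsto_mult_ennreal) auto
      then show "(k0 x)\<^sup>2 = liminf (\<lambda>n. (f n x)\<^sup>2)"
        by (simp add: lim_imp_Liminf power2_eq_square)
    qed
    also have "\<dots> \<le> liminf (\<lambda>n. \<integral>\<^sup>+x. (f n x)\<^sup>2 \<partial>lborel)" by (rule nn_integral_liminf) simp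
    also have "\<dots> \<le> c" by (rule Liminf_le) (auto simp: q)
    finally show ?thesis .
  qed
  then have fin: "(\<integral>\<^sup>+x. (k0 x)\<^sup>2 \<partial>lborel) < \<infinity>" using c by (rule le_less_trans)
  have "AE x in lborel. (k0 x)\<^sup>2 \<noteq> \<infinity>" by (rule nn_integral_PInf_AE) (use fin in auto)
  then have kk: "AE x in lborel. ennreal (enn2real (k0 x)) = k0 x"
    by eventually_elim (auto simp: power_eq_top_ennreal top.not_eq_extremum[symmetric])
  have "(\<integral>\<^sup>+x. ennreal ((enn2real (k0 x))\<^sup>2) \<partial>lborel) = (\<integral>\<^sup>+x. (k0 x)\<^sup>2 \<partial>lborel)"
    by (rule nn_integral_cong_AE, use kk in eventually_elim) (auto simp: ennreal_power[symmetric])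
  then have "L2fun (\<lambda>x. enn2real (k0 x))" using fin by (simp add: L2fun_iff)
  moreover have "(\<integral>\<^sup>+x. k0 x * f x \<partial>lborel) = (\<integral>\<^sup>+x. ennreal (enn2real (k0 x)) * f x \<partial>lborel)" for f
    by (rule nn_integral_cong_AE, use kk in eventually_elim) auto
  ultimately show ?thesis using rep by (intro exI[of _ "\<lambda>x. enn2real (k0 x)"]) auto
qed

section \<open>Compact operators with positive kernels\<close>

text \<open>No kernel in the pair of velocities is formed: \<open>h\<close> is sampled at
  \<open>Z x y\<close>, and \<open>y\<close> is an auxiliary integration variable. The last clause
  is compactness in the form that weakly convergent sequences have norm convergent images.\<close>

definition compact_kernel :: "(vel \<Rightarrow> 'y::euclidean_space \<Rightarrow> real) \<Rightarrow> (vel \<Rightarrow> 'y \<Rightarrow> vel) \<Rightarrow> bool" where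
  "compact_kernel b Z \<longleftrightarrow>
     (\<forall>h. L2fun h \<longrightarrow> (AE x in lborel. integrable lborel (\<lambda>y. b x y * h (Z x y))) \<and>
        L2fun (\<lambda>x. LINT y|lborel. b x y * h (Z x y))) \<and>
     (\<forall>h. L2weak h \<longrightarrow> L2Cauchy (\<lambda>n x. LINT y|lborel. b x y * h n (Z x y)))"

text \<open>Since \<open>y\<close> is not the point at which \<open>h\<close> is evaluated, there
  are no columns in the literal sense. Their bound takes pushforward form: the image under
  \<open>Z\<close> of the weight \<open>b\<close>, integrated over all \<open>x\<close>, is at most
  \<open>C2\<close> times Lebesgue measure.\<close>

locale schur_kernel =
  fixes b :: "vel \<Rightarrow> 'y::euclidean_space \<Rightarrow> real" and Z :: "vel \<Rightarrow> 'y \<Rightarrow> vel" and C1 C2 :: real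
  assumes b_meas [measurable]: "(\<lambda>(x, y). b x y) \<in> borel_measurable (borel \<Otimes>\<^sub>M borel)"
    and Z_meas [measurable]: "(\<lambda>(x, y). Z x y) \<in> borel_measurable (borel \<Otimes>\<^sub>M borel)"
    and b_nonneg: "b x y \<ge> 0"
    and C_nonneg: "C1 \<ge> 0" "C2 \<ge> 0"
    and row: "(\<integral>\<^sup>+y. ennreal (b x y) \<partial>lborel) \<le> ennreal C1"
    and col: "f \<in> borel_measurable borel \<Longrightarrow>
      (\<integral>\<^sup>+x. \<integral>\<^sup>+y. ennreal (b x y) * f (Z x y) \<partial>lborel \<partial>lborel) \<le> ennreal C2 * (\<integral>\<^sup>+x. f x \<partial>lborel)"
begin

definition T :: "(vel \<Rightarrow> real) \<Rightarrow> vel \<Rightarrow> real" where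
  "T h x = (LINT y|lborel. b x y * h (Z x y))"

lemma b_section [measurable]: "b x \<in> borel_measurable borel"
  using measurable_Pair2[OF b_meas, of x] by simp

lemma Z_section [measurable]: "Z x \<in> borel_measurable borel"
  using measurable_Pair2[OF Z_meas, of x] by simp

text \<open>Cauchy--Schwarz with the weight split as sqrt(b) times sqrt(b) |h|, so that one factor
  is a row sum.\<close>

lemma abs_integral_sq_le:
  assumes [measurable]: "h \<in> borel_measurable borel"
  shows "(\<integral>\<^sup>+y. ennreal \<bar>b x y * h (Z x y)\<bar> \<partial>lborel)\<^sup>2 \<le> ennreal C1 * (\<integral>\<^sup>+y. ennreal (b x y) * ennreal ((h (Z x y))\<^sup>2) \<partial>lborel)"
proof -
  have "(\<integral>\<^sup>+y. ennreal \<bar>b x y * h (Z x y)\<bar> \<partial>lborel)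
     = (\<integral>\<^sup>+y. ennreal (sqrt (b x y)) * ennreal (sqrt (b x y) * \<bar>h (Z x y)\<bar>) \<partial>lborel)"
    by (intro nn_integral_cong) (simp add: ennreal_mult[symmetric] b_nonneg abs_mult mult.assoc[symmetric])
  also have "\<dots>\<^sup>2 \<le> (\<integral>\<^sup>+y. (ennreal (sqrt (b x y)))\<^sup>2 \<partial>lborel) * (\<integral>\<^sup>+y. (ennreal (sqrt (b x y) * \<bar>h (Z x y)\<bar>))\<^sup>2 \<partial>lborel)"
    by (rule Cauchy_Schwarz_nn_integral) measurable
  also have "(\<integral>\<^sup>+y. (ennreal (sqrt (b x y)))\<^sup>2 \<partial>lborel) = (\<integral>\<^sup>+y. ennreal (b x y) \<partial>lborel)"
    by (intro nn_integral_cong) (simp add: ennreal_power b_nonneg)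
  also have "(\<integral>\<^sup>+y. (ennreal (sqrt (b x y) * \<bar>h (Z x y)\<bar>))\<^sup>2 \<partial>lborel) = (\<integral>\<^sup>+y. ennreal (b x y) * ennreal ((h (Z x y))\<^sup>2) \<partial>lborel)"
    by (intro nn_integral_cong) (simp add: ennreal_power b_nonneg ennreal_mult[symmetric] power_mult_distrib)
  finally show ?thesis using row[of x] by (meson mult_right_mono order_trans zero_le)
qed

lemma T_measurable [measurable]:
  assumes [measurable]: "h \<in> borel_measurable borel"
  shows "T h \<in> borel_measurable borel"
  unfolding T_def by measurable

lemma
  assumes h: "L2fun h"
  shows T_integrable: "AE x in lborel. integrable lborel (\<lambda>y. b x y * h (Z x y))"
    and T_bound: "(\<integral>\<^sup>+x. ennreal ((T h x)\<^sup>2) \<partial>lborel) \<le> ennreal (C1 * C2 * (LINT x|lborel. (h x)\<^sup>2))"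
proof -
  note [measurable] = L2fun_measurable[OF h]
  define I where "I x = (\<integral>\<^sup>+y. ennreal (b x y) * ennreal ((h (Z x y))\<^sup>2) \<partial>lborel)" for x
  have [measurable]: "I \<in> borel_measurable borel" unfolding I_def by measurable
  have I: "(\<integral>\<^sup>+x. I x \<partial>lborel) \<le> ennreal C2 * ennreal (LINT x|lborel. (h x)\<^sup>2)"
    unfolding I_def L2fun_nn_integral[OF h, symmetric] by (rule col) measurable
  also have "\<dots> < \<infinity>" by (simp add: ennreal_mult_less_top)
  finally have "(\<integral>\<^sup>+x. I x \<partial>lborel) \<noteq> \<infinity>" by (rule less_imp_neq)
  then have "AE x in lborel. I x \<noteq> \<infinity>" by (intro nn_integral_PInf_AE) measurable
  then show "AE x in lborel. integrable lborel (\<lambda>y. b x y * h (Z x y))"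
  proof eventually_elim
    case (elim x)
    have "(\<integral>\<^sup>+y. ennreal \<bar>b x y * h (Z x y)\<bar> \<partial>lborel)\<^sup>2 \<le> ennreal C1 * I x"
      unfolding I_def by (rule abs_integral_sq_le) measurable
    also have "\<dots> < top" using elim by (simp add: ennreal_mult_less_top top.not_eq_extremum)
    finally have "(\<integral>\<^sup>+y. ennreal \<bar>b x y * h (Z x y)\<bar> \<partial>lborel) < top"
      by (simp add: power_less_top_ennreal)
    then show ?case by (simp add: integrable_iff_bounded)
  qed
  have "ennreal ((T h x)\<^sup>2) \<le> ennreal C1 * I x" for x
  proof (cases "integrable lborel (\<lambda>y. b x y * h (Z x y))")
    case True
    have "ennreal \<bar>T h x\<bar> \<le> (\<integral>\<^sup>+y. ennreal \<bar>b x y * h (Z x y)\<bar> \<partial>lborel)"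
      using integral_norm_bound_ennreal[OF True] by (simp add: T_def)
    then have "(ennreal \<bar>T h x\<bar>)\<^sup>2 \<le> (\<integral>\<^sup>+y. ennreal \<bar>b x y * h (Z x y)\<bar> \<partial>lborel)\<^sup>2" by (rule power_mono_ennreal)
    also have "\<dots> \<le> ennreal C1 * I x" unfolding I_def by (rule abs_integral_sq_le) measurable
    finally show ?thesis by (simp add: ennreal_power)
  next
    \<comment> \<open>Here the integral takes its default value 0, so the pointwise estimate holds
      at every \<open>x\<close>.\<close>
    case False
    then show ?thesis by (simp add: T_def not_integrable_integral_eq)
  qed
  then have "(\<integral>\<^sup>+x. ennreal ((T h x)\<^sup>2) \<partial>lborel) \<le> (\<integral>\<^sup>+x. ennreal C1 * I x \<partial>lborel)"
    by (intro nn_integral_mono) auto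
  also have "\<dots> = ennreal C1 * (\<integral>\<^sup>+x. I x \<partial>lborel)" by (rule nn_integral_cmult) simp
  also have "\<dots> \<le> ennreal C1 * (ennreal C2 * ennreal (LINT x|lborel. (h x)\<^sup>2))"
    by (intro mult_left_mono I) simp
  also have "\<dots> = ennreal (C1 * C2 * (LINT x|lborel. (h x)\<^sup>2))"
    using C_nonneg by (simp add: ennreal_mult mult.assoc integral_nonneg_AE)
  finally show "(\<integral>\<^sup>+x. ennreal ((T h x)\<^sup>2) \<partial>lborel) \<le> ennreal (C1 * C2 * (LINT x|lborel. (h x)\<^sup>2))" .
qed

lemma T_L2fun:
  assumes h: "L2fun h"
  shows "L2fun (T h)"
  using T_bound[OF h] L2fun_measurable[OF h] by (auto simp: L2fun_iff intro: le_less_trans)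

lemma T_norm:
  assumes h: "L2fun h"
  shows "(LINT x|lborel. (T h x)\<^sup>2) \<le> C1 * C2 * (LINT x|lborel. (h x)\<^sup>2)"
  using T_bound[OF h] C_nonneg unfolding L2fun_nn_integral[OF T_L2fun[OF h]]
  by (subst (asm) ennreal_le_iff) (auto intro!: mult_nonneg_nonneg integral_nonneg_AE)

text \<open>Cutting the weight down to a set keeps the column constant, so only the row sums need to
  be estimated again.\<close>

lemma restrict:
  assumes E [measurable]: "E \<in> sets (borel \<Otimes>\<^sub>M borel)" and "c \<ge> 0"
    and r: "\<And>x. (\<integral>\<^sup>+y. ennreal (b x y) * indicator E (x, y) \<partial>lborel) \<le> ennreal c"
  shows "schur_kernel (\<lambda>x y. b x y * indicator E (x, y)) Z c C2"
proof
  show "(\<lambda>(x, y). b x y * indicator E (x, y)) \<in> borel_measurable (borel \<Otimes>\<^sub>M borel)" by measurable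
  show "(\<lambda>(x, y). Z x y) \<in> borel_measurable (borel \<Otimes>\<^sub>M borel)" by measurable
  have eq: "ennreal (b x y * indicator E (x, y)) = ennreal (b x y) * indicator E (x, y)" for x y
    by (auto simp: indicator_def)
  show "(\<integral>\<^sup>+y. ennreal (b x y * indicator E (x, y)) \<partial>lborel) \<le> ennreal c" for x
    unfolding eq by (rule r)
  show "(\<integral>\<^sup>+x. \<integral>\<^sup>+y. ennreal (b x y * indicator E (x, y)) * f (Z x y) \<partial>lborel \<partial>lborel) \<le> ennreal C2 * (\<integral>\<^sup>+x. f x \<partial>lborel)"
    if "f \<in> borel_measurable borel" for f
    by (rule order_trans[OF _ col[OF that]], intro nn_integral_mono mult_right_mono)
      (auto simp: indicator_def b_nonneg)
qed (use assms(2) C_nonneg b_nonneg in auto)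

text \<open>The weight is split along \<open>E\<close>. Off \<open>E\<close> the operator norm
  squared is at most \<open>e * C2\<close>. On \<open>E\<close> every row is a functional on L2
  whose squared norm is at most \<open>c x\<close>, and the integrability of \<open>c\<close>
  supplies the dominating function \<open>B * c x\<close>.\<close>

lemma compact_kernelI:
  assumes approx: "\<And>e. e > 0 \<Longrightarrow> \<exists>E c. E \<in> sets (borel \<Otimes>\<^sub>M borel) \<and> c \<in> borel_measurable borel \<and> (\<integral>\<^sup>+x. c x \<partial>lborel) < \<infinity> \<and>
      (\<forall>x. (\<integral>\<^sup>+y. ennreal (b x y) * indicator (-E) (x, y) \<partial>lborel) \<le> ennreal e) \<and>
      (\<forall>x. \<forall>f \<in> borel_measurable borel.
         (\<integral>\<^sup>+y. ennreal (b x y) * indicator E (x, y) * f (Z x y) \<partial>lborel)\<^sup>2 \<le> c x * (\<integral>\<^sup>+x. (f x)\<^sup>2 \<partial>lborel))"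
  shows "compact_kernel b Z"
proof -
  have cauchy: "L2Cauchy (\<lambda>n. T (h n))" if h: "L2weak h" for h
  proof (rule L2Cauchy_approx)
    have L2: "L2fun (h n)" for n using h by (simp add: L2weak_def)
    then show "L2fun (T (h n))" for n by (rule T_L2fun)
    note [measurable] = L2fun_measurable[OF L2]
    obtain B where B: "\<And>n. (LINT x|lborel. (h n x)\<^sup>2) \<le> B" using h by (auto simp: L2weak_def)
    have B0: "B \<ge> 0" using B[of 0] by (rule order_trans[rotated]) (auto intro: integral_nonneg_AE)
    fix e :: real assume e: "e > 0"
    \<comment> \<open>The added 1 keeps the denominator positive when
      \<open>C2 * B = 0\<close>.\<close>
    define e' where "e' = e / (C2 * B + 1)"
    have CB: "C2 * B \<ge> 0" using C_nonneg B0 by simp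
    then have e': "e' > 0" using e by (simp add: e'_def add_nonneg_pos)
    have e'e: "e' * C2 * B \<le> e"
    proof -
      have "e' * C2 * B = e * (C2 * B / (C2 * B + 1))" by (simp add: e'_def)
      also have "\<dots> \<le> e * 1" using e CB by (intro mult_left_mono) (simp_all add: field_simps)
      finally show ?thesis by simp
    qed
    from approx[OF e'] obtain E c where E [measurable]: "E \<in> sets (borel \<Otimes>\<^sub>M borel)"
      and c [measurable]: "c \<in> borel_measurable borel" and cfin: "(\<integral>\<^sup>+x. c x \<partial>lborel) < \<infinity>"
      and small: "\<And>x. (\<integral>\<^sup>+y. ennreal (b x y) * indicator (-E) (x, y) \<partial>lborel) \<le> ennreal e'"
      and bound: "\<And>x f. f \<in> borel_measurable borel \<Longrightarrow>
           (\<integral>\<^sup>+y. ennreal (b x y) * indicator E (x, y) * f (Z x y) \<partial>lborel)\<^sup>2 \<le> c x * (\<integral>\<^sup>+x. (f x)\<^sup>2 \<partial>lborel)"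
      by blast
    have cE [measurable]: "- E \<in> sets (borel \<Otimes>\<^sub>M borel)"
      using sets.compl_sets[OF E] by (simp add: space_pair_measure Compl_eq_Diff_UNIV)
    interpret I: schur_kernel "\<lambda>x y. b x y * indicator E (x, y)" Z C1 C2
    proof (rule restrict[OF E C_nonneg(1)])
      show "(\<integral>\<^sup>+y. ennreal (b x y) * indicator E (x, y) \<partial>lborel) \<le> ennreal C1" for x
        by (rule order_trans[OF _ row[of x]], intro nn_integral_mono) (auto simp: indicator_def)
    qed
    interpret O: schur_kernel "\<lambda>x y. b x y * indicator (-E) (x, y)" Z e' C2
      by (rule restrict[OF cE _ small]) (use e' in simp)
    have "L2Cauchy (\<lambda>n. I.T (h n))"
    proof (rule L2Cauchy_dominated)
      have "AE x in lborel. c x \<noteq> \<infinity>"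
        by (rule nn_integral_PInf_AE) (use cfin in auto)
      then have cAE: "AE x in lborel. c x < \<infinity>" by (simp add: top.not_eq_extremum)
      have rep: "\<exists>k. L2fun k \<and> (\<forall>n. I.T (h n) x = (LINT z|lborel. k z * h n z))" if cx: "c x < \<infinity>" for x
      proof -
        obtain k where k: "L2fun k" "\<And>x. k x \<ge> 0" and krep: "\<And>f. f \<in> borel_measurable borel \<Longrightarrow>
          (\<integral>\<^sup>+y. ennreal (b x y) * indicator E (x, y) * f (Z x y) \<partial>lborel) = (\<integral>\<^sup>+x. ennreal (k x) * f x \<partial>lborel)"
          using L2_functional_density[of "\<lambda>y. ennreal (b x y) * indicator E (x, y)" "Z x" "c x"] cx bound by auto
        note [measurable] = L2fun_measurable[OF k(1)]
        have "I.T (h n) x = (LINT z|lborel. k z * h n z)" for n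
        proof -
          have ik: "integrable lborel (\<lambda>z. k z * h n z)" by (rule L2fun_mult_integrable[OF k(1) L2])
          \<comment> \<open>The density represents the functional on nonnegative functions only. The
            choices \<open>abs\<close>, identity and \<open>uminus\<close> for \<open>g\<close> give
            integrability and the positive and negative parts, since \<open>ennreal\<close> sends
            negative numbers to 0.\<close>
          have key: "(\<integral>\<^sup>+y. ennreal (b x y * indicator E (x, y) * g (h n (Z x y))) \<partial>lborel) = (\<integral>\<^sup>+z. ennreal (k z * g (h n z)) \<partial>lborel)"
            if [measurable]: "g \<in> borel_measurable borel" for g :: "real \<Rightarrow> real"
          proof -
            have m: "(\<lambda>z. ennreal (g (h n z))) \<in> borel_measurable borel" by measurable
            have "ennreal (b x y * indicator E (x, y) * g (h n (Z x y))) = ennreal (b x y) * indicator E (x, y) * ennreal (g (h n (Z x y)))" for y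
              by (auto simp: indicator_def ennreal_mult' b_nonneg)
            then show ?thesis using krep[OF m] k(2) by (simp add: ennreal_mult')
          qed
          have ib: "integrable lborel (\<lambda>y. b x y * indicator E (x, y) * h n (Z x y))"
          proof (rule integrableI_bounded)
            have "(\<integral>\<^sup>+y. ennreal (norm (b x y * indicator E (x, y) * h n (Z x y))) \<partial>lborel) = (\<integral>\<^sup>+z. ennreal (k z * \<bar>h n z\<bar>) \<partial>lborel)"
              using key[of abs] by (simp add: abs_mult b_nonneg)
            also have "\<dots> = (\<integral>\<^sup>+z. ennreal (norm (k z * h n z)) \<partial>lborel)" using k(2) by (simp add: abs_mult)
            also have "\<dots> < \<infinity>" using ik by (simp add: integrable_iff_bounded)
            finally show "(\<integral>\<^sup>+y. ennreal (norm (b x y * indicator E (x, y) * h n (Z x y))) \<partial>lborel) < \<infinity>" .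
          qed measurable
          show ?thesis unfolding I.T_def real_lebesgue_integral_def[OF ib] real_lebesgue_integral_def[OF ik]
            using key[of "\<lambda>x. x"] key[of uminus] by simp
        qed
        with k(1) show ?thesis by blast
      qed
      show "L2fun (I.T (h n))" for n by (rule I.T_L2fun[OF L2])
      show "AE x in lborel. convergent (\<lambda>n. I.T (h n) x)"
        using cAE
      proof eventually_elim
        case (elim x)
        from rep[OF this] obtain k where "L2fun k" "\<And>n. I.T (h n) x = (LINT z|lborel. k z * h n z)" by blast
        then show ?case using h by (simp add: L2weak_def)
      qed
      have "(\<integral>\<^sup>+x. ennreal (enn2real (c x)) \<partial>lborel) = (\<integral>\<^sup>+x. c x \<partial>lborel)"
        by (rule nn_integral_cong_AE, use cAE in eventually_elim) auto
      then show "integrable lborel (\<lambda>x. B * enn2real (c x))"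
        using cfin by (intro integrable_mult_right integrableI_bounded) auto
      fix n
      show "AE x in lborel. (I.T (h n) x)\<^sup>2 \<le> B * enn2real (c x)"
        using cAE I.T_integrable[OF L2[of n]]
      proof eventually_elim
        case (elim x)
        have "ennreal \<bar>I.T (h n) x\<bar> \<le> (\<integral>\<^sup>+y. ennreal \<bar>b x y * indicator E (x, y) * h n (Z x y)\<bar> \<partial>lborel)"
          using integral_norm_bound_ennreal[OF elim(2)] by (simp add: I.T_def)
        also have "\<dots> = (\<integral>\<^sup>+y. ennreal (b x y) * indicator E (x, y) * ennreal \<bar>h n (Z x y)\<bar> \<partial>lborel)"
          by (intro nn_integral_cong) (auto simp: abs_mult ennreal_mult' b_nonneg indicator_def)
        finally have "(ennreal \<bar>I.T (h n) x\<bar>)\<^sup>2 \<le> \<dots>\<^sup>2" by (rule power_mono_ennreal)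
        also have "\<dots> \<le> c x * (\<integral>\<^sup>+x. (ennreal \<bar>h n x\<bar>)\<^sup>2 \<partial>lborel)"
          by (rule bound[of "\<lambda>z. ennreal \<bar>h n z\<bar>"]) measurable
        also have "\<dots> = c x * ennreal (LINT x|lborel. (h n x)\<^sup>2)"
          by (simp add: ennreal_power L2fun_nn_integral[OF L2, symmetric])
        also have "\<dots> \<le> c x * ennreal B" by (intro mult_left_mono ennreal_leI B) simp
        also have "\<dots> = ennreal (enn2real (c x)) * ennreal B" using elim(1) by simp
        also have "\<dots> = ennreal (B * enn2real (c x))" using B0 by (simp add: ennreal_mult mult.commute enn2real_nonneg)
        finally show ?case using B0 by (simp add: ennreal_power enn2real_nonneg ennreal_le_iff)
      qed
    qed
    moreover have "(LINT x|lborel. (T (h n) x - I.T (h n) x)\<^sup>2) \<le> e" for n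
    proof -
      have "AE x in lborel. T (h n) x - I.T (h n) x = O.T (h n) x"
        using T_integrable[OF L2[of n]] I.T_integrable[OF L2[of n]]
      proof eventually_elim
        case (elim x)
        show ?case unfolding T_def I.T_def O.T_def
          by (subst Bochner_Integration.integral_diff[symmetric, OF elim])
            (auto intro!: Bochner_Integration.integral_cong simp: indicator_def)
      qed
      then have "(LINT x|lborel. (T (h n) x - I.T (h n) x)\<^sup>2) = (LINT x|lborel. (O.T (h n) x)\<^sup>2)"
        by (intro integral_cong_AE) auto
      also have "\<dots> \<le> e' * C2 * (LINT x|lborel. (h n x)\<^sup>2)" by (rule O.T_norm[OF L2])
      also have "\<dots> \<le> e' * C2 * B" using e' C_nonneg by (intro mult_left_mono B) simp
      finally show ?thesis using e'e by simp
    qed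
    ultimately show "\<exists>f'. L2Cauchy f' \<and> (\<forall>n. (LINT x|lborel. (T (h n) x - f' n x)\<^sup>2) \<le> e)" by blast
  qed
  show ?thesis
    unfolding compact_kernel_def
    using T_integrable T_L2fun cauchy unfolding T_def[abs_def] by blast
qed

end

section \<open>Strips and caps of the sphere\<close>

lemma lborel_distr_orthogonal:
  fixes U :: "vel \<Rightarrow> vel"
  assumes U: "orthogonal_transformation U"
  shows "distr lborel borel U = lborel"
proof (rule lborel_eqI[symmetric])
  have bl: "bounded_linear U" using U by (simp add: orthogonal_transformation_linear linear_conv_bounded_linear[symmetric])
  then have m [measurable]: "U \<in> borel_measurable borel"
    by (intro borel_measurable_continuous_onI linear_continuous_on)
  fix l u :: vel assume lu: "\<And>b. b \<in> Basis \<Longrightarrow> l \<bullet> b \<le> u \<bullet> b"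
  have iU: "orthogonal_transformation (inv U)" using U by (rule orthogonal_transformation_inv)
  have eq: "U -` box l u = inv U ` box l u"
    using orthogonal_transformation_bij[OF U] by (simp add: bij_vimage_eq_inv_image)
  have mem: "inv U ` box l u \<in> sets borel"
    using measurable_sets[OF m, of "box l u"] by (simp add: eq)
  have "emeasure (distr lborel borel U) (box l u) = emeasure lborel (inv U ` box l u)"
    by (subst emeasure_distr) (auto simp: eq)
  also have "\<dots> = emeasure lebesgue (inv U ` box l u)"
    using mem by (simp add: emeasure_completion)
  also have "\<dots> = ennreal (measure lebesgue (inv U ` box l u))"
    using measurable_orthogonal_image[OF iU lmeasurable_box] by (intro emeasure_eq_measure2) auto
  also have "measure lebesgue (inv U ` box l u) = measure lebesgue (box l u)"
    by (rule measure_orthogonal_image[OF iU]) auto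
  also have "ennreal (measure lebesgue (box l u)) = emeasure lborel (box l u)"
    using lu by (simp add: emeasure_lborel_box_eq)
  also have "\<dots> = (\<Prod>b\<in>Basis. (u - l) \<bullet> b)" using lu by (simp add: emeasure_lborel_box_eq)
  finally show "emeasure (distr lborel borel U) (box l u) = (\<Prod>b\<in>Basis. (u - l) \<bullet> b)" .
qed simp

lemma nn_integral_orthogonal:
  fixes U :: "vel \<Rightarrow> vel"
  assumes U: "orthogonal_transformation U" and f: "f \<in> borel_measurable borel"
  shows "(\<integral>\<^sup>+x. f (U x) \<partial>lborel) = (\<integral>\<^sup>+x. f x \<partial>lborel)"
proof -
  have bl: "bounded_linear U" using U by (simp add: orthogonal_transformation_linear linear_conv_bounded_linear[symmetric])
  then have m [measurable]: "U \<in> borel_measurable borel"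
    by (intro borel_measurable_continuous_onI linear_continuous_on)
  show ?thesis
    by (subst lborel_distr_orthogonal[OF U, symmetric]) (use f in \<open>simp add: nn_integral_distr\<close>)
qed

text \<open>Identifies velocities with an iterated product, in which fixing the first coordinate
  leaves a planar slice.\<close>

definition triple :: "real \<times> real \<times> real \<Rightarrow> vel" where
  "triple p = vector [fst p, fst (snd p), snd (snd p)]"

lemma triple_nth [simp]: "triple p $ 1 = fst p" "triple p $ 2 = fst (snd p)" "triple p $ 3 = snd (snd p)"
  by (simp_all add: triple_def)



lemma triple_measurable [measurable]: "triple \<in> borel_measurable borel"
proof -
  have "linear triple"
    by (rule linearI) (simp_all add: vec_eq_iff forall_3)
  then have "bounded_linear triple" by (simp add: linear_conv_bounded_linear)
  then show ?thesis by (intro borel_measurable_continuous_onI linear_continuous_on)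
qed

lemma lborel_distr_triple: "distr lborel borel triple = lborel"
proof (rule lborel_eqI[symmetric])
  fix l u :: vel assume lu: "\<And>b. b \<in> Basis \<Longrightarrow> l \<bullet> b \<le> u \<bullet> b"
  have B: "Basis = range (\<lambda>i::3. axis i (1::real))"
    by (auto simp: Basis_vec_def)
  have li: "l $ i \<le> u $ i" for i
    using lu[of "axis i 1"] by (simp add: B inner_axis)
  have inj: "inj (\<lambda>i::3. axis i (1::real))" by (rule injI) (simp add: axis_eq_axis)
  have "(\<Prod>b\<in>Basis. (u - l) \<bullet> b) = (\<Prod>i\<in>UNIV. (u - l) $ i)"
    unfolding B by (subst prod.reindex[OF inj]) (simp add: inner_axis)
  also have "\<dots> = (u $ 1 - l $ 1) * ((u $ 2 - l $ 2) * (u $ 3 - l $ 3))"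
    unfolding UNIV_3 by (simp add: mult.assoc)
  finally have p: "(\<Prod>b\<in>Basis. (u - l) \<bullet> b) = (u $ 1 - l $ 1) * ((u $ 2 - l $ 2) * (u $ 3 - l $ 3))" .
  have "triple -` box l u = box (l $ 1, l $ 2, l $ 3) (u $ 1, u $ 2, u $ 3)"
    by (auto simp: mem_box_cart mem_box forall_3 Basis_prod_def)
  then have "emeasure (distr lborel borel triple) (box l u) = emeasure lborel (box (l $ 1, l $ 2, l $ 3) (u $ 1, u $ 2, u $ 3))"
    by (subst emeasure_distr) auto
  also have "\<dots> = ennreal (\<Prod>b\<in>Basis. ((u $ 1, u $ 2, u $ 3) - (l $ 1, l $ 2, l $ 3)) \<bullet> b)"
    using li by (subst emeasure_lborel_box) (auto simp: Basis_prod_def)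
  also have "(\<Prod>b\<in>Basis. ((u $ 1, u $ 2, u $ 3) - (l $ 1, l $ 2, l $ 3)) \<bullet> b) = (u $ 1 - l $ 1) * ((u $ 2 - l $ 2) * (u $ 3 - l $ 3))"
  proof -
    have B3: "(Basis :: (real \<times> real \<times> real) set) = {(1,0,0), (0,1,0), (0,0,1)}"
      by (auto simp: Basis_prod_def zero_prod_def)
    show ?thesis unfolding B3 by simp
  qed
  finally show "emeasure (distr lborel borel triple) (box l u) = ennreal (\<Prod>b\<in>Basis. (u - l) \<bullet> b)"
    unfolding p .
qed simp

text \<open>Archimedes: the slice of the shell is an annulus, whose area is at most $2\pi\delta$
  independently of the height.\<close>

lemma shell_slab_volume:
  fixes a b \<delta> :: real
  assumes "a \<le> b" "0 \<le> \<delta>" "\<delta> \<le> 1"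
  shows "emeasure lborel {x :: vel. 1 - \<delta> \<le> norm x \<and> norm x \<le> 1 \<and> a \<le> x $ 1 \<and> x $ 1 \<le> b} \<le> ennreal (2 * pi * \<delta> * (b - a))"
proof -
  let ?S = "{x :: vel. 1 - \<delta> \<le> norm x \<and> norm x \<le> 1 \<and> a \<le> x $ 1 \<and> x $ 1 \<le> b}"
  have S [measurable]: "?S \<in> sets borel" by measurable
  have nt: "norm (triple (t, y)) = sqrt (t\<^sup>2 + (norm y)\<^sup>2)" for t y
    by (cases y) (simp add: norm_vec_def L2_set_def sum_3 norm_prod_def)
  have [measurable]: "triple -` ?S \<in> sets borel"
    using measurable_sets[OF triple_measurable S] by simp
  have "emeasure lborel ?S = emeasure lborel (triple -` ?S)"
    by (subst lborel_distr_triple[symmetric], subst emeasure_distr) auto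
  also have "\<dots> = (\<integral>\<^sup>+t. emeasure lborel (Pair t -` (triple -` ?S)) \<partial>lborel)"
    by (subst lborel_prod[symmetric], rule lborel.emeasure_pair_measure_alt) (simp only: lborel_prod sets_lborel, fact)
  also have "\<dots> \<le> (\<integral>\<^sup>+t. ennreal (2 * pi * \<delta>) * indicator {a..b} t \<partial>lborel)"
  proof (rule nn_integral_mono)
    fix t :: real
    define A where "A = Pair t -` (triple -` ?S)"
    have eq: "A = (if t \<in> {a..b} then {y. 1 - \<delta> \<le> sqrt (t\<^sup>2 + (norm y)\<^sup>2) \<and> sqrt (t\<^sup>2 + (norm y)\<^sup>2) \<le> 1} else {})"
      unfolding A_def by (auto simp: nt)
    show "emeasure lborel (Pair t -` (triple -` ?S)) \<le> ennreal (2 * pi * \<delta>) * indicator {a..b} t"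
    proof (cases "t \<in> {a..b} \<and> t\<^sup>2 \<le> 1")
      case False
      have "A = {}"
      proof (cases "t \<in> {a..b}")
        case True
        then have "t\<^sup>2 > 1" using False by auto
        then have "sqrt (t\<^sup>2 + (norm y)\<^sup>2) > 1" for y :: "real \<times> real"
        proof -
          have "t\<^sup>2 + (norm y)\<^sup>2 > 1" using \<open>t\<^sup>2 > 1\<close> zero_le_power2[of "norm y"] by linarith
          then show ?thesis by simp
        qed
        then show ?thesis using True by (auto simp: eq not_le)
      qed (auto simp: eq)
      then show ?thesis unfolding A_def[symmetric] by simp
    next
      case True
      define R where "R = sqrt (1 - t\<^sup>2)"
      \<comment> \<open>Inner radius of the annulus. The maximum with 0 covers heights beyond the
        inner sphere, where the slice is a full disc.\<close>
      define q where "q = sqrt (max 0 ((1 - \<delta>)\<^sup>2 - t\<^sup>2))"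
      have R: "R \<ge> 0" "R\<^sup>2 = 1 - t\<^sup>2" using True by (auto simp: R_def)
      have q: "q \<ge> 0" "q\<^sup>2 = max 0 ((1 - \<delta>)\<^sup>2 - t\<^sup>2)" by (auto simp: q_def)
      have "(1 - \<delta>)\<^sup>2 \<le> 1\<^sup>2" using assms by (intro power_mono) auto
      then have "q\<^sup>2 \<le> R\<^sup>2" unfolding q R using True by auto
      then have qR: "q \<le> R" using R(1) by (rule power2_le_imp_le)
      have sub: "A \<subseteq> cball 0 R - ball 0 q"
      proof
        fix y assume "y \<in> A"
        then have y: "1 - \<delta> \<le> sqrt (t\<^sup>2 + (norm y)\<^sup>2)" "sqrt (t\<^sup>2 + (norm y)\<^sup>2) \<le> 1"
          by (auto simp: eq split: if_splits)
        from y(2) have "t\<^sup>2 + (norm y)\<^sup>2 \<le> 1" by simp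
        then have "(norm y)\<^sup>2 \<le> R\<^sup>2" using R by simp
        then have 1: "norm y \<le> R" using R(1) by (rule power2_le_imp_le)
        have "(1 - \<delta>)\<^sup>2 \<le> (sqrt (t\<^sup>2 + (norm y)\<^sup>2))\<^sup>2" using y(1) assms by (intro power_mono) auto
        then have "(1 - \<delta>)\<^sup>2 - t\<^sup>2 \<le> (norm y)\<^sup>2" by simp
        then have "q\<^sup>2 \<le> (norm y)\<^sup>2" unfolding q by simp
        then have "q \<le> norm y" by (rule power2_le_imp_le) simp
        with 1 show "y \<in> cball 0 R - ball 0 q" by simp
      qed
      have "emeasure lborel A \<le> emeasure lborel (cball (0::real\<times>real) R - ball 0 q)"
        by (rule emeasure_mono[OF sub]) simp
      also have "\<dots> = emeasure lborel (cball (0::real\<times>real) R) - emeasure lborel (ball (0::real\<times>real) q)"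
        using qR by (intro emeasure_Diff) (auto simp: emeasure_ball q)
      also have "\<dots> = ennreal (pi * R\<^sup>2) - ennreal (pi * q\<^sup>2)"
        using R(1) q(1) by (simp add: emeasure_ball emeasure_cball eval_unit_ball_vol power2_eq_square)
      also have "\<dots> = ennreal (pi * (R\<^sup>2 - q\<^sup>2))"
        by (subst ennreal_minus) (auto simp: right_diff_distrib)
      also have "\<dots> \<le> ennreal (pi * (2 * \<delta>))"
      proof (intro ennreal_leI mult_left_mono)
        have "R\<^sup>2 - q\<^sup>2 \<le> 1 - (1 - \<delta>)\<^sup>2" unfolding R q by simp
        also have "\<dots> \<le> 2 * \<delta>" by (simp add: power2_eq_square algebra_simps)
        finally show "R\<^sup>2 - q\<^sup>2 \<le> 2 * \<delta>" .
      qed simp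
      finally show ?thesis using True unfolding A_def[symmetric] by (simp add: mult_ac)
    qed
  qed
  also have "\<dots> = ennreal (2 * pi * \<delta>) * ennreal (b - a)"
    using assms by (subst nn_integral_cmult_indicator) auto
  also have "\<dots> = ennreal (2 * pi * \<delta> * (b - a))"
    using assms by (simp add: ennreal_mult)
  finally show ?thesis .
qed

lemma balls_borel [measurable]:
  fixes c :: "'a::metric_space"
  shows "ball c r \<in> sets borel" "cball c r \<in> sets borel"
  by simp_all

text \<open>In contrast to \<^const>\<open>sphere_int\<close> there is no factor 3, and the origin, where the junk
  value 0 of the projection is not a unit vector, is removed.\<close>

definition nsph :: "(vel \<Rightarrow> ennreal) \<Rightarrow> ennreal" where
  "nsph f = (\<integral>\<^sup>+x. indicator (ball 0 1 - {0}) x * f (x /\<^sub>R norm x) \<partial>lborel)"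

lemma nsph_mono: "(\<And>\<omega>. norm \<omega> = 1 \<Longrightarrow> f \<omega> \<le> g \<omega>) \<Longrightarrow> nsph f \<le> nsph g"
  unfolding nsph_def by (intro nn_integral_mono) (auto simp: indicator_def)

lemma nsph_cong: "(\<And>\<omega>. norm \<omega> = 1 \<Longrightarrow> f \<omega> = g \<omega>) \<Longrightarrow> nsph f = nsph g"
  by (intro antisym nsph_mono) auto

lemma nsph_cmult:
  assumes [measurable]: "f \<in> borel_measurable borel"
  shows "nsph (\<lambda>\<omega>. c * f \<omega>) = c * nsph f"
proof -
  have "(\<lambda>x. indicator (ball 0 1 - {0}) x * f (x /\<^sub>R norm x)) \<in> borel_measurable lborel" by measurable
  from nn_integral_cmult[OF this, of c] show ?thesis unfolding nsph_def by (simp add: mult_ac)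
qed

lemma nsph_one: "nsph (\<lambda>_. 1) = ennreal (unit_ball_vol 3)"
proof -
  have "nsph (\<lambda>_. 1) = emeasure lborel (ball (0::vel) 1 - {0})"
    unfolding nsph_def by simp
  also have "\<dots> = emeasure lborel (ball (0::vel) 1)" by (intro emeasure_Diff_null_set) auto
  finally show ?thesis by (simp add: emeasure_ball)
qed

lemma nsph_one_le: "nsph (\<lambda>_. 1) \<le> ennreal (unit_ball_vol 3)"
  by (simp add: nsph_one)

lemma nsph_orthogonal:
  assumes U: "orthogonal_transformation U" and f: "f \<in> borel_measurable borel"
  shows "nsph (\<lambda>\<omega>. f (U \<omega>)) = nsph f"
proof -
  note [measurable] = f
  have lin: "linear U" and n: "norm (U x) = norm x" for x
    using U by (auto simp: orthogonal_transformation)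
  have "nsph (\<lambda>\<omega>. f (U \<omega>)) = (\<integral>\<^sup>+x. (indicator (ball 0 1 - {0}) (U x) * f (U x /\<^sub>R norm (U x))) \<partial>lborel)"
    unfolding nsph_def
  proof (rule nn_integral_cong)
    fix x
    have "U (x /\<^sub>R norm x) = U x /\<^sub>R norm (U x)" using lin by (simp add: linear_scale n)
    moreover have "U x = 0 \<longleftrightarrow> x = 0" using n[of x] by (metis norm_eq_zero)
    then have "U x \<in> ball 0 1 - {0} \<longleftrightarrow> x \<in> ball 0 1 - {0}" by (simp add: n)
    ultimately show "indicator (ball 0 1 - {0}) x * f (U (x /\<^sub>R norm x)) = indicator (ball 0 1 - {0}) (U x) * f (U x /\<^sub>R norm (U x))"
      by (simp add: indicator_def)
  qed
  also have "\<dots> = nsph f" unfolding nsph_def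
    by (intro nn_integral_orthogonal[OF U]) measurable
  finally show ?thesis .
qed

lemma emeasure_scaleR_vel:
  fixes A :: "vel set"
  assumes A: "A \<in> sets borel" and c: "c > 0"
  shows "emeasure lborel ((\<lambda>x. c *\<^sub>R x) -` A) = ennreal (1 / c ^ 3) * emeasure lborel A"
proof -
  have [measurable]: "A \<in> sets borel" by fact
  have "emeasure lborel A = emeasure (density (distr lborel borel (\<lambda>x. 0 + c *\<^sub>R x)) (\<lambda>_. ennreal (\<bar>c\<bar>^DIM(vel)))) A"
    using lborel_affine[of c "0::vel"] c by simp
  also have "\<dots> = ennreal (c^3) * emeasure (distr lborel borel (\<lambda>x. c *\<^sub>R x)) A"
    using c by (subst emeasure_density) (auto simp: nn_integral_cmult)
  also have "emeasure (distr lborel borel (\<lambda>x. c *\<^sub>R x)) A = emeasure lborel ((\<lambda>x. c *\<^sub>R x) -` A)"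
    by (subst emeasure_distr) auto
  finally have "ennreal (1 / c^3) * emeasure lborel A = (ennreal (1 / c^3) * ennreal (c^3)) * emeasure lborel ((\<lambda>x. c *\<^sub>R x) -` A)"
    by (simp add: mult.assoc)
  also have "ennreal (1 / c^3) * ennreal (c^3) = 1"
    using c by (subst ennreal_mult[symmetric]) auto
  finally show ?thesis by simp
qed

text \<open>The truncated cone A over the strip is compared with itself. Its part of radius below 1
  - d becomes a subset of A after dilation by 1/(1 - d), and the rest lies in a thin slab of the
  shell. This gives |A| <= (1 - d) |A| + 10 pi d^2, and dividing by d yields a linear bound without
  polar coordinates.\<close>

lemma nsph_strip_axis:
  assumes d: "0 < d" "d \<le> 1"
  shows "nsph (\<lambda>\<omega>. indicator {t0..t0 + d} (\<omega> $ 1)) \<le> ennreal (10 * pi * d)"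
proof (cases "t0 \<le> 1 \<and> t0 + d \<ge> -1")
  case False
  have "nsph (\<lambda>\<omega>. indicator {t0..t0 + d} (\<omega> $ 1)) \<le> nsph (\<lambda>_. 0)"
  proof (rule nsph_mono)
    fix \<omega> :: vel assume "norm \<omega> = 1"
    then have "\<bar>\<omega> $ 1\<bar> \<le> 1" using component_le_norm_cart[of \<omega> 1] by simp
    then show "indicator {t0..t0 + d} (\<omega> $ 1) \<le> (0::ennreal)" using False by (auto simp: indicator_def)
  qed
  then show ?thesis by (simp add: nsph_def)
next
  case True
  define A where "A = {x::vel. x \<in> ball 0 1 - {0} \<and> t0 \<le> (x /\<^sub>R norm x) $ 1 \<and> (x /\<^sub>R norm x) $ 1 \<le> t0 + d}"
  have A [measurable]: "A \<in> sets borel" unfolding A_def by measurable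
  have nA: "nsph (\<lambda>\<omega>. indicator {t0..t0 + d} (\<omega> $ 1)) = emeasure lborel A"
    unfolding nsph_def
    by (subst nn_integral_indicator[symmetric], simp, intro nn_integral_cong) (auto simp: A_def indicator_def)
  have Afin: "emeasure lborel A < \<infinity>"
    by (rule le_less_trans[OF emeasure_mono emeasure_lborel_ball_finite[of 0 1]]) (auto simp: A_def)
  \<comment> \<open>Radial projection changes the first coordinate by at most \<open>d\<close>
    within this shell. The strip of width \<open>d\<close> is widened by \<open>2 * d\<close> on
    both sides, which produces the factor 5.\<close>
  define W where "W = {x :: vel. 1 - d \<le> norm x \<and> norm x \<le> 1 \<and> t0 - 2 * d \<le> x $ 1 \<and> x $ 1 \<le> t0 + 3 * d}"
  have W [measurable]: "W \<in> sets borel" unfolding W_def by measurable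
  have Wle: "emeasure lborel W \<le> ennreal (2 * pi * d * (5 * d))"
  proof -
    have "emeasure lborel W \<le> ennreal (2 * pi * d * ((t0 + 3 * d) - (t0 - 2 * d)))"
      unfolding W_def using d by (intro shell_slab_volume) auto
    then show ?thesis by simp
  qed
  have sub: "A - {x \<in> A. norm x < 1 - d} \<subseteq> W"
  proof
    fix x assume "x \<in> A - {x \<in> A. norm x < 1 - d}"
    then have x: "x \<noteq> 0" "norm x < 1" "1 - d \<le> norm x" "t0 \<le> x $ 1 / norm x" "x $ 1 / norm x \<le> t0 + d"
      by (auto simp: A_def divide_inverse mult.commute)
    define R where "R = norm x"
    define t where "t = x $ 1 / R"
    have R: "0 < R" "R < 1" "1 - d \<le> R" using x by (auto simp: R_def)
    have xt: "x $ 1 = t * R" using R by (simp add: t_def)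
    have tt: "\<bar>t\<bar> \<le> 1"
      using component_le_norm_cart[of x 1] R unfolding t_def R_def by (simp add: abs_divide)
    have "\<bar>t - t * R\<bar> = \<bar>t\<bar> * (1 - R)" using R by (simp add: abs_mult right_diff_distrib[symmetric, of t 1 R, simplified])
    also have "\<dots> \<le> 1 * d" using tt R by (intro mult_mono) auto
    finally have "\<bar>t - x $ 1\<bar> \<le> d" by (simp add: xt)
    moreover have "t0 \<le> t" "t \<le> t0 + d" using x by (auto simp: t_def R_def)
    ultimately have "t0 - 2 * d \<le> x $ 1" "x $ 1 \<le> t0 + 3 * d" using d by linarith+
    then show "x \<in> W" using x by (simp add: W_def)
  qed
  have inner: "emeasure lborel {x \<in> A. norm x < 1 - d} \<le> ennreal (1 - d) * emeasure lborel A"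
  \<comment> \<open>At \<open>d = 1\<close> the dilation factor \<open>1 / (1 - d)\<close> is
    meaningless, but then the inner part is empty.\<close>
  proof (cases "d = 1")
    case True
    then have "{x \<in> A. norm x < 1 - d} = {}" by auto
    then show ?thesis by (simp only: emeasure_empty zero_le)
  next
    case False
    then have d1: "0 < 1 - d" "1 - d \<le> 1" using d by auto
    define c where "c = 1 / (1 - d)"
    have c: "c > 0" using d1 by (simp add: c_def)
    have "{x \<in> A. norm x < 1 - d} \<subseteq> (\<lambda>x. c *\<^sub>R x) -` A"
    proof
      fix x assume x: "x \<in> {x \<in> A. norm x < 1 - d}"
      have eq: "(c *\<^sub>R x) /\<^sub>R norm (c *\<^sub>R x) = x /\<^sub>R norm x" using c by (simp add: divide_simps)
      have "norm (c *\<^sub>R x) < 1" using x d1 by (simp add: c_def field_simps)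
      then have "c *\<^sub>R x \<in> ball 0 1 - {0}" using x c by (auto simp: A_def)
      moreover have "t0 \<le> (x /\<^sub>R norm x) $ 1 \<and> (x /\<^sub>R norm x) $ 1 \<le> t0 + d" using x by (simp add: A_def)
      ultimately show "x \<in> (\<lambda>x. c *\<^sub>R x) -` A" unfolding A_def vimage_def mem_Collect_eq eq by blast
    qed
    then have "emeasure lborel {x \<in> A. norm x < 1 - d} \<le> emeasure lborel ((\<lambda>x. c *\<^sub>R x) -` A)"
      using measurable_sets[of "\<lambda>x::vel. c *\<^sub>R x" borel borel A] by (intro emeasure_mono) auto
    also have "\<dots> = ennreal (1 / c^3) * emeasure lborel A" by (rule emeasure_scaleR_vel[OF A c])
    also have "1 / c^3 = (1 - d)^3" by (simp add: c_def power_divide)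
    \<comment> \<open>One power of 1 - d is enough for the recursion: it leaves exactly
      \<open>d\<close> times the measure on the left.\<close>
    also have "ennreal ((1 - d)^3) * emeasure lborel A \<le> ennreal (1 - d) * emeasure lborel A"
      using d1 power_decreasing[of 1 3 "1 - d"] by (intro mult_right_mono ennreal_leI) auto
    finally show ?thesis .
  qed
  have "emeasure lborel A \<le> emeasure lborel {x \<in> A. norm x < 1 - d} + emeasure lborel (A - {x \<in> A. norm x < 1 - d})"
    by (subst plus_emeasure) (auto intro!: emeasure_mono)
  also have "\<dots> \<le> ennreal (1 - d) * emeasure lborel A + ennreal (2 * pi * d * (5 * d))"
    by (intro add_mono inner order_trans[OF emeasure_mono[OF sub] Wle]) auto
  finally have main: "emeasure lborel A \<le> ennreal (1 - d) * emeasure lborel A + ennreal (2 * pi * d * (5 * d))" .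
  obtain v where v: "emeasure lborel A = ennreal v" "v \<ge> 0"
    using Afin by (cases "emeasure lborel A") auto
  have "v \<le> (1 - d) * v + 2 * pi * d * (5 * d)"
    using main v d by (simp add: ennreal_mult[symmetric] ennreal_plus[symmetric] del: ennreal_plus)
  then have "d * v \<le> d * (10 * pi * d)" by (simp add: algebra_simps)
  then have "v \<le> 10 * pi * d" using d by (simp only: mult_le_cancel_left_pos)
  then show ?thesis unfolding nA v by (rule ennreal_leI)
qed

text \<open>The first summand serves widths up to 1; the second, the total mass of the sphere in
  this normalization, serves larger widths.\<close>

definition Kst :: real where "Kst = 10 * pi + unit_ball_vol 3"

lemma Kst_pos: "Kst > 0" unfolding Kst_def by (simp add: add_pos_pos)

lemma nsph_strip:
  assumes e: "norm e = 1" and d: "0 \<le> d"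
  shows "nsph (\<lambda>\<omega>. indicator {t0..t0 + d} (e \<bullet> \<omega>)) \<le> ennreal (Kst * d)"
proof (cases "d \<le> 1")
  case False
  have "nsph (\<lambda>\<omega>. indicator {t0..t0 + d} (e \<bullet> \<omega>)) \<le> nsph (\<lambda>_. 1)" by (intro nsph_mono) (auto simp: indicator_def)
  also have "\<dots> \<le> ennreal (unit_ball_vol 3)" by (rule nsph_one_le)
  also have "\<dots> \<le> ennreal (Kst * d)"
  proof (rule ennreal_leI)
    have "unit_ball_vol 3 \<le> Kst * 1" by (simp add: Kst_def)
    also have "\<dots> \<le> Kst * d" using False Kst_pos by (intro mult_left_mono) auto
    finally show "unit_ball_vol 3 \<le> Kst * d" .
  qed
  finally show ?thesis .
next
  case True
  have "norm e = norm (axis 1 1 :: vel)" by (simp add: e norm_axis_1)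
  then obtain U :: "vel \<Rightarrow> vel" where U: "orthogonal_transformation U" "U e = axis 1 1"
    by (rule orthogonal_transformation_exists)
  have "(e \<bullet> \<omega>) = U \<omega> $ 1" for \<omega>
  proof -
    have "e \<bullet> \<omega> = U e \<bullet> U \<omega>" using U(1) by (simp add: orthogonal_transformation_def)
    then show ?thesis by (simp add: U(2) inner_axis inner_commute)
  qed
  then have eq: "nsph (\<lambda>\<omega>. indicator {t0..t0 + d} (e \<bullet> \<omega>)) = nsph (\<lambda>\<omega>. indicator {t0..t0 + d} (\<omega> $ 1))"
    using nsph_orthogonal[OF U(1), of "\<lambda>\<omega>. indicator {t0..t0 + d} (\<omega> $ 1)"] by simp
  \<comment> \<open>The axis estimate needs positive width. A strip of width 0 is covered by strips
    of width \<open>d'\<close>, with \<open>d'\<close> as small as desired.\<close>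
  have small: "nsph (\<lambda>\<omega>. indicator {t0..t0 + d} (\<omega> $ 1)) \<le> ennreal (10 * pi * d')" if "d \<le> d'" "0 < d'" "d' \<le> 1" for d'
    by (rule order_trans[OF nsph_mono nsph_strip_axis[of d' t0]]) (use that in \<open>auto simp: indicator_def\<close>)
  have "nsph (\<lambda>\<omega>. indicator {t0..t0 + d} (\<omega> $ 1)) \<le> ennreal (10 * pi * d)"
  proof (cases "d = 0")
    case False then show ?thesis using small[of d] True d by simp
  next
    case d0: True
    have "nsph (\<lambda>\<omega>. indicator {t0..t0 + d} (\<omega> $ 1)) \<le> 0 + ennreal x" if "x > 0" for x
    proof -
      define d' where "d' = min 1 (x / (10 * pi))"
      have "d' > 0" "d' \<le> 1" "10 * pi * d' \<le> x" using that by (auto simp: d'_def min_def field_simps)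
      then show ?thesis using small[of d'] d0 by (auto intro: order_trans ennreal_leI)
    qed
    then have "nsph (\<lambda>\<omega>. indicator {t0..t0 + d} (\<omega> $ 1)) \<le> 0" by (rule ennreal_le_epsilon)
    then show ?thesis by (simp add: d0)
  qed
  also have "\<dots> \<le> ennreal (Kst * d)"
    using d by (intro ennreal_leI mult_right_mono) (auto simp: Kst_def)
  finally show ?thesis unfolding eq .
qed

text \<open>The second summand pays for caps with 2 l >= rho, where rho^2 <= 4 l^2 and the total
  mass is an adequate bound.\<close>

definition Kcap :: real where "Kcap = Kst + 4 * unit_ball_vol 3"

lemma Kcap_pos: "Kcap > 0" unfolding Kcap_def using Kst_pos by (simp add: add_pos_nonneg)

text \<open>By the law of cosines, and since (norm p)^2 + rho^2 >= 2 rho (norm p), every point of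
  the cap satisfies 2 rho (norm p) (1 - t) <= l^2 for the cosine t. For norm p >= rho/2 the cap thus
  lies in a strip of width l^2/rho^2. If both l and norm p are below rho/2, the cap is
  empty.\<close>

lemma nsph_cap:
  assumes \<rho>: "\<rho> > 0" and l: "l \<ge> 0"
  shows "nsph (\<lambda>\<omega>. indicator {x. norm (p - \<rho> *\<^sub>R x) \<le> l} \<omega>) \<le> ennreal (Kcap * l\<^sup>2 / \<rho>\<^sup>2)"
proof (cases "l \<ge> \<rho> / 2")
  case True
  have "nsph (\<lambda>\<omega>. indicator {x. norm (p - \<rho> *\<^sub>R x) \<le> l} \<omega>) \<le> nsph (\<lambda>_. 1)" by (intro nsph_mono) (auto simp: indicator_def)
  also have "\<dots> \<le> ennreal (unit_ball_vol 3)" by (rule nsph_one_le)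
  also have "\<dots> \<le> ennreal (Kcap * l\<^sup>2 / \<rho>\<^sup>2)"
  proof (rule ennreal_leI)
    have "(\<rho>/2)\<^sup>2 \<le> l\<^sup>2" using True \<rho> by (intro power_mono) auto
    then have "\<rho>\<^sup>2 \<le> 4 * l\<^sup>2" by (simp add: power_divide)
    then have "unit_ball_vol 3 * \<rho>\<^sup>2 \<le> unit_ball_vol 3 * (4 * l\<^sup>2)" by (intro mult_left_mono) auto
    also have "\<dots> \<le> Kcap * l\<^sup>2" using Kst_pos by (simp add: Kcap_def algebra_simps)
    finally show "unit_ball_vol 3 \<le> Kcap * l\<^sup>2 / \<rho>\<^sup>2" using \<rho> by (simp add: field_simps)
  qed
  finally show ?thesis .
next
  case False
  show ?thesis
  proof (cases "norm p \<ge> \<rho> / 2")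
    case p: False
    have "nsph (\<lambda>\<omega>. indicator {x. norm (p - \<rho> *\<^sub>R x) \<le> l} \<omega>) \<le> nsph (\<lambda>_. 0)"
    proof (rule nsph_mono)
      fix \<omega> :: vel assume w: "norm \<omega> = 1"
      have "norm (\<rho> *\<^sub>R \<omega>) \<le> norm p + norm (p - \<rho> *\<^sub>R \<omega>)"
        using norm_triangle_ineq4[of p "p - \<rho> *\<^sub>R \<omega>"] by simp
      then show "indicator {x. norm (p - \<rho> *\<^sub>R x) \<le> l} \<omega> \<le> (0::ennreal)"
        using p False w \<rho> by (auto simp: indicator_def)
    qed
    then show ?thesis by (simp add: nsph_def)
  next
    case p: True
    define \<delta> where "\<delta> = l\<^sup>2 / \<rho>\<^sup>2"
    have "nsph (\<lambda>\<omega>. indicator {x. norm (p - \<rho> *\<^sub>R x) \<le> l} \<omega>) \<le> nsph (\<lambda>\<omega>. indicator {1 - \<delta>..1 - \<delta> + \<delta>} ((p /\<^sub>R norm p) \<bullet> \<omega>))"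
    proof (rule nsph_mono)
      fix \<omega> :: vel assume w: "norm \<omega> = 1"
      define t where "t = (p /\<^sub>R norm p) \<bullet> \<omega>"
      have p0: "norm p > 0" using p \<rho> by linarith
      have pt: "p \<bullet> \<omega> = norm p * t" using p0 by (simp add: t_def)
      have t1: "t \<le> 1" using Cauchy_Schwarz_ineq2[of "p /\<^sub>R norm p" \<omega>] w p0 by (simp add: t_def)
      have "1 - \<delta> \<le> t" if "norm (p - \<rho> *\<^sub>R \<omega>) \<le> l"
      proof -
        have "(norm (p - \<rho> *\<^sub>R \<omega>))\<^sup>2 \<le> l\<^sup>2" using that by (intro power_mono) auto
        moreover have "(norm (p - \<rho> *\<^sub>R \<omega>))\<^sup>2 = (norm p)\<^sup>2 + \<rho>\<^sup>2 - 2 * \<rho> * norm p * t"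
        proof -
          have "(norm (p - \<rho> *\<^sub>R \<omega>))\<^sup>2 = (norm p)\<^sup>2 + (norm (\<rho> *\<^sub>R \<omega>))\<^sup>2 - 2 * (p \<bullet> (\<rho> *\<^sub>R \<omega>))"
            using dot_norm_neg[of p "\<rho> *\<^sub>R \<omega>"] by (simp only: field_simps)
          also have "\<dots> = (norm p)\<^sup>2 + \<rho>\<^sup>2 - 2 * \<rho> * norm p * t"
            using w \<rho> by (simp add: pt)
          finally show ?thesis .
        qed
        moreover have "(norm p)\<^sup>2 + \<rho>\<^sup>2 \<ge> 2 * \<rho> * norm p"
          using sum_squares_bound[of "norm p" \<rho>] by (simp add: mult_ac)
        ultimately have 1: "2 * \<rho> * norm p * (1 - t) \<le> l\<^sup>2" by (simp add: algebra_simps)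
        have "\<rho>\<^sup>2 * (1 - t) \<le> 2 * \<rho> * norm p * (1 - t)"
          using p \<rho> t1 by (intro mult_right_mono) (auto simp: power2_eq_square)
        with 1 have "\<rho>\<^sup>2 * (1 - t) \<le> l\<^sup>2" by linarith
        then have "1 - t \<le> \<delta>" using \<rho> by (simp add: \<delta>_def field_simps)
        then show ?thesis by simp
      qed
      then show "indicator {x. norm (p - \<rho> *\<^sub>R x) \<le> l} \<omega> \<le> (indicator {1 - \<delta>..1 - \<delta> + \<delta>} ((p /\<^sub>R norm p) \<bullet> \<omega>) :: ennreal)"
        using t1 unfolding t_def[symmetric] by (auto simp: indicator_def)
    qed
    also have "\<dots> \<le> ennreal (Kst * \<delta>)"
    proof (rule nsph_strip)
      have "norm p > 0" using p \<rho> by linarith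
      then show "norm (p /\<^sub>R norm p) = 1" by simp
    qed (simp add: \<delta>_def)
    also have "\<dots> \<le> ennreal (Kcap * l\<^sup>2 / \<rho>\<^sup>2)"
      unfolding \<delta>_def using \<rho> by (intro ennreal_leI) (simp add: Kcap_def divide_right_mono mult_right_mono)
    finally show ?thesis .
  qed
qed

text \<open>Dyadic domination: it turns cap and ball bounds into bounds for rapidly decaying weights.\<close>

lemma dyadic_bound:
  fixes y v K :: real
  assumes "y \<ge> 0" "v \<ge> 0" "v \<le> K" "v * y ^ 4 \<le> K"
  shows "ennreal v \<le> (\<Sum>n. ennreal (K * (1/16) ^ n) * indicator {..2 ^ (n + 1)} y)"
proof -
  have ex: "\<exists>n. y \<le> 2 ^ (n + 1)"
  proof -
    obtain n where "y < 2 ^ n" using real_arch_pow[of 2 y] by auto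
    also have "2 ^ n \<le> (2::real) ^ (n + 1)" by simp
    finally show ?thesis by (intro exI[of _ n]) simp
  qed
  define n where "n = (LEAST n. y \<le> 2 ^ (n + 1))"
  have n1: "y \<le> 2 ^ (n + 1)" unfolding n_def using ex by (rule LeastI_ex)
  have "v \<le> K * (1/16) ^ n"
  proof (cases n)
    case 0 then show ?thesis using assms by simp
  next
    case (Suc k)
    then have "\<not> y \<le> 2 ^ (k + 1)" using not_less_Least[of k "\<lambda>n. y \<le> 2 ^ (n + 1)"] by (simp add: n_def)
    then have "2 ^ n \<le> y" using Suc by simp
    then have "(2 ^ n) ^ 4 \<le> y ^ 4" by (intro power_mono) auto
    moreover have "(2 ^ n) ^ 4 = (16::real) ^ n" 
    proof -
      have "(2 ^ n) ^ 4 = ((2::real) ^ 4) ^ n" by (simp only: power_mult[symmetric] mult.commute)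
      then show ?thesis by simp
    qed
    ultimately have "16 ^ n \<le> y ^ 4" by simp
    then have "v * 16 ^ n \<le> v * y ^ 4" using assms(2) by (rule mult_left_mono)
    then have "v * 16 ^ n \<le> K" using assms(4) by linarith
    then show ?thesis by (simp add: field_simps)
  qed
  then have "ennreal v \<le> ennreal (K * (1/16) ^ n) * indicator {..2 ^ (n + 1)} y"
    using n1 by (simp add: ennreal_leI)
  also have "\<dots> \<le> (\<Sum>n. ennreal (K * (1/16) ^ n) * indicator {..2 ^ (n + 1)} y)"
  proof -
    have "u n \<le> suminf u" for u :: "nat \<Rightarrow> ennreal" using sum_le_suminf[of u "{n}"] by simp
    then show ?thesis .
  qed
  finally show ?thesis .
qed

lemma ennreal_geometric_sum:
  assumes "0 \<le> q" "q < 1" "0 \<le> K"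
  shows "(\<Sum>n. ennreal (K * q ^ n)) = ennreal (K / (1 - q))"
proof -
  have "(\<lambda>n. K * q ^ n) sums (K * (1 / (1 - q)))"
    using assms by (intro sums_mult geometric_sums) auto
  then show ?thesis using assms by (intro suminf_ennreal_eq) auto
qed

text \<open>On dyadic level n the weight 16^(-n) meets a cap of radius 2^(n+1), whose measure is of
  order 4^n / rho^2; the ratio 1/4 remains and sums to a constant independent of the centre.\<close>

lemma nsph_gauss:
  assumes c: "c > 0"
  shows "\<exists>K>0. \<forall>p \<rho>. \<rho> > 0 \<longrightarrow> nsph (\<lambda>\<omega>. ennreal (exp (- c * (norm (p - \<rho> *\<^sub>R \<omega>))\<^sup>2))) \<le> ennreal (K / \<rho>\<^sup>2)"
proof -
  \<comment> \<open>The term 2/c^2 comes from exp u >= u^2/2 at u = c y^2, and 1 from the trivial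
    bound on the exponential.\<close>
  define K0 where "K0 = 1 + 2 / c\<^sup>2"
  have K0: "K0 > 0" using c by (simp add: K0_def add_pos_nonneg)
  have ex: "exp (- c * y\<^sup>2) \<le> K0" "exp (- c * y\<^sup>2) * y ^ 4 \<le> K0" for y :: real
  proof -
    have "exp (- c * y\<^sup>2) \<le> 1" using c by simp
    moreover have "0 \<le> 2 / c\<^sup>2" by simp
    ultimately show "exp (- c * y\<^sup>2) \<le> K0" unfolding K0_def by linarith
    have "(c * y\<^sup>2)\<^sup>2 / 2 \<le> exp (c * y\<^sup>2)"
      using exp_lower_Taylor_quadratic[of "c * y\<^sup>2"] c by (smt (verit) zero_le_mult_iff zero_le_power2)
    then have "c\<^sup>2 * y ^ 4 \<le> 2 * exp (c * y\<^sup>2)" by (simp add: power_mult_distrib)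
    then have "exp (- c * y\<^sup>2) * y ^ 4 \<le> 2 / c\<^sup>2"
      using c by (simp add: exp_minus field_simps)
    then show "exp (- c * y\<^sup>2) * y ^ 4 \<le> K0" unfolding K0_def by linarith
  qed
  have "nsph (\<lambda>\<omega>. ennreal (exp (- c * (norm (p - \<rho> *\<^sub>R \<omega>))\<^sup>2))) \<le> ennreal ((4 * K0 * Kcap / (1 - 1/4)) / \<rho>\<^sup>2)" if \<rho>: "\<rho> > 0" for p \<rho>
  proof -
    have "nsph (\<lambda>\<omega>. ennreal (exp (- c * (norm (p - \<rho> *\<^sub>R \<omega>))\<^sup>2)))
       \<le> nsph (\<lambda>\<omega>. \<Sum>n. ennreal (K0 * (1/16) ^ n) * indicator {x. norm (p - \<rho> *\<^sub>R x) \<le> 2 ^ (n + 1)} \<omega>)"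
    proof (rule nsph_mono)
      fix \<omega> :: vel
      show "ennreal (exp (- c * (norm (p - \<rho> *\<^sub>R \<omega>))\<^sup>2)) \<le> (\<Sum>n. ennreal (K0 * (1/16) ^ n) * indicator {x. norm (p - \<rho> *\<^sub>R x) \<le> 2 ^ (n + 1)} \<omega>)"
        using dyadic_bound[of "norm (p - \<rho> *\<^sub>R \<omega>)" "exp (- c * (norm (p - \<rho> *\<^sub>R \<omega>))\<^sup>2)" K0] ex
        by (simp add: indicator_def)
    qed
    also have "\<dots> = (\<Sum>n. ennreal (K0 * (1/16) ^ n) * nsph (\<lambda>\<omega>. indicator {x. norm (p - \<rho> *\<^sub>R x) \<le> 2 ^ (n + 1)} \<omega>))"
      unfolding nsph_def ennreal_suminf_cmult[symmetric]
      by (subst nn_integral_suminf, measurable, intro suminf_cong, subst nn_integral_cmult[symmetric], measurable) (simp add: mult_ac)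
    also have "\<dots> \<le> (\<Sum>n. ennreal ((4 * K0 * Kcap / \<rho>\<^sup>2) * (1/4) ^ n))"
    proof (intro suminf_le allI)
      fix n
      have "ennreal (K0 * (1/16) ^ n) * nsph (\<lambda>\<omega>. indicator {x. norm (p - \<rho> *\<^sub>R x) \<le> 2 ^ (n + 1)} \<omega>)
         \<le> ennreal (K0 * (1/16) ^ n) * ennreal (Kcap * (2 ^ (n + 1))\<^sup>2 / \<rho>\<^sup>2)"
        by (intro mult_left_mono nsph_cap \<rho>) auto
      also have "\<dots> = ennreal ((K0 * (1/16) ^ n) * (Kcap * (2 ^ (n + 1))\<^sup>2 / \<rho>\<^sup>2))"
        using K0 Kcap_pos by (subst ennreal_mult) auto
      also have "(K0 * (1/16) ^ n) * (Kcap * (2 ^ (n + 1))\<^sup>2 / \<rho>\<^sup>2) = (4 * K0 * Kcap / \<rho>\<^sup>2) * ((1/16) ^ n * (2 ^ n)\<^sup>2)"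
        by (simp add: power_mult_distrib)
      also have "(1/16) ^ n * (2 ^ n)\<^sup>2 = (1/4 :: real) ^ n"
      proof -
        have "(2 ^ n)\<^sup>2 = (4::real) ^ n" by (simp add: power2_eq_square power_mult_distrib[symmetric])
        then show ?thesis by (simp add: power_mult_distrib[symmetric])
      qed
      finally show "ennreal (K0 * (1/16) ^ n) * nsph (\<lambda>\<omega>. indicator {x. norm (p - \<rho> *\<^sub>R x) \<le> 2 ^ (n + 1)} \<omega>)
        \<le> ennreal ((4 * K0 * Kcap / \<rho>\<^sup>2) * (1/4) ^ n)" .
    qed auto
    also have "\<dots> = ennreal ((4 * K0 * Kcap / \<rho>\<^sup>2) / (1 - 1/4))"
      using K0 Kcap_pos by (intro ennreal_geometric_sum) auto
    finally show ?thesis by (simp add: field_simps)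
  qed
  then show ?thesis using K0 Kcap_pos by (intro exI[of _ "4 * K0 * Kcap / (1 - 1/4)"]) auto
qed

section \<open>Gaussian moments and integrable singularities on velocity space\<close>

lemma pow_exp_le:
  fixes u :: real
  assumes "u \<ge> 0"
  shows "u ^ k * exp (- u) \<le> real k ^ k"
proof (cases "k = 0")
  case False
  have "(u / real k) ^ k \<le> exp (u / real k) ^ k"
  proof (rule power_mono)
    show "u / real k \<le> exp (u / real k)" using exp_ge_add_one_self[of "u / real k"] by linarith
  qed (use assms in simp)
  also have "\<dots> = exp u" using False by (simp add: exp_of_nat_mult[symmetric])
  finally have "u ^ k \<le> real k ^ k * exp u" using False by (simp add: power_divide field_simps)
  then show ?thesis by (simp add: exp_minus field_simps)
qed (use assms in simp)

lemma emeasure_cball_vel: "r \<ge> 0 \<Longrightarrow> emeasure lborel (cball (0::vel) r) = ennreal (unit_ball_vol 3 * r ^ 3)"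
  by (simp add: emeasure_cball)

text \<open>Fourth-power decay beats the volume growth 8^n and leaves the ratio 1/2. The constant 16
  is 8, from the doubled radii, times 2, from the geometric series.\<close>

lemma nn_integral_dyadic:
  fixes v :: "vel \<Rightarrow> real"
  assumes [measurable]: "v \<in> borel_measurable borel"
    and v: "\<And>x. v x \<ge> 0" "\<And>x. v x \<le> K" "\<And>x. v x * norm x ^ 4 \<le> K"
  shows "(\<integral>\<^sup>+x. ennreal (v x) \<partial>lborel) \<le> ennreal (16 * K * unit_ball_vol 3)"
proof -
  have K: "K \<ge> 0" using v(1)[of 0] v(2)[of 0] by linarith
  have "(\<integral>\<^sup>+x. ennreal (v x) \<partial>lborel) \<le> (\<integral>\<^sup>+x. (\<Sum>n. ennreal (K * (1/16) ^ n) * indicator (cball (0::vel) (2 ^ (n + 1))) x) \<partial>lborel)"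
  proof (rule nn_integral_mono)
    fix x :: vel
    show "ennreal (v x) \<le> (\<Sum>n. ennreal (K * (1/16) ^ n) * indicator (cball (0::vel) (2 ^ (n + 1))) x)"
      using dyadic_bound[of "norm x" "v x" K] v by (simp add: indicator_def)
  qed
  also have "\<dots> = (\<Sum>n. ennreal (K * (1/16) ^ n) * emeasure lborel (cball (0::vel) (2 ^ (n + 1))))"
    by (subst nn_integral_suminf) (auto simp: nn_integral_cmult_indicator)
  also have "\<dots> = (\<Sum>n. ennreal ((8 * K * unit_ball_vol 3) * (1/2) ^ n))"
  proof (rule suminf_cong)
    fix n
    have "ennreal (K * (1/16) ^ n) * emeasure lborel (cball (0::vel) (2 ^ (n + 1)))
       = ennreal ((K * (1/16) ^ n) * (unit_ball_vol 3 * (2 ^ (n + 1)) ^ 3))"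
      using K by (subst emeasure_cball_vel) (auto simp: ennreal_mult)
    also have "(K * (1/16) ^ n) * (unit_ball_vol 3 * (2 ^ (n + 1)) ^ 3) = (8 * K * unit_ball_vol 3) * ((1/16) ^ n * (2 ^ n) ^ 3)"
      by (simp add: power_mult_distrib)
    also have "(1/16) ^ n * (2 ^ n) ^ 3 = (1/2 :: real) ^ n"
    proof -
      have "(2 ^ n) ^ 3 = ((2::real) ^ 3) ^ n" by (simp only: power_mult[symmetric] mult.commute)
      then show ?thesis by (simp add: power_mult_distrib[symmetric])
    qed
    finally show "ennreal (K * (1/16) ^ n) * emeasure lborel (cball (0::vel) (2 ^ (n + 1))) = ennreal ((8 * K * unit_ball_vol 3) * (1/2) ^ n)" .
  qed
  also have "\<dots> = ennreal ((8 * K * unit_ball_vol 3) / (1 - 1/2))"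
    using K by (intro ennreal_geometric_sum) auto
  finally show ?thesis by (simp add: mult.assoc)
qed

lemma gauss_moment:
  assumes c: "c > 0"
  shows "\<exists>K>0. (\<integral>\<^sup>+(x::vel). ennreal ((1 + norm x)\<^sup>2 * exp (- c * (norm x)\<^sup>2)) \<partial>lborel) \<le> ennreal K"
proof -
  \<comment> \<open>After (1 + y)^2 <= 2 + 2 y^2 the four summands bound 2, 2 y^2, 2 y^4 and 2 y^6
    times the Gaussian, through u^k exp(-u) <= k^k at u = c y^2.\<close>
  define K where "K = 2 + 2 / c + 8 / c\<^sup>2 + 54 / c ^ 3"
  have K0: "K > 0" using c by (simp add: K_def add_pos_nonneg)
  have b: "(1 + y)\<^sup>2 * exp (- c * y\<^sup>2) \<le> K" "(1 + y)\<^sup>2 * exp (- c * y\<^sup>2) * y ^ 4 \<le> K" for y :: real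
  proof -
    define u where "u = c * y\<^sup>2"
    have u: "u \<ge> 0" using c by (simp add: u_def)
    have y2: "y\<^sup>2 = u / c" using c by (simp add: u_def)
    have y4: "y ^ 4 = u\<^sup>2 / c\<^sup>2" using c by (simp add: u_def power_mult_distrib)
    have "0 \<le> (1 - y)\<^sup>2" by simp
    then have "(1 + y)\<^sup>2 \<le> 2 + 2 * y\<^sup>2" by (simp add: power2_eq_square algebra_simps)
    then have sq: "(1 + y)\<^sup>2 \<le> 2 + 2 * u / c" unfolding y2 by simp
    have e: "exp (- u) \<le> 1" "u * exp (- u) \<le> 1" "u\<^sup>2 * exp (- u) \<le> 4" "u ^ 3 * exp (- u) \<le> 27"
      using u pow_exp_le[OF u, of 1] pow_exp_le[OF u, of 2] pow_exp_le[OF u, of 3] by simp_all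
    have "(1 + y)\<^sup>2 * exp (- c * y\<^sup>2) \<le> (2 + 2 * u / c) * exp (- u)"
      using sq by (simp add: u_def)
    also have "\<dots> = 2 * exp (- u) + (2 / c) * (u * exp (- u))" by (simp add: algebra_simps)
    also have "\<dots> \<le> 2 * 1 + (2 / c) * 1" using c by (intro add_mono mult_left_mono e) auto
    also have "\<dots> \<le> K" using c by (simp add: K_def)
    finally show "(1 + y)\<^sup>2 * exp (- c * y\<^sup>2) \<le> K" .
    have "(1 + y)\<^sup>2 * exp (- c * y\<^sup>2) * y ^ 4 \<le> (2 + 2 * u / c) * exp (- u) * y ^ 4"
      using sq by (intro mult_right_mono) (auto simp: u_def)
    also have "\<dots> = (2 / c\<^sup>2) * (u\<^sup>2 * exp (- u)) + (2 / c ^ 3) * (u ^ 3 * exp (- u))"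
      unfolding y4 using c by (simp add: field_simps power2_eq_square power3_eq_cube)
    also have "\<dots> \<le> (2 / c\<^sup>2) * 4 + (2 / c ^ 3) * 27" using c by (intro add_mono mult_left_mono e) auto
    also have "\<dots> \<le> K" using c by (simp add: K_def)
    finally show "(1 + y)\<^sup>2 * exp (- c * y\<^sup>2) * y ^ 4 \<le> K" .
  qed
  have "(\<integral>\<^sup>+(x::vel). ennreal ((1 + norm x)\<^sup>2 * exp (- c * (norm x)\<^sup>2)) \<partial>lborel) \<le> ennreal (16 * K * unit_ball_vol 3)"
    by (rule nn_integral_dyadic) (use b in auto)
  then show ?thesis using K0 by (intro exI[of _ "16 * K * unit_ball_vol 3"]) auto
qed

text \<open>Dyadic shells shrinking to the origin: the values grow like 4^n while the volumes decay
  like 8^(-n). This is the square integrability of 1/|z| near the origin, used later for the density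
  of the scattered velocity.\<close>

lemma nn_integral_inverse_square:
  assumes R: "R > 0"
  shows "(\<integral>\<^sup>+(z::vel). indicator (ball 0 R) z * ennreal (1 / (norm z)\<^sup>2) \<partial>lborel) \<le> ennreal (8 * unit_ball_vol 3 * R)"
proof -
  have "(\<integral>\<^sup>+(z::vel). indicator (ball 0 R) z * ennreal (1 / (norm z)\<^sup>2) \<partial>lborel)
     \<le> (\<integral>\<^sup>+z. (\<Sum>n. ennreal (4 ^ (n + 1) / R\<^sup>2) * indicator (cball (0::vel) (R / 2 ^ n)) z) \<partial>lborel)"
  proof (rule nn_integral_mono)
    fix z :: vel
    show "indicator (ball 0 R) z * ennreal (1 / (norm z)\<^sup>2) \<le> (\<Sum>n. ennreal (4 ^ (n + 1) / R\<^sup>2) * indicator (cball (0::vel) (R / 2 ^ n)) z)"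
    proof (cases "z \<in> ball 0 R \<and> z \<noteq> 0")
      case False then show ?thesis by (auto simp: indicator_def)
    next
      case True
      then have z: "0 < norm z" "norm z < R" by auto
      have ex: "\<exists>n. R / 2 ^ (n + 1) < norm z"
      proof -
        obtain n where "R / norm z < 2 ^ n" using real_arch_pow[of 2] by auto
        also have "2 ^ n \<le> (2::real) ^ (n + 1)" by simp
        finally show ?thesis using z by (intro exI[of _ n]) (simp add: field_simps)
      qed
      define n where "n = (LEAST n. R / 2 ^ (n + 1) < norm z)"
      have n1: "R / 2 ^ (n + 1) < norm z" unfolding n_def using ex by (rule LeastI_ex)
      have n2: "norm z \<le> R / 2 ^ n"
      proof (cases n)
        case (Suc k)
        then have "\<not> R / 2 ^ (k + 1) < norm z" using not_less_Least[of k "\<lambda>n. R / 2 ^ (n + 1) < norm z"] by (simp add: n_def)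
        then show ?thesis using Suc by simp
      qed (use z in simp)
      have "(R / 2 ^ (n + 1))\<^sup>2 \<le> (norm z)\<^sup>2" using n1 R by (intro power_mono) auto
      moreover have "(2 ^ (n + 1))\<^sup>2 = (4::real) ^ (n + 1)" by (simp add: power2_eq_square power_mult_distrib[symmetric])
      ultimately have "R\<^sup>2 / 4 ^ (n + 1) \<le> (norm z)\<^sup>2" by (simp add: power_divide)
      then have "1 / (norm z)\<^sup>2 \<le> 4 ^ (n + 1) / R\<^sup>2" using z R by (simp add: field_simps)
      then have "indicator (ball 0 R) z * ennreal (1 / (norm z)\<^sup>2) \<le> ennreal (4 ^ (n + 1) / R\<^sup>2) * indicator (cball (0::vel) (R / 2 ^ n)) z"
        using True n2 by (simp add: ennreal_leI)
      also have "\<dots> \<le> (\<Sum>n. ennreal (4 ^ (n + 1) / R\<^sup>2) * indicator (cball (0::vel) (R / 2 ^ n)) z)"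
      proof -
        have "u n \<le> suminf u" for u :: "nat \<Rightarrow> ennreal" using sum_le_suminf[of u "{n}"] by simp
        then show ?thesis .
      qed
      finally show ?thesis .
    qed
  qed
  also have "\<dots> = (\<Sum>n. ennreal (4 ^ (n + 1) / R\<^sup>2) * emeasure lborel (cball (0::vel) (R / 2 ^ n)))"
    by (subst nn_integral_suminf) (auto simp: nn_integral_cmult_indicator)
  also have "\<dots> = (\<Sum>n. ennreal ((4 * unit_ball_vol 3 * R) * (1/2) ^ n))"
  proof (rule suminf_cong)
    fix n
    have "ennreal (4 ^ (n + 1) / R\<^sup>2) * emeasure lborel (cball (0::vel) (R / 2 ^ n))
       = ennreal ((4 ^ (n + 1) / R\<^sup>2) * (unit_ball_vol 3 * (R / 2 ^ n) ^ 3))"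
    proof -
      have "emeasure lborel (cball (0::vel) (R / 2 ^ n)) = ennreal (unit_ball_vol 3 * (R / 2 ^ n) ^ 3)"
        using R by (intro emeasure_cball_vel) simp
      then show ?thesis using R by (simp only:) (intro ennreal_mult[symmetric]; simp)
    qed
    also have "(4 ^ (n + 1) / R\<^sup>2) * (unit_ball_vol 3 * (R / 2 ^ n) ^ 3) = (4 * unit_ball_vol 3 * R) * (4 ^ n / (2 ^ n) ^ 3)"
      using R by (simp add: power_divide power2_eq_square power3_eq_cube)
    also have "4 ^ n / (2 ^ n) ^ 3 = (1/2 :: real) ^ n"
    proof -
      have "(2 ^ n) ^ 3 = ((2::real) ^ 3) ^ n" by (simp only: power_mult[symmetric] mult.commute)
      then show ?thesis by (simp add: power_divide[symmetric])
    qed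
    finally show "ennreal (4 ^ (n + 1) / R\<^sup>2) * emeasure lborel (cball (0::vel) (R / 2 ^ n)) = ennreal ((4 * unit_ball_vol 3 * R) * (1/2) ^ n)" .
  qed
  also have "\<dots> = ennreal ((4 * unit_ball_vol 3 * R) / (1 - 1/2))"
    using R by (intro ennreal_geometric_sum) auto
  finally show ?thesis by (simp add: mult.assoc)
qed

text \<open>On the ball 1/|z| is at most R/|z|^2. The radius R + 1 replaces the closed ball by an
  open one; at the origin both sides are 0 by the convention for division.\<close>

lemma nn_integral_inverse_norm:
  assumes R: "R > 0"
  shows "(\<integral>\<^sup>+(z::vel). indicator (cball 0 R) z * ennreal (1 / norm z) \<partial>lborel) \<le> ennreal (R * (8 * unit_ball_vol 3 * (R + 1)))"
proof -
  have "(\<integral>\<^sup>+(z::vel). indicator (cball 0 R) z * ennreal (1 / norm z) \<partial>lborel)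
    \<le> (\<integral>\<^sup>+(z::vel). ennreal R * (indicator (ball 0 (R + 1)) z * ennreal (1 / (norm z)\<^sup>2)) \<partial>lborel)"
  proof (rule nn_integral_mono)
    fix z :: vel
    have "1 / norm z \<le> R * (1 / (norm z)\<^sup>2)" if "norm z \<le> R"
      using that by (cases "z = 0") (auto simp: field_simps power2_eq_square)
    then show "indicator (cball 0 R) z * ennreal (1 / norm z) \<le> ennreal R * (indicator (ball 0 (R + 1)) z * ennreal (1 / (norm z)\<^sup>2))"
      using R by (auto simp: indicator_def ennreal_mult[symmetric] intro!: ennreal_leI)
  qed
  also have "\<dots> = ennreal R * (\<integral>\<^sup>+(z::vel). (indicator (ball 0 (R + 1)) z * ennreal (1 / (norm z)\<^sup>2)) \<partial>lborel)"
    by (rule nn_integral_cmult) measurable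
  also have "\<dots> \<le> ennreal R * ennreal (8 * unit_ball_vol 3 * (R + 1))"
    using R by (intro mult_left_mono nn_integral_inverse_square) auto
  finally show ?thesis using R by (simp add: ennreal_mult)
qed

section \<open>The law of the post-collisional velocity\<close>

text \<open>Relative speed after a collision with scaled energy gap \<open>d\<close>. It is set to 0
  below the threshold, so that estimates can be written without a case distinction on whether the
  channel is open.\<close>

definition rho :: "real \<Rightarrow> vel \<Rightarrow> real" where
  "rho d g = sqrt (max 0 ((norm g)\<^sup>2 - 2 * d))"

lemma rho_nonneg [simp]: "rho d g \<ge> 0"
  by (simp add: rho_def)

lemma rho_measurable [measurable]: "rho d \<in> borel_measurable borel"
  unfolding rho_def by measurable

lemma rho_le: "rho d g \<le> norm g + sqrt (2 * \<bar>d\<bar>)"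
proof -
  have "rho d g \<le> sqrt ((norm g)\<^sup>2 + 2 * \<bar>d\<bar>)" unfolding rho_def by (intro real_sqrt_le_mono) auto
  also have "\<dots> \<le> sqrt ((norm g)\<^sup>2) + sqrt (2 * \<bar>d\<bar>)" by (rule sqrt_add_le_add_sqrt) auto
  finally show ?thesis by simp
qed

lemma norm_le_rho: "norm g \<le> rho d g + sqrt (2 * \<bar>d\<bar>)"
proof -
  have "norm g = sqrt ((norm g)\<^sup>2)" by simp
  also have "\<dots> \<le> sqrt (max 0 ((norm g)\<^sup>2 - 2 * d) + 2 * \<bar>d\<bar>)" by (intro real_sqrt_le_mono) auto
  also have "\<dots> \<le> rho d g + sqrt (2 * \<bar>d\<bar>)" unfolding rho_def by (rule sqrt_add_le_add_sqrt) auto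
  finally show ?thesis .
qed

text \<open>The law of the shifted post-collisional velocity $c_1 g + c_2\rho\,\omega$ with weight $\rho$, for $|g|\le R$.
  It is rotation invariant, so its mass on a ball is estimated by averaging the ball over a sphere;
  this yields a density bounded by a multiple of $1/|z|$.\<close>

locale scatter =
  fixes c1 c2 d R :: real
  assumes c: "c1 \<noteq> 0" "c2 \<noteq> 0" and R: "R > 0"
begin

definition post :: "vel \<Rightarrow> vel \<Rightarrow> vel" where
  "post g \<omega> = c1 *\<^sub>R g + (c2 * rho d g) *\<^sub>R \<omega>"

text \<open>Kept as a measure, so that rotation invariance, Fubini and comparison with an explicit
  density can be applied. The second component encodes the direction as in
  \<open>nsph\<close>.\<close>

definition N :: "vel measure" where
  "N = distr (density lborel (\<lambda>p::vel \<times> vel. indicator (cball 0 R) (fst p) * ennreal (rho d (fst p)) * indicator (ball 0 1 - {0}) (snd p)))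
     borel (\<lambda>p. post (fst p) (snd p /\<^sub>R norm (snd p)))"

lemma post_measurable [measurable (raw)]:
  assumes [measurable]: "f \<in> borel_measurable M" "g \<in> borel_measurable M"
  shows "(\<lambda>x. post (f x) (g x)) \<in> borel_measurable M"
  unfolding post_def by measurable

lemma sets_N [simp, measurable_cong]: "sets N = sets borel"
  by (simp add: N_def)

lemma space_N [simp]: "space N = UNIV"
  by (simp add: N_def)

lemma N_nn:
  assumes f [measurable]: "f \<in> borel_measurable borel"
  shows "(\<integral>\<^sup>+z. f z \<partial>N) = (\<integral>\<^sup>+g. indicator (cball 0 R) g * ennreal (rho d g) * nsph (\<lambda>\<omega>. f (post g \<omega>)) \<partial>lborel)"
proof -
  let ?w = "\<lambda>p::vel \<times> vel. indicator (cball 0 R) (fst p) * ennreal (rho d (fst p)) * indicator (ball 0 1 - {0}) (snd p) :: ennreal"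
  have [measurable]: "?w \<in> borel_measurable (borel \<Otimes>\<^sub>M borel)" by measurable
  have [measurable]: "(\<lambda>p. post (fst p) (snd p /\<^sub>R norm (snd p))) \<in> borel_measurable (borel \<Otimes>\<^sub>M borel)" by measurable
  have "(\<integral>\<^sup>+z. f z \<partial>N) = (\<integral>\<^sup>+p. ?w p * f (post (fst p) (snd p /\<^sub>R norm (snd p))) \<partial>lborel)"
    unfolding N_def by (subst nn_integral_distr) (auto simp: nn_integral_density borel_prod[symmetric])
  also have "\<dots> = (\<integral>\<^sup>+g. \<integral>\<^sup>+x. ?w (g, x) * f (post (fst (g, x)) (snd (g, x) /\<^sub>R norm (snd (g, x)))) \<partial>lborel \<partial>lborel)"
    unfolding lborel_prod[symmetric]
    by (rule lborel.nn_integral_fst[symmetric]) measurable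
  also have "\<dots> = (\<integral>\<^sup>+g. indicator (cball 0 R) g * ennreal (rho d g) * nsph (\<lambda>\<omega>. f (post g \<omega>)) \<partial>lborel)"
    unfolding nsph_def
    by (intro nn_integral_cong, subst nn_integral_cmult[symmetric]) (auto simp: mult_ac)
  finally show ?thesis .
qed

lemma N_emeasure:
  assumes [measurable]: "A \<in> sets borel"
  shows "emeasure N A = (\<integral>\<^sup>+g. indicator (cball 0 R) g * ennreal (rho d g) * nsph (\<lambda>\<omega>. indicator A (post g \<omega>)) \<partial>lborel)"
  using N_nn[of "indicator A"] by simp

definition P where "P = R + sqrt (2 * \<bar>d\<bar>)"

lemma P_nonneg: "P \<ge> 0" unfolding P_def using R by simp

lemma rho_P: "norm g \<le> R \<Longrightarrow> rho d g \<le> P"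
  unfolding P_def using rho_le[of d g] by linarith

sublocale finite_measure N
proof
  have "emeasure N (space N) = (\<integral>\<^sup>+g. indicator (cball 0 R) g * ennreal (rho d g) * nsph (\<lambda>\<omega>. 1) \<partial>lborel)"
    using N_emeasure[of UNIV] by simp
  also have "\<dots> \<le> (\<integral>\<^sup>+g. (ennreal P * ennreal (unit_ball_vol 3)) * indicator (cball (0::vel) R) g \<partial>lborel)"
  proof (rule nn_integral_mono)
    fix g :: vel
    show "indicator (cball 0 R) g * ennreal (rho d g) * nsph (\<lambda>\<omega>. 1) \<le> (ennreal P * ennreal (unit_ball_vol 3)) * indicator (cball (0::vel) R) g"
      using nsph_one_le rho_P[of g] by (auto simp: indicator_def intro!: mult_mono ennreal_leI)
  qed
  also have "\<dots> < \<infinity>"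
    using R by (simp add: nn_integral_cmult_indicator emeasure_cball ennreal_mult_less_top)
  finally show "emeasure N (space N) \<noteq> \<infinity>" by simp
qed

text \<open>The strip constant over the slope factor \<open>2 * \<bar>c1 * c2\<bar>\<close>, times
  the bound for the integral of 1/|g| over the ball of radius \<open>R\<close>.\<close>

definition Ka where "Ka = Kst / (2 * \<bar>c1 * c2\<bar>) * (R * (8 * unit_ball_vol 3 * (R + 1)))"

lemma Ka_nonneg: "Ka \<ge> 0" unfolding Ka_def using Kst_pos R by simp

text \<open>At fixed g the squared norm of the scattered velocity is affine in the cosine, with
  slope 2 |c1 c2| rho |g|, so an annulus becomes a strip. The weight rho cancels the rho of the
  slope. What remains is 1/|g|, which is integrable on the ball; slow outgoing pairs do no
  harm.\<close>

lemma N_annulus: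
  assumes ab: "a \<le> b"
  shows "emeasure N {z. a \<le> (norm z)\<^sup>2 \<and> (norm z)\<^sup>2 \<le> b} \<le> ennreal (Ka * (b - a))"
proof -
  let ?A = "{z::vel. a \<le> (norm z)\<^sup>2 \<and> (norm z)\<^sup>2 \<le> b}"
  let ?k = "Kst * (b - a) / (2 * \<bar>c1 * c2\<bar>)"
  have k0: "?k \<ge> 0" using ab Kst_pos by simp
  have "emeasure N ?A = (\<integral>\<^sup>+g. indicator (cball 0 R) g * ennreal (rho d g) * nsph (\<lambda>\<omega>. indicator ?A (post g \<omega>)) \<partial>lborel)"
    by (rule N_emeasure) measurable
  also have "\<dots> \<le> (\<integral>\<^sup>+g. ennreal ?k * (indicator (cball 0 R) g * ennreal (1 / norm (g::vel))) \<partial>lborel)"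
  proof (rule nn_integral_mono_AE, use AE_lborel_singleton[of "0::vel"] in eventually_elim)
    case (elim g)
    define r where "r = rho d g"
    show ?case
    proof (cases "norm g \<le> R \<and> r > 0")
      case False
      then have "r = 0 \<or> g \<notin> cball 0 R" using rho_nonneg[of d g] by (auto simp: r_def)
      then show ?thesis by (auto simp: r_def)
    next
      case True
      \<comment> \<open>The sign of \<open>c1 * c2\<close> is moved into the unit vector so that the
        slope \<open>D\<close> is positive.\<close>
      define e where "e = (sgn (c1 * c2) / norm g) *\<^sub>R g"
      define D where "D = 2 * \<bar>c1 * c2\<bar> * r * norm g"
      define \<alpha> where "\<alpha> = c1\<^sup>2 * (norm g)\<^sup>2 + c2\<^sup>2 * r\<^sup>2"
      have g: "norm g > 0" using elim by simp
      have D: "D > 0" unfolding D_def using c g True by simp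
      have e: "norm e = 1" unfolding e_def using c g by (simp add: abs_sgn_eq)
      have De: "D * (e \<bullet> \<omega>) = 2 * c1 * c2 * r * (g \<bullet> \<omega>)" for \<omega>
        using g mult_sgn_abs[of "c1 * c2"] unfolding D_def e_def by (simp add: field_simps)
      have sq: "(norm (post g \<omega>))\<^sup>2 = \<alpha> + D * (e \<bullet> \<omega>)" if w: "norm \<omega> = 1" for \<omega>
      proof -
        have "(norm (post g \<omega>))\<^sup>2 = (norm (c1 *\<^sub>R g))\<^sup>2 + (norm ((c2 * r) *\<^sub>R \<omega>))\<^sup>2 + 2 * ((c1 *\<^sub>R g) \<bullet> ((c2 * r) *\<^sub>R \<omega>))"
          using dot_norm[of "c1 *\<^sub>R g" "(c2 * r) *\<^sub>R \<omega>"] unfolding post_def r_def by (simp only: field_simps)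
        also have "\<dots> = \<alpha> + D * (e \<bullet> \<omega>)" unfolding De \<alpha>_def using w by (simp add: power_mult_distrib)
        finally show ?thesis .
      qed
      have "nsph (\<lambda>\<omega>. indicator ?A (post g \<omega>)) \<le> nsph (\<lambda>\<omega>. indicator {(a - \<alpha>) / D..(a - \<alpha>) / D + (b - a) / D} (e \<bullet> \<omega>))"
      proof (rule nsph_mono)
        fix \<omega> :: vel assume "norm \<omega> = 1"
        have eD: "(a - \<alpha>) / D + (b - a) / D = (b - \<alpha>) / D" by (simp add: add_divide_distrib[symmetric])
        from sq[OF \<open>norm \<omega> = 1\<close>] show "indicator ?A (post g \<omega>) \<le> (indicator {(a - \<alpha>) / D..(a - \<alpha>) / D + (b - a) / D} (e \<bullet> \<omega>) :: ennreal)"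
          using D unfolding eD by (auto simp: indicator_def pos_divide_le_eq pos_le_divide_eq algebra_simps)
      qed
      also have "\<dots> \<le> ennreal (Kst * ((b - a) / D))" using D ab by (intro nsph_strip e) simp
      finally have "indicator (cball 0 R) g * ennreal (rho d g) * nsph (\<lambda>\<omega>. indicator ?A (post g \<omega>))
         \<le> indicator (cball 0 R) g * ennreal r * ennreal (Kst * ((b - a) / D))"
        unfolding r_def by (rule mult_left_mono) simp
      also have "\<dots> = indicator (cball 0 R) g * ennreal (r * (Kst * ((b - a) / D)))"
      proof -
        have "ennreal r * ennreal (Kst * ((b - a) / D)) = ennreal (r * (Kst * ((b - a) / D)))"
          using True D ab Kst_pos by (intro ennreal_mult[symmetric]) auto
        then show ?thesis by (simp only: mult.assoc)
      qed
      also have "r * (Kst * ((b - a) / D)) = ?k * (1 / norm g)"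
        unfolding D_def using True g c by (simp add: field_simps)
      also have "ennreal (?k * (1 / norm g)) = ennreal ?k * ennreal (1 / norm g)"
        using k0 by (rule ennreal_mult) simp
      finally show ?thesis by (simp add: mult_ac)
    qed
  qed
  also have "\<dots> = ennreal ?k * (\<integral>\<^sup>+g. (indicator (cball 0 R) g * ennreal (1 / norm (g::vel))) \<partial>lborel)"
    by (rule nn_integral_cmult) measurable
  also have "\<dots> \<le> ennreal ?k * ennreal (R * (8 * unit_ball_vol 3 * (R + 1)))"
    by (intro mult_left_mono nn_integral_inverse_norm R) simp
  also have "\<dots> = ennreal (?k * (R * (8 * unit_ball_vol 3 * (R + 1))))"
    using k0 R by (intro ennreal_mult[symmetric]) auto
  also have "?k * (R * (8 * unit_ball_vol 3 * (R + 1))) = Ka * (b - a)" unfolding Ka_def by simp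
  finally show ?thesis .
qed

lemma N_orthogonal:
  assumes U: "orthogonal_transformation U" and f [measurable]: "f \<in> borel_measurable borel"
  shows "(\<integral>\<^sup>+z. f (U z) \<partial>N) = (\<integral>\<^sup>+z. f z \<partial>N)"
proof -
  have lin: "linear U" and n: "norm (U x) = norm x" for x
    using U by (auto simp: orthogonal_transformation)
  have "bounded_linear U" using lin by (simp add: linear_conv_bounded_linear)
  then have [measurable]: "U \<in> borel_measurable borel"
    by (intro borel_measurable_continuous_onI linear_continuous_on)
  have r: "rho d (U g) = rho d g" for g by (simp add: rho_def n)
  have p: "U (post g \<omega>) = post (U g) (U \<omega>)" for g \<omega>
    unfolding post_def by (simp add: linear_add[OF lin] linear_scale[OF lin] r)
  have "(\<integral>\<^sup>+z. f (U z) \<partial>N) = (\<integral>\<^sup>+g. indicator (cball 0 R) g * ennreal (rho d g) * nsph (\<lambda>\<omega>. f (U (post g \<omega>))) \<partial>lborel)"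
    by (rule N_nn) measurable
  also have "\<dots> = (\<integral>\<^sup>+g. indicator (cball 0 R) (U g) * ennreal (rho d (U g)) * nsph (\<lambda>\<omega>. f (post (U g) \<omega>)) \<partial>lborel)"
    unfolding p
    by (intro nn_integral_cong, subst nsph_orthogonal[OF U], measurable) (simp add: indicator_def n r)
  also have "\<dots> = (\<integral>\<^sup>+g. indicator (cball 0 R) g * ennreal (rho d g) * nsph (\<lambda>\<omega>. f (post g \<omega>)) \<partial>lborel)"
    unfolding nsph_def by (rule nn_integral_orthogonal[OF U]) measurable
  also have "\<dots> = (\<integral>\<^sup>+z. f z \<partial>N)" by (rule N_nn[symmetric]) measurable
  finally show ?thesis .
qed

lemma N_cball_rotate:
  assumes "norm z = norm z'"
  shows "emeasure N (cball z e) = emeasure N (cball z' e)"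
proof -
  obtain U :: "vel \<Rightarrow> vel" where U: "orthogonal_transformation U" "U z = z'"
    using assms by (rule orthogonal_transformation_exists)
  have lin: "linear U" and n: "norm (U x) = norm x" for x
    using U by (auto simp: orthogonal_transformation)
  have "dist (U z) (U x) = dist z x" for x
    unfolding dist_norm linear_diff[OF lin, symmetric] by (rule n)
  then have "(indicator (cball z' e) (U x) :: ennreal) = indicator (cball z e) x" for x
    by (simp add: indicator_def U(2))
  then show ?thesis using N_orthogonal[OF U(1), of "indicator (cball z' e)"] by simp
qed

definition Kb where "Kb = Kcap * Ka * 6 / unit_ball_vol 3"

lemma Kb_nonneg: "Kb \<ge> 0" unfolding Kb_def using Kcap_pos Ka_nonneg by simp

text \<open>With r = norm z, Fubini exchanges the average over centres for the measure of the cap of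
  radius e seen from the scattered velocity y, of order e^2/r^2 and nonzero only for r - e <= norm y
  <= r + e. The mass of that annulus is at most \<open>Ka\<close> times (r + e)^2 - (r - e)^2 = 4 r
  e. The product is of order e^3/r, that is, volume over r.\<close>

lemma N_cball:
  assumes e: "0 < e" "e \<le> norm z / 2"
  shows "emeasure N (cball z e) \<le> ennreal (Kb * e ^ 3 / norm z)"
proof -
  define r where "r = norm z"
  have r: "r > 0" "e \<le> r / 2" using e by (auto simp: r_def)
  have V: "unit_ball_vol (3::real) > 0" by simp
  then have V': "unit_ball_vol (3::real) \<noteq> 0" by linarith
  interpret pair_sigma_finite lborel N ..
  have "ennreal (unit_ball_vol 3) * emeasure N (cball z e) = nsph (\<lambda>\<omega>. emeasure N (cball z e))"
    using nsph_cmult[of "\<lambda>_. 1" "emeasure N (cball z e)"] by (simp add: nsph_one mult.commute)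
  also have "\<dots> = nsph (\<lambda>\<omega>. emeasure N (cball (r *\<^sub>R \<omega>) e))"
    using r by (intro nsph_cong N_cball_rotate) (simp add: r_def)
  also have "\<dots> = nsph (\<lambda>\<omega>. \<integral>\<^sup>+y. indicator {x. norm (y - r *\<^sub>R x) \<le> e} \<omega> \<partial>N)"
  proof (rule nsph_cong)
    fix \<omega> :: vel
    have "emeasure N (cball (r *\<^sub>R \<omega>) e) = (\<integral>\<^sup>+y. indicator (cball (r *\<^sub>R \<omega>) e) y \<partial>N)" by simp
    also have "\<dots> = (\<integral>\<^sup>+y. indicator {x. norm (y - r *\<^sub>R x) \<le> e} \<omega> \<partial>N)"
      by (intro nn_integral_cong) (simp add: indicator_def dist_norm norm_minus_commute)
    finally show "emeasure N (cball (r *\<^sub>R \<omega>) e) = (\<integral>\<^sup>+y. indicator {x. norm (y - r *\<^sub>R x) \<le> e} \<omega> \<partial>N)" .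
  qed
  also have "\<dots> = (\<integral>\<^sup>+x. \<integral>\<^sup>+y. indicator (ball 0 1 - {0}) x * indicator {x. norm (y - r *\<^sub>R x) \<le> e} (x /\<^sub>R norm x) \<partial>N \<partial>lborel)"
    unfolding nsph_def by (intro nn_integral_cong, subst nn_integral_cmult[symmetric]) auto
  also have "\<dots> = (\<integral>\<^sup>+y. nsph (\<lambda>\<omega>. indicator {x. norm (y - r *\<^sub>R x) \<le> e} \<omega>) \<partial>N)"
    unfolding nsph_def by (rule Fubini'[symmetric]) (simp add: indicator_def, measurable)
  also have "\<dots> \<le> (\<integral>\<^sup>+y. ennreal (Kcap * e\<^sup>2 / r\<^sup>2) * indicator {y. (r - e)\<^sup>2 \<le> (norm y)\<^sup>2 \<and> (norm y)\<^sup>2 \<le> (r + e)\<^sup>2} y \<partial>N)"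
  proof (rule nn_integral_mono)
    fix y :: vel
    show "nsph (\<lambda>\<omega>. indicator {x. norm (y - r *\<^sub>R x) \<le> e} \<omega>) \<le> ennreal (Kcap * e\<^sup>2 / r\<^sup>2) * indicator {y. (r - e)\<^sup>2 \<le> (norm y)\<^sup>2 \<and> (norm y)\<^sup>2 \<le> (r + e)\<^sup>2} y"
    proof (cases "r - e \<le> norm y \<and> norm y \<le> r + e")
      case True
      then have "(r - e)\<^sup>2 \<le> (norm y)\<^sup>2 \<and> (norm y)\<^sup>2 \<le> (r + e)\<^sup>2" using r by (auto intro!: power_mono)
      then show ?thesis using nsph_cap[OF r(1), of e y] e by simp
    next
      case False
      have "nsph (\<lambda>\<omega>. indicator {x. norm (y - r *\<^sub>R x) \<le> e} \<omega>) \<le> nsph (\<lambda>_. 0)"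
      proof (rule nsph_mono)
        fix \<omega> :: vel assume w: "norm \<omega> = 1"
        have "\<bar>norm y - r\<bar> \<le> norm (y - r *\<^sub>R \<omega>)" using norm_triangle_ineq3[of y "r *\<^sub>R \<omega>"] w r by simp
        then show "indicator {x. norm (y - r *\<^sub>R x) \<le> e} \<omega> \<le> (0 :: ennreal)" using False by (auto simp: indicator_def)
      qed
      then show ?thesis by (simp add: nsph_def)
    qed
  qed
  also have "\<dots> = ennreal (Kcap * e\<^sup>2 / r\<^sup>2) * emeasure N {y. (r - e)\<^sup>2 \<le> (norm y)\<^sup>2 \<and> (norm y)\<^sup>2 \<le> (r + e)\<^sup>2}"
    by (rule nn_integral_cmult_indicator) (simp, measurable)
  also have "\<dots> \<le> ennreal (Kcap * e\<^sup>2 / r\<^sup>2) * ennreal (Ka * ((r + e)\<^sup>2 - (r - e)\<^sup>2))"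
    using r e by (intro mult_left_mono N_annulus power_mono) auto
  also have "\<dots> = ennreal ((Kcap * e\<^sup>2 / r\<^sup>2) * (Ka * ((r + e)\<^sup>2 - (r - e)\<^sup>2)))"
    using Kcap_pos Ka_nonneg r e by (intro ennreal_mult[symmetric]) (auto intro!: mult_nonneg_nonneg power_mono)
  also have "(Kcap * e\<^sup>2 / r\<^sup>2) * (Ka * ((r + e)\<^sup>2 - (r - e)\<^sup>2)) = Kcap * Ka * 4 * e ^ 3 / r"
    using r by (simp add: power2_eq_square power3_eq_cube field_simps)
  also have "ennreal (Kcap * Ka * 4 * e ^ 3 / r) \<le> ennreal (unit_ball_vol 3 * (Kb * e ^ 3 / r))"
    unfolding Kb_def using Kcap_pos Ka_nonneg r e V
    by (intro ennreal_leI) (simp add: divide_right_mono mult_right_mono V')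
  also have "\<dots> = ennreal (unit_ball_vol 3) * ennreal (Kb * e ^ 3 / r)"
    using Kb_nonneg r e by (intro ennreal_mult) auto
  finally have "ennreal (unit_ball_vol 3) * emeasure N (cball z e) \<le> ennreal (unit_ball_vol 3) * ennreal (Kb * e ^ 3 / r)" .
  moreover have "ennreal (unit_ball_vol 3) \<noteq> 0" using V by (simp only: ennreal_eq_0_iff not_le)
  ultimately show ?thesis
    unfolding r_def[symmetric] by (simp only: ennreal_mult_le_mult_iff ennreal_neq_top not_False_eq_True)
qed


text \<open>The bound on balls divided by the volume of the ball, hence the constant of the
  density.\<close>

definition Kc where "Kc = Kb / unit_ball_vol 3"

lemma Kc_nonneg: "Kc \<ge> 0" unfolding Kc_def using Kb_nonneg by simp

text \<open>The proportion \<open>q n z\<close> of a shrinking ball around z that lies in U has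
  lower limit at least 1 on the open set U. Fatou and Fubini turn its integral against
  \<open>N\<close> into the masses of balls centred in U, where the powers of the radius cancel. No
  differentiation theorem is used.\<close>

lemma N_open:
  assumes U: "open U" and \<eta>: "\<eta> > 0" "\<And>z. z \<in> U \<Longrightarrow> \<eta> < norm z"
  shows "emeasure N U \<le> (\<integral>\<^sup>+z. ennreal (Kc / norm z) * indicator U z \<partial>lborel)"
proof -
  have [measurable]: "U \<in> sets borel" using U by simp
  have V: "unit_ball_vol (3::real) > 0" by simp
  interpret pair_sigma_finite lborel N ..
  \<comment> \<open>Half of \<eta> at most, so that the radius stays below half the norm of every
    centre in \<open>U\<close>, as the ball estimate demands.\<close>
  define e where "e n = \<eta> / 2 / real (Suc n)" for n
  have e: "e n > 0" "e n \<le> \<eta> / 2" for n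
  proof -
    show "e n > 0" using \<eta> by (simp add: e_def)
    have "\<eta> / 2 / real (Suc n) \<le> \<eta> / 2 / 1" using \<eta> by (intro divide_left_mono) auto
    then show "e n \<le> \<eta> / 2" by (simp add: e_def)
  qed
  have elim0: "e \<longlonglongrightarrow> 0" unfolding e_def by (rule lim_const_over_n[THEN LIMSEQ_Suc])
  define q where "q n z = ennreal (1 / (unit_ball_vol 3 * e n ^ 3)) * (\<integral>\<^sup>+y. indicator U y * indicator {y. norm (y - z) \<le> e n} y \<partial>lborel)" for n and z :: vel
  have [measurable]: "q n \<in> borel_measurable borel" for n
    unfolding q_def by (simp add: indicator_def) measurable
  have "emeasure N U = (\<integral>\<^sup>+z. indicator U z \<partial>N)" by simp
  also have "\<dots> \<le> (\<integral>\<^sup>+z. liminf (\<lambda>n. q n z) \<partial>N)"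
  proof (rule nn_integral_mono)
    fix z :: vel
    show "indicator U z \<le> liminf (\<lambda>n. q n z)"
    proof (cases "z \<in> U")
      case True
      then obtain \<delta> where \<delta>: "\<delta> > 0" "cball z \<delta> \<subseteq> U" using U by (auto simp: open_contains_cball)
      have "\<forall>\<^sub>F n in sequentially. e n < \<delta>" using order_tendstoD(2)[OF elim0 \<delta>(1)] .
      then have "\<forall>\<^sub>F n in sequentially. 1 \<le> q n z"
      proof eventually_elim
        case (elim n)
        have "(\<integral>\<^sup>+y. indicator U y * indicator {y. norm (y - z) \<le> e n} y \<partial>lborel) = (\<integral>\<^sup>+y. indicator (cball z (e n)) y \<partial>lborel)"
        proof (rule nn_integral_cong)
          fix y :: vel
          have "norm (y - z) \<le> e n \<longleftrightarrow> y \<in> cball z (e n)" by (simp add: dist_norm norm_minus_commute)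
          moreover have "y \<in> U" if "y \<in> cball z (e n)" using that elim \<delta> by auto
          ultimately show "indicator U y * indicator {y. norm (y - z) \<le> e n} y = (indicator (cball z (e n)) y :: ennreal)"
            by (auto simp: indicator_def)
        qed
        also have "\<dots> = ennreal (unit_ball_vol 3 * e n ^ 3)" using e[of n] by (simp add: emeasure_cball)
        finally have "q n z = ennreal ((1 / (unit_ball_vol 3 * e n ^ 3)) * (unit_ball_vol 3 * e n ^ 3))"
          unfolding q_def using e[of n] V by (simp only:) (intro ennreal_mult[symmetric]; simp)
        also have "(1 / (unit_ball_vol 3 * e n ^ 3)) * (unit_ball_vol 3 * e n ^ 3) = 1"
          using e(1)[of n] V by (simp del: unit_ball_vol_pos)
        finally show ?case by simp
      qed
      then have "1 \<le> liminf (\<lambda>n. q n z)" by (rule Liminf_bounded)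
      then show ?thesis using True by simp
    qed simp
  qed
  also have "\<dots> \<le> liminf (\<lambda>n. \<integral>\<^sup>+z. q n z \<partial>N)"
    by (rule nn_integral_liminf) measurable
  also have "\<dots> \<le> (\<integral>\<^sup>+z. ennreal (Kc / norm z) * indicator U z \<partial>lborel)"
  proof (rule Liminf_le)
    show "\<forall>\<^sub>F n in sequentially. (\<integral>\<^sup>+z. q n z \<partial>N) \<le> (\<integral>\<^sup>+z. ennreal (Kc / norm z) * indicator U z \<partial>lborel)"
    proof (rule always_eventually, rule allI)
      fix n
      let ?k = "1 / (unit_ball_vol 3 * e n ^ 3)"
      have k: "?k \<ge> 0" using e[of n] by simp
      have "(\<integral>\<^sup>+z. q n z \<partial>N) = ennreal ?k * (\<integral>\<^sup>+z. \<integral>\<^sup>+y. indicator U y * indicator {y. norm (y - z) \<le> e n} y \<partial>lborel \<partial>N)"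
        unfolding q_def by (rule nn_integral_cmult) (simp add: indicator_def, measurable)
      also have "(\<integral>\<^sup>+z. \<integral>\<^sup>+y. indicator U y * indicator {y. norm (y - z) \<le> e n} y \<partial>lborel \<partial>N)
         = (\<integral>\<^sup>+y. \<integral>\<^sup>+z. indicator U y * indicator {y. norm (y - z) \<le> e n} y \<partial>N \<partial>lborel)"
        by (rule Fubini') (simp add: indicator_def, measurable)
      also have "\<dots> = (\<integral>\<^sup>+y. indicator U y * emeasure N (cball y (e n)) \<partial>lborel)"
      proof (rule nn_integral_cong)
        fix y :: vel
        have "(\<integral>\<^sup>+z. indicator U y * indicator {y. norm (y - z) \<le> e n} y \<partial>N) = (\<integral>\<^sup>+z. indicator U y * indicator (cball y (e n)) z \<partial>N)"
          by (intro nn_integral_cong) (simp add: indicator_def dist_norm)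
        then show "(\<integral>\<^sup>+z. indicator U y * indicator {y. norm (y - z) \<le> e n} y \<partial>N) = indicator U y * emeasure N (cball y (e n))"
          by (simp add: nn_integral_cmult_indicator)
      qed
      also have "ennreal ?k * \<dots> \<le> ennreal ?k * (\<integral>\<^sup>+y. indicator U y * ennreal (Kb * e n ^ 3 / norm y) \<partial>lborel)"
      proof (rule mult_left_mono, rule nn_integral_mono)
        fix y :: vel
        show "indicator U y * emeasure N (cball y (e n)) \<le> indicator U y * ennreal (Kb * e n ^ 3 / norm y)"
        proof (cases "y \<in> U")
          case True
          then have "e n \<le> norm y / 2" using \<eta>(2)[of y] e(2)[of n] by simp
          then show ?thesis using N_cball[OF e(1)[of n]] by (intro mult_left_mono) auto
        qed simp
      qed simp
      also have "\<dots> = (\<integral>\<^sup>+y. ennreal ?k * (indicator U y * ennreal (Kb * e n ^ 3 / norm y)) \<partial>lborel)"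
        by (rule nn_integral_cmult[symmetric]) measurable
      also have "\<dots> = (\<integral>\<^sup>+z. ennreal (Kc / norm z) * indicator U z \<partial>lborel)"
      proof (rule nn_integral_cong)
        fix y :: vel
        have "ennreal ?k * ennreal (Kb * e n ^ 3 / norm y) = ennreal (?k * (Kb * e n ^ 3 / norm y))"
          using k Kb_nonneg e(1)[of n] by (intro ennreal_mult[symmetric]) auto
        also have "?k * (Kb * e n ^ 3 / norm y) = Kc / norm y"
          unfolding Kc_def using e(1)[of n] by simp
        finally show "ennreal ?k * (indicator U y * ennreal (Kb * e n ^ 3 / norm y)) = ennreal (Kc / norm y) * indicator U y"
          by (simp add: indicator_def)
      qed
      finally show "(\<integral>\<^sup>+z. q n z \<partial>N) \<le> (\<integral>\<^sup>+z. ennreal (Kc / norm z) * indicator U z \<partial>lborel)" .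
    qed
  qed simp
  finally show ?thesis .
qed

lemma N_zero: "emeasure N {0} = 0"
proof -
  have "emeasure N {0} \<le> 0 + ennreal x" if "x > 0" for x
  proof -
    define \<delta> where "\<delta> = x / (Ka + 1)"
    have "Ka * \<delta> \<le> x" using that Ka_nonneg by (simp add: \<delta>_def field_simps)
    have "\<delta> > 0" using that Ka_nonneg by (simp add: \<delta>_def)
    have "emeasure N {0} \<le> emeasure N {z. 0 \<le> (norm z)\<^sup>2 \<and> (norm z)\<^sup>2 \<le> \<delta>}"
      using \<open>\<delta> > 0\<close> by (intro emeasure_mono) auto
    also have "\<dots> \<le> ennreal (Ka * (\<delta> - 0))" using \<open>\<delta> > 0\<close> by (intro N_annulus) simp
    also have "\<dots> \<le> ennreal x" using \<open>Ka * \<delta> \<le> x\<close> by (intro ennreal_leI) simp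
    finally show ?thesis by simp
  qed
  then have "emeasure N {0} \<le> 0" by (rule ennreal_le_epsilon)
  then show ?thesis by simp
qed

text \<open>The added 1 makes every scattered velocity lie strictly inside the ball.\<close>

definition R' where "R' = \<bar>c1\<bar> * R + \<bar>c2\<bar> * P + 1"

lemma R'_pos: "R' > 0" unfolding R'_def using R P_nonneg by (simp add: add_nonneg_pos)

lemma N_support: "emeasure N {z. norm z \<ge> R'} = 0"
proof -
  have "emeasure N {z. norm z \<ge> R'} = (\<integral>\<^sup>+g. indicator (cball 0 R) g * ennreal (rho d g) * nsph (\<lambda>\<omega>. indicator {z. norm z \<ge> R'} (post g \<omega>)) \<partial>lborel)"
    by (rule N_emeasure) measurable
  also have "\<dots> = (\<integral>\<^sup>+(g::vel). 0 \<partial>lborel)"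
  proof (rule nn_integral_cong)
    fix g :: vel
    show "indicator (cball 0 R) g * ennreal (rho d g) * nsph (\<lambda>\<omega>. indicator {z. norm z \<ge> R'} (post g \<omega>)) = 0"
    proof (cases "norm g \<le> R")
      case True
      have "nsph (\<lambda>\<omega>. indicator {z. norm z \<ge> R'} (post g \<omega>)) = nsph (\<lambda>\<omega>. 0)"
      proof (rule nsph_cong)
        fix \<omega> :: vel assume w: "norm \<omega> = 1"
        have "norm (post g \<omega>) \<le> \<bar>c1\<bar> * norm g + \<bar>c2\<bar> * rho d g"
          unfolding post_def by (rule norm_triangle_le) (simp add: w abs_mult)
        also have "\<dots> \<le> \<bar>c1\<bar> * R + \<bar>c2\<bar> * P" using True rho_P by (intro add_mono mult_left_mono) auto
        finally show "indicator {z. norm z \<ge> R'} (post g \<omega>) = (0::ennreal)" by (simp add: R'_def indicator_def)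
      qed
      then show ?thesis by (simp add: nsph_def)
    qed simp
  qed
  finally show ?thesis by simp
qed

text \<open>Outer regularity carries the bound from open sets to Borel sets, and it is applied to
  the comparison measure, which must be finite. The sets \<open>W n\<close> therefore first exclude
  a neighbourhood of the origin and everything beyond \<open>R'\<close>. Their union misses only
  sets that are null for \<open>N\<close>.\<close>

lemma N_le:
  assumes A [measurable]: "A \<in> sets borel"
  shows "emeasure N A \<le> (\<integral>\<^sup>+z. ennreal (Kc / norm z) * indicator (ball 0 R') z * indicator A z \<partial>lborel)" (is "_ \<le> ?r")
proof -
  define W where "W n = {z::vel. 1 / real (Suc n) < norm z \<and> norm z < R'}" for n
  have oW: "open (W n)" for n
    unfolding W_def by (intro open_Collect_conj open_Collect_less continuous_intros)
  then have [measurable]: "W n \<in> sets borel" for n by simp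
  have n_le: "emeasure N (A \<inter> W n) \<le> ?r" for n
  proof -
    define Q where "Q = density lborel (\<lambda>z. ennreal (Kc / norm z) * indicator (W n) z)"
    have Q: "emeasure Q B = (\<integral>\<^sup>+z. ennreal (Kc / norm z) * indicator (W n) z * indicator B z \<partial>lborel)" if "B \<in> sets borel" for B
      unfolding Q_def using that by (subst emeasure_density) auto
    have "emeasure Q (space Q) \<le> (\<integral>\<^sup>+z. ennreal (Kc * real (Suc n)) * indicator (ball (0::vel) R') z \<partial>lborel)"
    proof -
      have "emeasure Q (space Q) = emeasure Q UNIV" by (simp add: Q_def)
      also have "\<dots> \<le> (\<integral>\<^sup>+z. ennreal (Kc * real (Suc n)) * indicator (ball (0::vel) R') z \<partial>lborel)"
      proof (subst Q, simp, rule nn_integral_mono)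
        fix z :: vel
        have "Kc / norm z \<le> Kc * real (Suc n)" if "z \<in> W n"
        proof -
          have "0 < 1 / real (Suc n)" by simp
          then have "norm z > 0" using that unfolding W_def mem_Collect_eq by linarith
          then have "1 / norm z \<le> real (Suc n)" using that by (auto simp: W_def field_simps)
          then have "Kc * (1 / norm z) \<le> Kc * real (Suc n)" using Kc_nonneg by (rule mult_left_mono)
          then show ?thesis by simp
        qed
        then show "ennreal (Kc / norm z) * indicator (W n) z * indicator UNIV z \<le> ennreal (Kc * real (Suc n)) * indicator (ball 0 R') z"
          by (auto simp: indicator_def W_def intro!: ennreal_leI)
      qed
      finally show ?thesis .
    qed
    also have "\<dots> < \<infinity>" using R'_pos by (simp add: nn_integral_cmult_indicator emeasure_ball ennreal_mult_less_top)
    finally have Qfin: "emeasure Q (space Q) \<noteq> \<infinity>" by simp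
    have "emeasure N (A \<inter> W n) \<le> (INF U\<in>{U. A \<subseteq> U \<and> open U}. emeasure Q U)"
    proof (rule INF_greatest)
      fix U assume U: "U \<in> {U. A \<subseteq> U \<and> open U}"
      then have oU: "open U" and [measurable]: "U \<in> sets borel" by auto
      have "emeasure N (A \<inter> W n) \<le> emeasure N (U \<inter> W n)" using U by (intro emeasure_mono) auto
      also have "\<dots> \<le> (\<integral>\<^sup>+z. ennreal (Kc / norm z) * indicator (U \<inter> W n) z \<partial>lborel)"
        using oU oW by (intro N_open[of _ "1 / real (Suc n)"]) (auto simp: W_def)
      also have "\<dots> = emeasure Q U"
        by (subst Q) (auto intro!: nn_integral_cong simp: indicator_def)
      finally show "emeasure N (A \<inter> W n) \<le> emeasure Q U" .
    qed
    also have "\<dots> = emeasure Q A"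
      using Qfin A by (intro outer_regular[symmetric]) (auto simp: Q_def)
    also have "\<dots> \<le> ?r" unfolding Q[OF A]
      by (intro nn_integral_mono) (auto simp: indicator_def W_def)
    finally show ?thesis .
  qed
  have "A \<subseteq> ({0} \<union> {z. norm z \<ge> R'}) \<union> (\<Union>n. A \<inter> W n)"
  proof
    fix z assume z: "z \<in> A"
    show "z \<in> ({0} \<union> {z. norm z \<ge> R'}) \<union> (\<Union>n. A \<inter> W n)"
    proof (cases "z = 0 \<or> norm z \<ge> R'")
      case False
      then obtain n where "inverse (real (Suc n)) < norm z" using reals_Archimedean[of "norm z"] by auto
      then show ?thesis using z False by (auto simp: W_def inverse_eq_divide)
    qed auto
  qed
  then have "emeasure N A \<le> emeasure N (({0} \<union> {z. norm z \<ge> R'}) \<union> (\<Union>n. A \<inter> W n))"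
    by (rule emeasure_mono) simp
  also have "\<dots> \<le> (emeasure N {0} + emeasure N {z. norm z \<ge> R'}) + emeasure N (\<Union>n. A \<inter> W n)"
    by (intro order_trans[OF emeasure_subadditive] add_mono emeasure_subadditive) auto
  also have "\<dots> = emeasure N (\<Union>n. A \<inter> W n)" by (simp add: N_zero N_support)
  also have "\<dots> = (SUP n. emeasure N (A \<inter> W n))"
  proof (rule SUP_emeasure_incseq[symmetric])
    show "incseq (\<lambda>n. A \<inter> W n)"
    proof (intro incseq_SucI)
      fix n
      have "1 / real (Suc (Suc n)) \<le> 1 / real (Suc n)" by (simp add: frac_le)
      then show "A \<inter> W n \<subseteq> A \<inter> W (Suc n)" unfolding W_def by auto
    qed
  qed auto
  also have "\<dots> \<le> ?r" by (rule SUP_least) (rule n_le)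
  finally show ?thesis .
qed

lemma N_L2:
  assumes f [measurable]: "f \<in> borel_measurable borel"
  shows "(\<integral>\<^sup>+z. f z \<partial>N)\<^sup>2 \<le> ennreal (Kc\<^sup>2 * (8 * unit_ball_vol 3 * R')) * (\<integral>\<^sup>+z. (f z)\<^sup>2 \<partial>lborel)"
proof -
  define \<kappa> where "\<kappa> z = ennreal (Kc / norm z) * indicator (ball 0 R') z" for z :: vel
  have [measurable]: "\<kappa> \<in> borel_measurable borel" unfolding \<kappa>_def by measurable
  have "N \<le> density lborel \<kappa>"
    by (subst le_measure) (auto simp: emeasure_density N_le \<kappa>_def)
  then have "(\<integral>\<^sup>+z. f z \<partial>N) \<le> (\<integral>\<^sup>+z. f z \<partial>density lborel \<kappa>)"
    by (intro nn_integral_mono_measure) auto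
  also have "\<dots> = (\<integral>\<^sup>+z. \<kappa> z * f z \<partial>lborel)" by (simp add: nn_integral_density)
  finally have "(\<integral>\<^sup>+z. f z \<partial>N)\<^sup>2 \<le> (\<integral>\<^sup>+z. \<kappa> z * f z \<partial>lborel)\<^sup>2" by (rule power_mono_ennreal)
  also have "\<dots> \<le> (\<integral>\<^sup>+z. (\<kappa> z)\<^sup>2 \<partial>lborel) * (\<integral>\<^sup>+z. (f z)\<^sup>2 \<partial>lborel)"
    by (rule Cauchy_Schwarz_nn_integral) measurable
  also have "(\<integral>\<^sup>+z. (\<kappa> z)\<^sup>2 \<partial>lborel) = (\<integral>\<^sup>+z. ennreal (Kc\<^sup>2) * (indicator (ball 0 R') z * ennreal (1 / (norm (z::vel))\<^sup>2)) \<partial>lborel)"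
  proof (rule nn_integral_cong)
    fix z :: vel
    have "(ennreal (Kc / norm z))\<^sup>2 = ennreal (Kc\<^sup>2) * ennreal (1 / (norm z)\<^sup>2)"
      using Kc_nonneg by (subst ennreal_mult[symmetric]) (auto simp: ennreal_power power_divide)
    then show "(\<kappa> z)\<^sup>2 = ennreal (Kc\<^sup>2) * (indicator (ball 0 R') z * ennreal (1 / (norm z)\<^sup>2))"
      by (simp add: \<kappa>_def indicator_def)
  qed
  also have "\<dots> = ennreal (Kc\<^sup>2) * (\<integral>\<^sup>+z. indicator (ball 0 R') z * ennreal (1 / (norm (z::vel))\<^sup>2) \<partial>lborel)"
    by (rule nn_integral_cmult) measurable
  also have "\<dots> \<le> ennreal (Kc\<^sup>2) * ennreal (8 * unit_ball_vol 3 * R')"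
    by (intro mult_left_mono nn_integral_inverse_square R'_pos) simp
  also have "\<dots> = ennreal (Kc\<^sup>2 * (8 * unit_ball_vol 3 * R'))"
    using R'_pos by (intro ennreal_mult[symmetric]) auto
  finally show ?thesis by (simp add: mult_right_mono)
qed

end

lemma scatter_L2_bound:
  fixes c1 c2 d R :: real
  assumes "c1 \<noteq> 0" "c2 \<noteq> 0" "R > 0"
  shows "\<exists>K\<ge>0. \<forall>f \<in> borel_measurable borel.
    (\<integral>\<^sup>+g. indicator (cball 0 R) g * ennreal (rho d g) * nsph (\<lambda>\<omega>. f (c1 *\<^sub>R g + (c2 * rho d g) *\<^sub>R \<omega>)) \<partial>lborel)\<^sup>2
      \<le> ennreal K * (\<integral>\<^sup>+z. (f z)\<^sup>2 \<partial>lborel)"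
proof -
  interpret scatter c1 c2 d R by unfold_locales fact+
  show ?thesis
    using N_L2 R'_pos by (intro exI[of _ "Kc\<^sup>2 * (8 * unit_ball_vol 3 * R')"]) (simp add: N_nn post_def)
qed

section \<open>Gain and loss kernels\<close>

lemma nn_integral_vel_affine:
  fixes F :: "vel \<Rightarrow> ennreal"
  assumes [measurable]: "F \<in> borel_measurable borel" and c: "c \<noteq> 0"
  shows "(\<integral>\<^sup>+x. F (t + c *\<^sub>R x) \<partial>lborel) = ennreal (1 / \<bar>c\<bar> ^ 3) * (\<integral>\<^sup>+x. F x \<partial>lborel)"
proof -
  have "(\<integral>\<^sup>+x. F x \<partial>lborel) = (\<integral>\<^sup>+x. F x \<partial>density (distr lborel borel (\<lambda>x. t + c *\<^sub>R x)) (\<lambda>_. ennreal (\<bar>c\<bar>^DIM(vel))))"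
    using lborel_affine[OF c, of t] by simp
  also have "\<dots> = (\<integral>\<^sup>+x. ennreal (\<bar>c\<bar>^3) * F (t + c *\<^sub>R x) \<partial>lborel)"
    by (simp add: nn_integral_density nn_integral_distr)
  also have "\<dots> = ennreal (\<bar>c\<bar>^3) * (\<integral>\<^sup>+x. F (t + c *\<^sub>R x) \<partial>lborel)"
    by (rule nn_integral_cmult) measurable
  finally have "ennreal (1 / \<bar>c\<bar>^3) * (\<integral>\<^sup>+x. F x \<partial>lborel) = (ennreal (1 / \<bar>c\<bar>^3) * ennreal (\<bar>c\<bar>^3)) * (\<integral>\<^sup>+x. F (t + c *\<^sub>R x) \<partial>lborel)"
    by (simp add: mult.assoc)
  also have "ennreal (1 / \<bar>c\<bar>^3) * ennreal (\<bar>c\<bar>^3) = 1"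
    using c by (subst ennreal_mult[symmetric]) auto
  finally show ?thesis by simp
qed

lemma nn_integral_vel_reflect:
  fixes F :: "vel \<Rightarrow> ennreal"
  assumes "F \<in> borel_measurable borel"
  shows "(\<integral>\<^sup>+x. F (t - x) \<partial>lborel) = (\<integral>\<^sup>+x. F x \<partial>lborel)"
  using nn_integral_vel_affine[OF assms, of "-1" t] by simp

lemma nn_integral_vel_shift:
  fixes F :: "vel \<Rightarrow> ennreal"
  assumes "F \<in> borel_measurable borel"
  shows "(\<integral>\<^sup>+x. F (t + x) \<partial>lborel) = (\<integral>\<^sup>+x. F x \<partial>lborel)"
  using nn_integral_vel_affine[OF assms, of 1 t] by simp

lemma nn_integral_vel_pair:
  fixes F :: "vel \<times> vel \<Rightarrow> ennreal"
  assumes [measurable]: "F \<in> borel_measurable (borel \<Otimes>\<^sub>M borel)"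
  shows "(\<integral>\<^sup>+y. F y \<partial>lborel) = (\<integral>\<^sup>+u. \<integral>\<^sup>+x. F (u, x) \<partial>lborel \<partial>lborel)"
  unfolding lborel_prod[symmetric] by (rule lborel.nn_integral_fst[symmetric]) simp

lemma nsph_gauss':
  assumes c: "c > 0"
  shows "\<exists>K>0. \<forall>A s. s \<noteq> 0 \<longrightarrow> nsph (\<lambda>\<omega>. ennreal (exp (- c * (norm (A + s *\<^sub>R \<omega>))\<^sup>2))) \<le> ennreal (K / s\<^sup>2)"
proof -
  obtain K where K: "K > 0" "\<And>p \<rho>. \<rho> > 0 \<Longrightarrow> nsph (\<lambda>\<omega>. ennreal (exp (- c * (norm (p - \<rho> *\<^sub>R \<omega>))\<^sup>2))) \<le> ennreal (K / \<rho>\<^sup>2)"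
    using nsph_gauss[OF c] by blast
  have "nsph (\<lambda>\<omega>. ennreal (exp (- c * (norm (A + s *\<^sub>R \<omega>))\<^sup>2))) \<le> ennreal (K / s\<^sup>2)" if "s \<noteq> 0" for A s
  proof (cases "s > 0")
    case True
    have "norm (A + s *\<^sub>R \<omega>) = norm (- A - s *\<^sub>R \<omega>)" for \<omega> using norm_minus_cancel[of "A + s *\<^sub>R \<omega>"] by simp
    then show ?thesis using K(2)[OF True, of "-A"] by simp
  next
    case False
    then show ?thesis using K(2)[of "-s" A] that by simp
  qed
  with K(1) show ?thesis by blast
qed

lemma nsph_gauss_le:
  assumes "c > 0"
  shows "nsph (\<lambda>\<omega>. ennreal (exp (- c * (norm (A \<omega>))\<^sup>2))) \<le> ennreal (unit_ball_vol 3)"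
proof -
  have "nsph (\<lambda>\<omega>. ennreal (exp (- c * (norm (A \<omega>))\<^sup>2))) \<le> nsph (\<lambda>_. 1)"
    using assms by (intro nsph_mono) simp
  then show ?thesis using nsph_one_le by (rule order_trans)
qed

text \<open>Two regimes: for r <= 1 the Gaussian is bounded by 1, for r > 1 the average is of order
  1/r^2. After multiplication by r both fit below a multiple of 1/(1 + r).\<close>

lemma rho_nsph_gauss:
  assumes c: "c > 0" and s: "s \<noteq> 0"
  shows "\<exists>K>0. \<forall>A r. r \<ge> 0 \<longrightarrow> ennreal r * nsph (\<lambda>\<omega>. ennreal (exp (- c * (norm (A + (s * r) *\<^sub>R \<omega>))\<^sup>2))) \<le> ennreal (K / (1 + r))"
proof -
  obtain K where K: "K > 0" "\<And>A s. s \<noteq> 0 \<Longrightarrow> nsph (\<lambda>\<omega>. ennreal (exp (- c * (norm (A + s *\<^sub>R \<omega>))\<^sup>2))) \<le> ennreal (K / s\<^sup>2)"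
    using nsph_gauss'[OF c] by blast
  define K' where "K' = 2 * unit_ball_vol 3 + 2 * (K / s\<^sup>2)"
  have V: "unit_ball_vol (3::real) \<ge> 0" by simp
  have Ks: "K / s\<^sup>2 > 0" using K(1) s by simp
  have K'0: "K' > 0" unfolding K'_def using V Ks by linarith
  have "ennreal r * nsph (\<lambda>\<omega>. ennreal (exp (- c * (norm (A + (s * r) *\<^sub>R \<omega>))\<^sup>2))) \<le> ennreal (K' / (1 + r))" if r: "r \<ge> 0" for A r
  proof (cases "r \<le> 1")
    case True
    have "ennreal r * nsph (\<lambda>\<omega>. ennreal (exp (- c * (norm (A + (s * r) *\<^sub>R \<omega>))\<^sup>2))) \<le> ennreal r * ennreal (unit_ball_vol 3)"
      by (intro mult_left_mono nsph_gauss_le c) simp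
    also have "\<dots> = ennreal (r * unit_ball_vol 3)" using r by (simp add: ennreal_mult)
    also have "\<dots> \<le> ennreal (K' / (1 + r))"
    proof (rule ennreal_leI)
      have "r * (1 + r) \<le> 1 * 2" using True r by (intro mult_mono) auto
      then have "unit_ball_vol 3 * (r * (1 + r)) \<le> unit_ball_vol 3 * 2" using V by (intro mult_left_mono) auto
      also have "\<dots> \<le> K'" unfolding K'_def using Ks by linarith
      finally show "r * unit_ball_vol 3 \<le> K' / (1 + r)" using r by (simp add: pos_le_divide_eq mult_ac)
    qed
    finally show ?thesis .
  next
    case False
    then have "s * r \<noteq> 0" using s by simp
    have "ennreal r * nsph (\<lambda>\<omega>. ennreal (exp (- c * (norm (A + (s * r) *\<^sub>R \<omega>))\<^sup>2))) \<le> ennreal r * ennreal (K / (s * r)\<^sup>2)"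
      by (intro mult_left_mono K(2) \<open>s * r \<noteq> 0\<close>) simp
    also have "\<dots> = ennreal (r * (K / (s * r)\<^sup>2))" using r K(1) by (intro ennreal_mult[symmetric]) auto
    also have "r * (K / (s * r)\<^sup>2) = (K / s\<^sup>2) / r" using False s by (simp add: power2_eq_square)
    also have "ennreal ((K / s\<^sup>2) / r) \<le> ennreal (K' / (1 + r))"
    proof (rule ennreal_leI)
      have "(K / s\<^sup>2) * (1 + r) \<le> (K / s\<^sup>2) * (2 * r)" using False Ks by (intro mult_left_mono) auto
      also have "\<dots> \<le> K' * r" unfolding K'_def using V r by (simp add: algebra_simps)
      finally have "(K / s\<^sup>2) * (1 + r) \<le> K' * r" .
      moreover have "k / r \<le> K' / (1 + r)" if "k * (1 + r) \<le> K' * r" for k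
        using that False by (simp add: field_simps)
      ultimately show "(K / s\<^sup>2) / r \<le> K' / (1 + r)" by blast
    qed
    finally show ?thesis .
  qed
  with K'0 show ?thesis by blast
qed

text \<open>Converts decay in the relative speed into decay in \<open>\<xi>\<close>, at the price of
  growth in \<open>\<xi>s\<close> that the Maxwellian of \<open>\<xi>s\<close> absorbs.\<close>

lemma one_plus_norm_le_rho:
  "1 + norm \<xi> \<le> (1 + sqrt (2 * \<bar>d\<bar>)) * (1 + norm \<xi>s) * (1 + rho d (\<xi> - \<xi>s))"
proof -
  define s0 where "s0 = sqrt (2 * \<bar>d\<bar>)"
  define r where "r = rho d (\<xi> - \<xi>s)"
  have s0: "s0 \<ge> 0" and r: "r \<ge> 0" by (auto simp: s0_def r_def)
  have "norm \<xi> \<le> norm \<xi>s + norm (\<xi> - \<xi>s)" using norm_triangle_ineq[of \<xi>s "\<xi> - \<xi>s"] by simp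
  also have "norm (\<xi> - \<xi>s) \<le> r + s0" unfolding r_def s0_def by (rule norm_le_rho)
  finally have "1 + norm \<xi> \<le> 1 + s0 + norm \<xi>s + r" by simp
  also have "\<dots> \<le> (1 + s0) * (1 + norm \<xi>s) * (1 + r)"
    using s0 r by (simp add: algebra_simps)
  finally show ?thesis by (simp add: s0_def r_def)
qed

lemma rho_le_prod: "rho d (\<xi> - \<xi>s) \<le> (1 + sqrt (2 * \<bar>d\<bar>)) * (1 + norm \<xi>) * (1 + norm \<xi>s)"
proof -
  define s0 where "s0 = sqrt (2 * \<bar>d\<bar>)"
  have s0: "s0 \<ge> 0" by (auto simp: s0_def)
  have "rho d (\<xi> - \<xi>s) \<le> norm (\<xi> - \<xi>s) + s0" unfolding s0_def by (rule rho_le)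
  also have "norm (\<xi> - \<xi>s) \<le> norm \<xi> + norm \<xi>s" by (rule norm_triangle_ineq4)
  finally have "rho d (\<xi> - \<xi>s) \<le> norm \<xi> + norm \<xi>s + s0" by simp
  also have "\<dots> \<le> (1 + s0) * (1 + norm \<xi>) * (1 + norm \<xi>s)"
    using s0 by (simp add: algebra_simps)
  finally show ?thesis by (simp add: s0_def)
qed

text \<open>The parameters $(\tau,\sigma) = (q,1)$ and $(-p,-1)$ describe the gain terms in $h(\xi')$ and
  $h(\xi_*')$. In both cases $Z - \sigma\rho\,\omega$ is the other post-collisional velocity, which
  enters through the Maxwellian weight.\<close>

locale gain =
  fixes p q \<tau> \<sigma> d c Cb :: real and b :: "vel \<Rightarrow> vel \<times> vel \<Rightarrow> real"
  assumes pq: "p > 0" "q > 0" "p + q = 1" and \<tau>: "\<tau> \<noteq> 0" "\<tau> \<noteq> \<sigma>" and \<sigma>: "\<sigma> * \<sigma> = 1"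
    and c: "c > 0" and Cb: "Cb \<ge> 0"
    and b_meas [measurable]: "(\<lambda>(x, y). b x y) \<in> borel_measurable (borel \<Otimes>\<^sub>M borel)"
    and b_nonneg: "b \<xi> y \<ge> 0"
    and b_le: "b \<xi> (\<xi>s, x) \<le> Cb * rho d (\<xi> - \<xi>s) * exp (- c * (norm \<xi>s)\<^sup>2)
       * exp (- c * (norm (\<xi> - q *\<^sub>R (\<xi> - \<xi>s) + ((\<tau> - \<sigma>) * rho d (\<xi> - \<xi>s)) *\<^sub>R (x /\<^sub>R norm x)))\<^sup>2) * indicator (ball 0 1 - {0}) x"
begin

definition Z :: "vel \<Rightarrow> vel \<times> vel \<Rightarrow> vel" where
  "Z \<xi> y = \<xi> - q *\<^sub>R (\<xi> - fst y) + (\<tau> * rho d (\<xi> - fst y)) *\<^sub>R (snd y /\<^sub>R norm (snd y))"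

lemma Z_meas [measurable]: "(\<lambda>(x, y). Z x y) \<in> borel_measurable (borel \<Otimes>\<^sub>M borel)"
  unfolding Z_def by (subst borel_prod[symmetric]) measurable

lemma b_meas3 [measurable]: "(\<lambda>(x, y). b x y) \<in> borel_measurable (borel \<Otimes>\<^sub>M (borel \<Otimes>\<^sub>M borel))"
  using b_meas by (simp add: borel_prod)

lemma Z_meas3 [measurable]: "(\<lambda>(x, y). Z x y) \<in> borel_measurable (borel \<Otimes>\<^sub>M (borel \<Otimes>\<^sub>M borel))"
  using Z_meas by (simp add: borel_prod)

lemma b_le_ennreal:
  "ennreal (b \<xi> (\<xi>s, x)) \<le> ennreal (Cb * exp (- c * (norm \<xi>s)\<^sup>2)) * (ennreal (rho d (\<xi> - \<xi>s)) *
     (indicator (ball 0 1 - {0}) x * ennreal (exp (- c * (norm (\<xi> - q *\<^sub>R (\<xi> - \<xi>s) + ((\<tau> - \<sigma>) * rho d (\<xi> - \<xi>s)) *\<^sub>R (x /\<^sub>R norm x)))\<^sup>2))))"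
proof -
  let ?e = "exp (- c * (norm (\<xi> - q *\<^sub>R (\<xi> - \<xi>s) + ((\<tau> - \<sigma>) * rho d (\<xi> - \<xi>s)) *\<^sub>R (x /\<^sub>R norm x)))\<^sup>2)"
  have "ennreal (b \<xi> (\<xi>s, x)) \<le> ennreal ((Cb * exp (- c * (norm \<xi>s)\<^sup>2)) * (rho d (\<xi> - \<xi>s) * (indicator (ball 0 1 - {0}) x * ?e)))"
    using b_le[of \<xi> \<xi>s x] by (intro ennreal_leI) (simp only: mult_ac)
  also have "\<dots> = ennreal (Cb * exp (- c * (norm \<xi>s)\<^sup>2)) * ennreal (rho d (\<xi> - \<xi>s) * (indicator (ball 0 1 - {0}) x * ?e))"
    using Cb by (intro ennreal_mult) auto
  also have "ennreal (rho d (\<xi> - \<xi>s) * (indicator (ball 0 1 - {0}) x * ?e)) = ennreal (rho d (\<xi> - \<xi>s)) * ennreal (indicator (ball 0 1 - {0}) x * ?e)"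
    by (intro ennreal_mult) auto
  also have "ennreal (indicator (ball 0 1 - {0}) x * ?e) = indicator (ball 0 1 - {0}) x * ennreal ?e"
    by (simp add: indicator_def)
  finally show ?thesis .
qed

text \<open>The Gaussian depends on the direction through a sphere of radius |\<tau> - \<sigma>|
  rho, so its average gains 1/(1 + rho) as \<tau> and \<sigma> differ; this is then exchanged for
  decay in \<open>\<xi>\<close>.\<close>

lemma row_density:
  "\<exists>K>0. \<forall>\<xi> \<xi>s. (\<integral>\<^sup>+x. ennreal (b \<xi> (\<xi>s, x)) \<partial>lborel)
     \<le> ennreal (K * (exp (- c * (norm \<xi>s)\<^sup>2) * ((1 + norm \<xi>s) / (1 + norm \<xi>))))"
proof -
  have "\<tau> - \<sigma> \<noteq> 0" using \<tau> by simp
  then obtain K where K: "K > 0" "\<And>A r. r \<ge> 0 \<Longrightarrow>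
     ennreal r * nsph (\<lambda>\<omega>. ennreal (exp (- c * (norm (A + ((\<tau> - \<sigma>) * r) *\<^sub>R \<omega>))\<^sup>2))) \<le> ennreal (K / (1 + r))"
    using rho_nsph_gauss[OF c] by blast
  define S where "S = 1 + sqrt (2 * \<bar>d\<bar>)"
  have S: "S \<ge> 1" by (simp add: S_def)
  have "(\<integral>\<^sup>+x. ennreal (b \<xi> (\<xi>s, x)) \<partial>lborel)
     \<le> ennreal (((Cb + 1) * K * S) * (exp (- c * (norm \<xi>s)\<^sup>2) * ((1 + norm \<xi>s) / (1 + norm \<xi>))))" for \<xi> \<xi>s
  proof -
    define r where "r = rho d (\<xi> - \<xi>s)"
    have r: "r \<ge> 0" by (simp add: r_def)
    define A where "A = \<xi> - q *\<^sub>R (\<xi> - \<xi>s)"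
    have "(\<integral>\<^sup>+x. ennreal (b \<xi> (\<xi>s, x)) \<partial>lborel) \<le> (\<integral>\<^sup>+x. ennreal (Cb * exp (- c * (norm \<xi>s)\<^sup>2)) * (ennreal r *
     (indicator (ball 0 1 - {0}) x * ennreal (exp (- c * (norm (A + ((\<tau> - \<sigma>) * r) *\<^sub>R (x /\<^sub>R norm x)))\<^sup>2)))) \<partial>lborel)"
      unfolding r_def A_def by (intro nn_integral_mono b_le_ennreal)
    also have "\<dots> = ennreal (Cb * exp (- c * (norm \<xi>s)\<^sup>2)) * (ennreal r *
        nsph (\<lambda>\<omega>. ennreal (exp (- c * (norm (A + ((\<tau> - \<sigma>) * r) *\<^sub>R \<omega>))\<^sup>2))))"
      unfolding nsph_def
      by (simp add: nn_integral_cmult)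
    also have "\<dots> \<le> ennreal (Cb * exp (- c * (norm \<xi>s)\<^sup>2)) * ennreal (K / (1 + r))"
      by (intro mult_left_mono K r) simp
    also have "\<dots> = ennreal ((Cb * exp (- c * (norm \<xi>s)\<^sup>2)) * (K / (1 + r)))"
      using Cb K(1) r by (intro ennreal_mult[symmetric]) auto
    also have "\<dots> \<le> ennreal (((Cb + 1) * K * S) * (exp (- c * (norm \<xi>s)\<^sup>2) * ((1 + norm \<xi>s) / (1 + norm \<xi>))))"
    proof (rule ennreal_leI)
      have "0 \<le> norm \<xi>" by simp
      have "1 / (1 + r) \<le> S * ((1 + norm \<xi>s) / (1 + norm \<xi>))"
      proof -
        have "1 + norm \<xi> \<le> S * (1 + norm \<xi>s) * (1 + r)" unfolding S_def r_def by (rule one_plus_norm_le_rho)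
        moreover have "1 + norm \<xi> > 0" "1 + r > 0" using r \<open>0 \<le> norm \<xi>\<close> by linarith+
        ultimately show ?thesis by (simp add: divide_simps mult_ac)
      qed
      moreover define F where "F = (1 + norm \<xi>s) / (1 + norm \<xi>)"
      ultimately have "(Cb * exp (- c * (norm \<xi>s)\<^sup>2) * K) * (1 / (1 + r)) \<le> ((Cb + 1) * exp (- c * (norm \<xi>s)\<^sup>2) * K) * (S * F)"
        using Cb K(1) r by (intro mult_mono mult_right_mono) auto
      then show "(Cb * exp (- c * (norm \<xi>s)\<^sup>2)) * (K / (1 + r)) \<le> ((Cb + 1) * K * S) * (exp (- c * (norm \<xi>s)\<^sup>2) * ((1 + norm \<xi>s) / (1 + norm \<xi>)))"
        unfolding F_def[symmetric] by (simp add: mult_ac)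
    qed
    finally show ?thesis .
  qed
  \<comment> \<open>\<open>Cb\<close> may be 0; the shift by 1 keeps the constant strictly
    positive.\<close>
  moreover have "(Cb + 1) * K * S > 0" using Cb K(1) S by (intro mult_pos_pos) auto
  ultimately show ?thesis by blast
qed

definition E :: "real \<Rightarrow> (vel \<times> vel \<times> vel) set" where
  "E R = {p. norm (fst p) \<le> R \<and> norm (fst (snd p)) \<le> R}"

lemma E_meas: "E R \<in> sets (borel \<Otimes>\<^sub>M borel)"
proof -
  have "closed (E R)" unfolding E_def
    by (intro closed_Collect_conj closed_Collect_le continuous_intros)
  then show ?thesis unfolding borel_prod by (rule borel_closed)
qed

text \<open>One computation with a parameter w serves both claims; it needs w <= (1 + norm \<xi>s)
  (1 + norm \<xi>). The value 1 is always admissible. Off \<open>E R\<close> one of the two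
  velocities exceeds R, so 1 + R is admissible and becomes the gain.\<close>

lemma row_bounds:
  "\<exists>K>0. (\<forall>\<xi>. (\<integral>\<^sup>+y. ennreal (b \<xi> y) \<partial>lborel) \<le> ennreal K) \<and>
    (\<forall>\<xi> R. R \<ge> 0 \<longrightarrow> (\<integral>\<^sup>+y. ennreal (b \<xi> y) * indicator (- E R) (\<xi>, y) \<partial>lborel) \<le> ennreal (K / (1 + R)))"
proof -
  obtain K where K: "K > 0" "\<And>\<xi> \<xi>s. (\<integral>\<^sup>+x. ennreal (b \<xi> (\<xi>s, x)) \<partial>lborel)
     \<le> ennreal (K * (exp (- c * (norm \<xi>s)\<^sup>2) * ((1 + norm \<xi>s) / (1 + norm \<xi>))))"
    using row_density by blast
  obtain M where M: "M > 0" "(\<integral>\<^sup>+(x::vel). ennreal ((1 + norm x)\<^sup>2 * exp (- c * (norm x)\<^sup>2)) \<partial>lborel) \<le> ennreal M"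
    using gauss_moment[OF c] by blast
  have main: "(\<integral>\<^sup>+y. ennreal (b \<xi> y) * indicator A (fst y) \<partial>lborel) \<le> ennreal (K * M / w)"
    if [measurable]: "A \<in> sets borel" and w: "w > 0"
      and le: "\<And>\<xi>s. \<xi>s \<in> A \<Longrightarrow> (1 + norm \<xi>s) / (1 + norm \<xi>) \<le> (1 + norm \<xi>s)\<^sup>2 / w" for A \<xi> w
  proof -
    have "(\<integral>\<^sup>+y. ennreal (b \<xi> y) * indicator A (fst y) \<partial>lborel) = (\<integral>\<^sup>+\<xi>s. \<integral>\<^sup>+x. ennreal (b \<xi> (\<xi>s, x)) * indicator A \<xi>s \<partial>lborel \<partial>lborel)"
      by (subst nn_integral_vel_pair) auto
    also have "\<dots> = (\<integral>\<^sup>+\<xi>s. (\<integral>\<^sup>+x. ennreal (b \<xi> (\<xi>s, x)) \<partial>lborel) * indicator A \<xi>s \<partial>lborel)"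
      by (intro nn_integral_cong nn_integral_multc) measurable
    also have "\<dots> \<le> (\<integral>\<^sup>+(x::vel). ennreal (K / w) * ennreal ((1 + norm x)\<^sup>2 * exp (- c * (norm x)\<^sup>2)) \<partial>lborel)"
    proof (rule nn_integral_mono)
      fix \<xi>s :: vel
      show "(\<integral>\<^sup>+x. ennreal (b \<xi> (\<xi>s, x)) \<partial>lborel) * indicator A \<xi>s \<le> ennreal (K / w) * ennreal ((1 + norm \<xi>s)\<^sup>2 * exp (- c * (norm \<xi>s)\<^sup>2))"
      proof (cases "\<xi>s \<in> A")
        case True
        have "(\<integral>\<^sup>+x. ennreal (b \<xi> (\<xi>s, x)) \<partial>lborel) \<le> ennreal (K * (exp (- c * (norm \<xi>s)\<^sup>2) * ((1 + norm \<xi>s)\<^sup>2 / w)))"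
          using K(1) le[OF True] by (intro order_trans[OF K(2)] ennreal_leI mult_left_mono) auto
        also have "\<dots> = ennreal ((K / w) * ((1 + norm \<xi>s)\<^sup>2 * exp (- c * (norm \<xi>s)\<^sup>2)))" by (simp add: mult_ac)
        also have "\<dots> = ennreal (K / w) * ennreal ((1 + norm \<xi>s)\<^sup>2 * exp (- c * (norm \<xi>s)\<^sup>2))"
          using K(1) w by (intro ennreal_mult) auto
        finally show ?thesis using True by simp
      qed simp
    qed
    also have "\<dots> = ennreal (K / w) * (\<integral>\<^sup>+(x::vel). ennreal ((1 + norm x)\<^sup>2 * exp (- c * (norm x)\<^sup>2)) \<partial>lborel)"
      by (rule nn_integral_cmult) measurable
    also have "\<dots> \<le> ennreal (K / w) * ennreal M" by (intro mult_left_mono M) simp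
    also have "\<dots> = ennreal (K * M / w)" using K(1) M(1) w by (simp add: ennreal_mult[symmetric])
    finally show ?thesis .
  qed
  have sq: "(1 + norm \<xi>s) / (1 + norm \<xi>) \<le> (1 + norm \<xi>s)\<^sup>2 / w" if "w \<le> (1 + norm \<xi>s) * (1 + norm \<xi>)" "w > 0" for \<xi> \<xi>s :: vel and w
  proof -
    have p: "1 + norm \<xi> > 0" "1 + norm \<xi>s > 0" by (simp_all add: add_pos_nonneg)
    have "(1 + norm \<xi>s) * w \<le> (1 + norm \<xi>s) * ((1 + norm \<xi>s) * (1 + norm \<xi>))"
      using that p by (intro mult_left_mono) auto
    then have "(1 + norm \<xi>s) * w \<le> (1 + norm \<xi>s)\<^sup>2 * (1 + norm \<xi>)" by (simp only: power2_eq_square mult_ac)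
    then show ?thesis using p that(2) by (simp add: pos_divide_le_eq pos_le_divide_eq)
  qed
  have 1: "(\<integral>\<^sup>+y. ennreal (b \<xi> y) \<partial>lborel) \<le> ennreal (K * M)" for \<xi>
  proof -
    have "1 \<le> (1 + norm \<xi>s) * (1 + norm \<xi>)" for \<xi>s :: vel
      using mult_mono[of 1 "1 + norm \<xi>s" 1 "1 + norm \<xi>"] by simp
    then have "(\<integral>\<^sup>+y. ennreal (b \<xi> y) * indicator UNIV (fst y) \<partial>lborel) \<le> ennreal (K * M / 1)"
      by (intro main sq) auto
    then show ?thesis by simp
  qed
  have 2: "(\<integral>\<^sup>+y. ennreal (b \<xi> y) * indicator (- E R) (\<xi>, y) \<partial>lborel) \<le> ennreal (K * M / (1 + R))" if R: "R \<ge> 0" for \<xi> R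
  proof -
    \<comment> \<open>The section of the complement of \<open>E R\<close> at fixed
      \<open>\<xi>\<close>: everything when \<open>\<xi>\<close> itself is large.\<close>
    define A where "A = (if norm \<xi> \<le> R then {\<xi>s :: vel. R < norm \<xi>s} else UNIV)"
    have A [measurable]: "A \<in> sets borel" unfolding A_def by simp
    have "(indicator (- E R) (\<xi>, y) :: ennreal) = indicator A (fst y)" for y
      by (auto simp: E_def A_def indicator_def)
    moreover have "1 + R \<le> (1 + norm \<xi>s) * (1 + norm \<xi>)" if "\<xi>s \<in> A" for \<xi>s
    proof (cases "norm \<xi> \<le> R")
      case True
      then have "1 + R \<le> 1 + norm \<xi>s" using that by (simp add: A_def)
      then show ?thesis using mult_mono[of "1 + R" "1 + norm \<xi>s" 1 "1 + norm \<xi>"] R by simp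
    next
      case False
      then show ?thesis using mult_mono[of 1 "1 + norm \<xi>s" "1 + R" "1 + norm \<xi>"] R by simp
    qed
    ultimately show ?thesis using main[OF A, of "1 + R" \<xi>] sq R by simp
  qed
  show ?thesis using 1 2 K(1) M(1) by (intro exI[of _ "K * M"]) auto
qed

text \<open>Here \<open>\<eta>\<close>, \<open>u\<close>, \<open>v\<close> are $Z$, the other post-collisional velocity and $\xi_*$; the inequality rests on
  $p g - (1 - \tau\sigma)\eta = \tau\sigma u - v$, which decouples the Gaussian in $g$ from the one in $\omega$.\<close>

lemma exp_split:
  assumes u: "u = \<eta> - (\<sigma> * r) *\<^sub>R \<omega>" and v: "v = \<eta> - (\<tau> * r) *\<^sub>R \<omega> - p *\<^sub>R g"
  shows "exp (- c * (norm v)\<^sup>2) * exp (- c * (norm u)\<^sup>2)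
    \<le> exp (- (c / (4 * (1 + \<tau>\<^sup>2))) * (norm ((- (1 - \<tau> * \<sigma>)) *\<^sub>R \<eta> + p *\<^sub>R g))\<^sup>2) * exp (- (c / 2) * (norm u)\<^sup>2)"
proof -
  have s: "\<tau> * \<sigma> * (\<sigma> * r) = \<tau> * r" using \<sigma> by (metis mult.assoc mult.commute mult_1)
  have "(- (1 - \<tau> * \<sigma>)) *\<^sub>R \<eta> + p *\<^sub>R g = (\<tau> * \<sigma>) *\<^sub>R u - v"
    unfolding u v scaleR_diff_right scaleR_scaleR s by (simp add: algebra_simps)
  then have "norm ((- (1 - \<tau> * \<sigma>)) *\<^sub>R \<eta> + p *\<^sub>R g) \<le> \<bar>\<tau> * \<sigma>\<bar> * norm u + norm v"
    using norm_triangle_ineq4[of "(\<tau> * \<sigma>) *\<^sub>R u" v] by simp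
  then have "(norm ((- (1 - \<tau> * \<sigma>)) *\<^sub>R \<eta> + p *\<^sub>R g))\<^sup>2 \<le> (\<bar>\<tau> * \<sigma>\<bar> * norm u + norm v)\<^sup>2"
    by (intro power_mono) auto
  also have "\<dots> \<le> 2 * (\<bar>\<tau> * \<sigma>\<bar> * norm u)\<^sup>2 + 2 * (norm v)\<^sup>2"
    using zero_le_power2[of "\<bar>\<tau> * \<sigma>\<bar> * norm u - norm v"] by (simp add: power2_sum power2_diff)
  also have "(\<bar>\<tau> * \<sigma>\<bar> * norm u)\<^sup>2 = \<tau>\<^sup>2 * (norm u)\<^sup>2"
    using \<sigma> by (simp add: power_mult_distrib power2_eq_square[of \<sigma>])
  also have "2 * (\<tau>\<^sup>2 * (norm u)\<^sup>2) + 2 * (norm v)\<^sup>2 \<le> 2 * (1 + \<tau>\<^sup>2) * ((norm u)\<^sup>2 + (norm v)\<^sup>2)"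
    by (simp add: algebra_simps)
  finally have "(norm ((- (1 - \<tau> * \<sigma>)) *\<^sub>R \<eta> + p *\<^sub>R g))\<^sup>2 \<le> 2 * (1 + \<tau>\<^sup>2) * ((norm u)\<^sup>2 + (norm v)\<^sup>2)" .
  then have "(c / (4 * (1 + \<tau>\<^sup>2))) * (norm ((- (1 - \<tau> * \<sigma>)) *\<^sub>R \<eta> + p *\<^sub>R g))\<^sup>2
      \<le> (c / (4 * (1 + \<tau>\<^sup>2))) * (2 * (1 + \<tau>\<^sup>2) * ((norm u)\<^sup>2 + (norm v)\<^sup>2))"
    using c by (intro mult_left_mono) auto
  also have "\<dots> = (c / 2) * ((norm u)\<^sup>2 + (norm v)\<^sup>2)"
  proof -
    have "1 + \<tau>\<^sup>2 \<noteq> 0" by (metis add_pos_nonneg less_irrefl zero_le_power2 zero_less_one)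
    moreover have "c / (4 * T) * (2 * T * X) = c / 2 * X" if "T \<noteq> 0" for T X :: real using that by simp
    ultimately show ?thesis by blast
  qed
  also have "\<dots> \<le> (c / 2) * (norm u)\<^sup>2 + c * (norm v)\<^sup>2" using c by (simp add: algebra_simps)
  finally show ?thesis unfolding exp_add[symmetric] by (simp add: algebra_simps)
qed


text \<open>Two exchanges of integrals bring \<open>\<xi>\<close> innermost, where it is translated
  to \<eta> = Z, and two more bring \<eta> outermost. Both Gaussians then depend on g and on the
  direction; \<open>exp_split\<close> separates them. The sphere average of the one centred through
  \<eta> - \<sigma> rho \<omega> absorbs the factor rho, because \<sigma> is not 0. The remaining
  Gaussian in g has an integral independent of \<eta>, because p is not 0.\<close>

lemma col_bound:
  "\<exists>K\<ge>0. \<forall>f\<in>borel_measurable borel. (\<integral>\<^sup>+\<xi>. \<integral>\<^sup>+y. ennreal (b \<xi> y) * f (Z \<xi> y) \<partial>lborel \<partial>lborel) \<le> ennreal K * (\<integral>\<^sup>+x. f x \<partial>lborel)"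
proof -
  define \<kappa> where "\<kappa> = - (1 - \<tau> * \<sigma>)"
  define c' where "c' = c / (4 * (1 + \<tau>\<^sup>2))"
  have "1 + \<tau>\<^sup>2 > 0" by (simp add: add_pos_nonneg)
  then have c': "c' > 0" using c by (simp add: c'_def)
  have c2: "c / 2 > 0" using c by simp
  have sg: "- \<sigma> \<noteq> 0" using \<sigma> by auto
  obtain K1 where K1: "K1 > 0" "\<And>A r. r \<ge> 0 \<Longrightarrow>
     ennreal r * nsph (\<lambda>\<omega>. ennreal (exp (- (c / 2) * (norm (A + (- \<sigma> * r) *\<^sub>R \<omega>))\<^sup>2))) \<le> ennreal (K1 / (1 + r))"
    using rho_nsph_gauss[OF c2 sg] by blast
  obtain M where M: "M > 0" "(\<integral>\<^sup>+(x::vel). ennreal ((1 + norm x)\<^sup>2 * exp (- c' * (norm x)\<^sup>2)) \<partial>lborel) \<le> ennreal M"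
    using gauss_moment[OF c'] by blast
  define K where "K = Cb * K1 * (1 / \<bar>p\<bar>^3 * M)"
  have "(\<integral>\<^sup>+\<xi>. \<integral>\<^sup>+y. ennreal (b \<xi> y) * f (Z \<xi> y) \<partial>lborel \<partial>lborel) \<le> ennreal K * (\<integral>\<^sup>+x. f x \<partial>lborel)"
    if f [measurable]: "f \<in> borel_measurable borel" for f
  proof -
    define B where "B \<xi> g x = ennreal (Cb * exp (- c * (norm (\<xi> - g))\<^sup>2)) * (ennreal (rho d g) *
     (indicator (ball 0 1 - {0}) x * ennreal (exp (- c * (norm (\<xi> - q *\<^sub>R g + ((\<tau> - \<sigma>) * rho d g) *\<^sub>R (x /\<^sub>R norm x)))\<^sup>2))))" for \<xi> g x :: vel
    \<comment> \<open>The displacement from \<open>Z\<close> to \<open>\<xi>\<close>; it does not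
      involve \<open>\<xi>\<close>, hence the pure translation.\<close>
    define Y where "Y g x = q *\<^sub>R g - (\<tau> * rho d g) *\<^sub>R (x /\<^sub>R norm x)" for g x :: vel
    have Bm [measurable (raw)]: "(\<lambda>w. B (f1 w) (f2 w) (f3 w)) \<in> borel_measurable N"
      if [measurable]: "f1 \<in> borel_measurable N" "f2 \<in> borel_measurable N" "f3 \<in> borel_measurable N" for N :: "'w measure" and f1 f2 f3
      unfolding B_def by measurable
    have Ym [measurable (raw)]: "(\<lambda>w. Y (f1 w) (f2 w)) \<in> borel_measurable N"
      if [measurable]: "f1 \<in> borel_measurable N" "f2 \<in> borel_measurable N" for N :: "'w measure" and f1 f2
      unfolding Y_def by measurable
    have ZY: "Z \<xi> (\<xi> - g, x) = \<xi> - Y g x" for \<xi> g x by (simp add: Z_def Y_def algebra_simps)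
    have step1: "(\<integral>\<^sup>+y. ennreal (b \<xi> y) * f (Z \<xi> y) \<partial>lborel) \<le> (\<integral>\<^sup>+g. \<integral>\<^sup>+x. B \<xi> g x * f (\<xi> - Y g x) \<partial>lborel \<partial>lborel)" for \<xi>
    proof -
      have "(\<integral>\<^sup>+y. ennreal (b \<xi> y) * f (Z \<xi> y) \<partial>lborel) = (\<integral>\<^sup>+\<xi>s. \<integral>\<^sup>+x. ennreal (b \<xi> (\<xi>s, x)) * f (Z \<xi> (\<xi>s, x)) \<partial>lborel \<partial>lborel)"
        by (rule nn_integral_vel_pair) measurable
      also have "\<dots> = (\<integral>\<^sup>+g. \<integral>\<^sup>+x. ennreal (b \<xi> (\<xi> - g, x)) * f (Z \<xi> (\<xi> - g, x)) \<partial>lborel \<partial>lborel)"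
        by (rule nn_integral_vel_reflect[symmetric]) measurable
      also have "\<dots> \<le> (\<integral>\<^sup>+g. \<integral>\<^sup>+x. B \<xi> g x * f (\<xi> - Y g x) \<partial>lborel \<partial>lborel)"
      proof (intro nn_integral_mono)
        fix g x :: vel
        have "ennreal (b \<xi> (\<xi> - g, x)) \<le> B \<xi> g x" unfolding B_def using b_le_ennreal[of \<xi> "\<xi> - g" x] by simp
        then show "ennreal (b \<xi> (\<xi> - g, x)) * f (Z \<xi> (\<xi> - g, x)) \<le> B \<xi> g x * f (\<xi> - Y g x)"
          unfolding ZY by (rule mult_right_mono) simp
      qed
      finally show ?thesis .
    qed
    have "(\<integral>\<^sup>+\<xi>. \<integral>\<^sup>+y. ennreal (b \<xi> y) * f (Z \<xi> y) \<partial>lborel \<partial>lborel)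
       \<le> (\<integral>\<^sup>+\<xi>. \<integral>\<^sup>+g. \<integral>\<^sup>+x. B \<xi> g x * f (\<xi> - Y g x) \<partial>lborel \<partial>lborel \<partial>lborel)"
      by (intro nn_integral_mono step1)
    also have "\<dots> = (\<integral>\<^sup>+g. \<integral>\<^sup>+\<xi>. \<integral>\<^sup>+x. B \<xi> g x * f (\<xi> - Y g x) \<partial>lborel \<partial>lborel \<partial>lborel)"
      by (rule lborel_pair.Fubini') measurable
    also have "\<dots> = (\<integral>\<^sup>+g. \<integral>\<^sup>+x. \<integral>\<^sup>+\<xi>. B \<xi> g x * f (\<xi> - Y g x) \<partial>lborel \<partial>lborel \<partial>lborel)"
      by (intro nn_integral_cong lborel_pair.Fubini') measurable
    also have "\<dots> = (\<integral>\<^sup>+g. \<integral>\<^sup>+x. \<integral>\<^sup>+\<eta>. B (Y g x + \<eta>) g x * f \<eta> \<partial>lborel \<partial>lborel \<partial>lborel)"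
    proof (rule nn_integral_cong, rule nn_integral_cong)
      fix g x :: vel
      have "(\<integral>\<^sup>+\<eta>. B (Y g x + \<eta>) g x * f (Y g x + \<eta> - Y g x) \<partial>lborel) = (\<integral>\<^sup>+\<xi>. B \<xi> g x * f (\<xi> - Y g x) \<partial>lborel)"
        by (rule nn_integral_vel_shift) measurable
      then show "(\<integral>\<^sup>+\<xi>. B \<xi> g x * f (\<xi> - Y g x) \<partial>lborel) = (\<integral>\<^sup>+\<eta>. B (Y g x + \<eta>) g x * f \<eta> \<partial>lborel)" by simp
    qed
    also have "\<dots> = (\<integral>\<^sup>+g. \<integral>\<^sup>+\<eta>. \<integral>\<^sup>+x. B (Y g x + \<eta>) g x * f \<eta> \<partial>lborel \<partial>lborel \<partial>lborel)"
      by (intro nn_integral_cong lborel_pair.Fubini'[symmetric]) measurable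
    also have "\<dots> = (\<integral>\<^sup>+\<eta>. \<integral>\<^sup>+g. \<integral>\<^sup>+x. B (Y g x + \<eta>) g x * f \<eta> \<partial>lborel \<partial>lborel \<partial>lborel)"
      by (rule lborel_pair.Fubini') measurable
    also have "\<dots> \<le> (\<integral>\<^sup>+\<eta>. ennreal K * f \<eta> \<partial>lborel)"
    proof (rule nn_integral_mono)
      fix \<eta> :: vel
      have inner: "(\<integral>\<^sup>+x. B (Y g x + \<eta>) g x \<partial>lborel) \<le> ennreal (Cb * K1) * ennreal (exp (- c' * (norm (\<kappa> *\<^sub>R \<eta> + p *\<^sub>R g))\<^sup>2))" for g :: vel
      proof -
        define r where "r = rho d g"
        have r: "r \<ge> 0" by (simp add: r_def)
        let ?G = "ennreal (Cb * exp (- c' * (norm (\<kappa> *\<^sub>R \<eta> + p *\<^sub>R g))\<^sup>2))"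
        have "(\<integral>\<^sup>+x. B (Y g x + \<eta>) g x \<partial>lborel) \<le> (\<integral>\<^sup>+x. ?G * (ennreal r * (indicator (ball 0 1 - {0}) x *
            ennreal (exp (- (c / 2) * (norm (\<eta> + (- \<sigma> * r) *\<^sub>R (x /\<^sub>R norm x)))\<^sup>2)))) \<partial>lborel)"
        proof (rule nn_integral_mono)
          fix x :: vel
          define \<omega> where "\<omega> = x /\<^sub>R norm x"
          define u where "u = \<eta> - (\<sigma> * r) *\<^sub>R \<omega>"
          define v where "v = \<eta> - (\<tau> * r) *\<^sub>R \<omega> - p *\<^sub>R g"
          have p1: "p = 1 - q" using pq by simp
          have v': "Y g x + \<eta> - g = v" unfolding Y_def v_def p1 by (simp add: r_def \<omega>_def algebra_simps)
          have u': "Y g x + \<eta> - q *\<^sub>R g + ((\<tau> - \<sigma>) * rho d g) *\<^sub>R (x /\<^sub>R norm x) = u"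
            unfolding Y_def u_def by (simp add: r_def \<omega>_def algebra_simps)
          have u'': "\<eta> + (- \<sigma> * r) *\<^sub>R (x /\<^sub>R norm x) = u" by (simp add: u_def \<omega>_def)
          have "Cb * (exp (- c * (norm v)\<^sup>2) * exp (- c * (norm u)\<^sup>2))
            \<le> Cb * (exp (- c' * (norm (\<kappa> *\<^sub>R \<eta> + p *\<^sub>R g))\<^sup>2) * exp (- (c / 2) * (norm u)\<^sup>2))"
            unfolding c'_def \<kappa>_def using Cb by (intro mult_left_mono exp_split[where r=r and \<omega>=\<omega>] u_def v_def) auto
          then have "ennreal ((Cb * exp (- c * (norm v)\<^sup>2)) * exp (- c * (norm u)\<^sup>2))
            \<le> ennreal ((Cb * exp (- c' * (norm (\<kappa> *\<^sub>R \<eta> + p *\<^sub>R g))\<^sup>2)) * exp (- (c / 2) * (norm u)\<^sup>2))"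
            by (intro ennreal_leI) (simp only: mult.assoc)
          then have le: "ennreal (Cb * exp (- c * (norm v)\<^sup>2)) * ennreal (exp (- c * (norm u)\<^sup>2)) \<le> ?G * ennreal (exp (- (c / 2) * (norm u)\<^sup>2))"
            using Cb by (subst (asm) (1 2) ennreal_mult) auto
          have "B (Y g x + \<eta>) g x = (ennreal r * indicator (ball 0 1 - {0}) x) * (ennreal (Cb * exp (- c * (norm v)\<^sup>2)) * ennreal (exp (- c * (norm u)\<^sup>2)))"
            unfolding B_def v' u' r_def by (simp only: mult_ac)
          also have "\<dots> \<le> (ennreal r * indicator (ball 0 1 - {0}) x) * (?G * ennreal (exp (- (c / 2) * (norm u)\<^sup>2)))"
            by (rule mult_left_mono[OF le]) simp
          finally show "B (Y g x + \<eta>) g x \<le> ?G * (ennreal r * (indicator (ball 0 1 - {0}) x *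
            ennreal (exp (- (c / 2) * (norm (\<eta> + (- \<sigma> * r) *\<^sub>R (x /\<^sub>R norm x)))\<^sup>2))))"
            unfolding u'' by (simp only: mult_ac)
        qed
        also have "\<dots> = ?G * (ennreal r * nsph (\<lambda>\<omega>. ennreal (exp (- (c / 2) * (norm (\<eta> + (- \<sigma> * r) *\<^sub>R \<omega>))\<^sup>2))))"
          unfolding nsph_def by (simp add: nn_integral_cmult)
        also have "\<dots> \<le> ?G * ennreal (K1 / (1 + r))" by (intro mult_left_mono K1 r) simp
        also have "\<dots> \<le> ?G * ennreal K1"
        proof (intro mult_left_mono ennreal_leI)
          have "K1 * 1 \<le> K1 * (1 + r)" using K1(1) r by (intro mult_left_mono) auto
          then show "K1 / (1 + r) \<le> K1" using r by (simp add: pos_divide_le_eq)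
        qed simp
        also have "\<dots> = ennreal (Cb * K1) * ennreal (exp (- c' * (norm (\<kappa> *\<^sub>R \<eta> + p *\<^sub>R g))\<^sup>2))"
          using Cb K1(1) by (simp add: ennreal_mult mult_ac)
        finally show ?thesis .
      qed
      have "(\<integral>\<^sup>+g. \<integral>\<^sup>+x. B (Y g x + \<eta>) g x * f \<eta> \<partial>lborel \<partial>lborel) = (\<integral>\<^sup>+g. \<integral>\<^sup>+x. B (Y g x + \<eta>) g x \<partial>lborel \<partial>lborel) * f \<eta>"
        by (simp add: nn_integral_multc)
      also have "(\<integral>\<^sup>+g. \<integral>\<^sup>+x. B (Y g x + \<eta>) g x \<partial>lborel \<partial>lborel) \<le> (\<integral>\<^sup>+g. ennreal (Cb * K1) * ennreal (exp (- c' * (norm (\<kappa> *\<^sub>R \<eta> + p *\<^sub>R g))\<^sup>2)) \<partial>lborel)"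
        by (intro nn_integral_mono inner)
      also have "\<dots> = ennreal (Cb * K1) * (\<integral>\<^sup>+g. ennreal (exp (- c' * (norm (\<kappa> *\<^sub>R \<eta> + p *\<^sub>R g))\<^sup>2)) \<partial>lborel)"
        by (rule nn_integral_cmult) measurable
      also have "(\<integral>\<^sup>+g. ennreal (exp (- c' * (norm (\<kappa> *\<^sub>R \<eta> + p *\<^sub>R g))\<^sup>2)) \<partial>lborel) = ennreal (1 / \<bar>p\<bar>^3) * (\<integral>\<^sup>+(x::vel). ennreal (exp (- c' * (norm x)\<^sup>2)) \<partial>lborel)"
        using pq by (intro nn_integral_vel_affine) auto
      also have "(\<integral>\<^sup>+(x::vel). ennreal (exp (- c' * (norm x)\<^sup>2)) \<partial>lborel) \<le> (\<integral>\<^sup>+(x::vel). ennreal ((1 + norm x)\<^sup>2 * exp (- c' * (norm x)\<^sup>2)) \<partial>lborel)"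
        by (intro nn_integral_mono ennreal_leI) (simp add: mult_le_cancel_right1 one_le_power)
      also note M(2)
      finally have "(\<integral>\<^sup>+g. \<integral>\<^sup>+x. B (Y g x + \<eta>) g x * f \<eta> \<partial>lborel \<partial>lborel) \<le> ennreal (Cb * K1) * (ennreal (1 / \<bar>p\<bar>^3) * ennreal M) * f \<eta>"
        by (simp add: mult_left_mono mult_right_mono)
      also have "ennreal (Cb * K1) * (ennreal (1 / \<bar>p\<bar>^3) * ennreal M) = ennreal K"
      proof -
        have a: "ennreal (1 / \<bar>p\<bar>^3) * ennreal M = ennreal (1 / \<bar>p\<bar>^3 * M)"
          using M(1) by (intro ennreal_mult[symmetric]) auto
        show ?thesis unfolding a K_def using Cb K1(1) M(1) by (intro ennreal_mult[symmetric]) auto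
      qed
      finally show "(\<integral>\<^sup>+g. \<integral>\<^sup>+x. B (Y g x + \<eta>) g x * f \<eta> \<partial>lborel \<partial>lborel) \<le> ennreal K * f \<eta>" .
    qed
    also have "\<dots> = ennreal K * (\<integral>\<^sup>+x. f x \<partial>lborel)" by (rule nn_integral_cmult) measurable
    finally show ?thesis .
  qed
  moreover have "K \<ge> 0" unfolding K_def using Cb K1(1) M(1) by simp
  ultimately show ?thesis by blast
qed

text \<open>On \<open>E R\<close> the relative velocity has norm at most 2 R, and the Gaussians may
  be dropped. What remains is the law of the scattered velocity tested on a translate of f;
  translation invariance makes the constant independent of \<open>\<xi>\<close>.\<close>

lemma functional_bound:
  assumes R: "R > 0"
  shows "\<exists>K\<ge>0. \<forall>\<xi>. \<forall>f\<in>borel_measurable borel.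
    (\<integral>\<^sup>+y. ennreal (b \<xi> y) * indicator (E R) (\<xi>, y) * f (Z \<xi> y) \<partial>lborel)\<^sup>2 \<le> (ennreal K * indicator (cball 0 R) \<xi>) * (\<integral>\<^sup>+x. (f x)\<^sup>2 \<partial>lborel)"
proof -
  have q0: "- q \<noteq> 0" "2 * R > 0" using pq R by auto
  from scatter_L2_bound[OF q0(1) \<tau>(1) q0(2), of d] obtain K where K: "K \<ge> 0"
    and bd: "\<And>f. f \<in> borel_measurable borel \<Longrightarrow>
    (\<integral>\<^sup>+g. indicator (cball 0 (2 * R)) g * ennreal (rho d g) * nsph (\<lambda>\<omega>. f ((- q) *\<^sub>R g + (\<tau> * rho d g) *\<^sub>R \<omega>)) \<partial>lborel)\<^sup>2
      \<le> ennreal K * (\<integral>\<^sup>+z. (f z)\<^sup>2 \<partial>lborel)" by blast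
  have "(\<integral>\<^sup>+y. ennreal (b \<xi> y) * indicator (E R) (\<xi>, y) * f (Z \<xi> y) \<partial>lborel)\<^sup>2 \<le> (ennreal (Cb\<^sup>2 * K) * indicator (cball 0 R) \<xi>) * (\<integral>\<^sup>+x. (f x)\<^sup>2 \<partial>lborel)"
    if f [measurable]: "f \<in> borel_measurable borel" for \<xi> f
  proof (cases "norm \<xi> \<le> R")
    case False
    then have "indicator (E R) (\<xi>, y) = (0::ennreal)" for y by (simp add: E_def indicator_def)
    then show ?thesis by simp
  next
    case True
    note [measurable] = E_meas[of R]
    have Es [measurable]: "(\<lambda>y. indicator (E R) (\<xi>, y) :: ennreal) \<in> borel_measurable borel"
      using measurable_Pair2[of "indicator (E R) :: _ \<Rightarrow> ennreal" borel borel borel \<xi>] by simp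
    define F where "F g x = ennreal Cb * (indicator (cball 0 (2 * R)) g * ennreal (rho d g) * (indicator (ball 0 1 - {0}) x * f (\<xi> + ((- q) *\<^sub>R g + (\<tau> * rho d g) *\<^sub>R (x /\<^sub>R norm x)))))" for g x :: vel
    have Fm [measurable (raw)]: "(\<lambda>w. F (f1 w) (f2 w)) \<in> borel_measurable N"
      if [measurable]: "f1 \<in> borel_measurable N" "f2 \<in> borel_measurable N" for N :: "'w measure" and f1 f2
      unfolding F_def by measurable
    have "(\<integral>\<^sup>+y. ennreal (b \<xi> y) * indicator (E R) (\<xi>, y) * f (Z \<xi> y) \<partial>lborel) \<le> (\<integral>\<^sup>+y. F (\<xi> - fst y) (snd y) \<partial>lborel)"
    proof (rule nn_integral_mono)
      fix y :: "vel \<times> vel"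
      obtain \<xi>s x where y: "y = (\<xi>s, x)" by (cases y)
      show "ennreal (b \<xi> y) * indicator (E R) (\<xi>, y) * f (Z \<xi> y) \<le> F (\<xi> - fst y) (snd y)"
      proof (cases "norm \<xi>s \<le> R")
        case False then show ?thesis by (simp add: y E_def)
      next
        case s: True
        have ge: "norm (\<xi> - \<xi>s) \<le> 2 * R" using norm_triangle_ineq4[of \<xi> \<xi>s] True s by linarith
        let ?e1 = "exp (- c * (norm \<xi>s)\<^sup>2)" and ?e2 = "exp (- c * (norm (\<xi> - q *\<^sub>R (\<xi> - \<xi>s) + ((\<tau> - \<sigma>) * rho d (\<xi> - \<xi>s)) *\<^sub>R (x /\<^sub>R norm x)))\<^sup>2)"
        have "?e1 * ?e2 \<le> 1 * 1" using c by (intro mult_mono) auto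
        then have "(Cb * rho d (\<xi> - \<xi>s) * indicator (ball 0 1 - {0}) x) * (?e1 * ?e2) \<le> (Cb * rho d (\<xi> - \<xi>s) * indicator (ball 0 1 - {0}) x) * 1"
          using Cb by (intro mult_left_mono) auto
        moreover have "b \<xi> y \<le> (Cb * rho d (\<xi> - \<xi>s) * indicator (ball 0 1 - {0}) x) * (?e1 * ?e2)"
          unfolding y using b_le[of \<xi> \<xi>s x] by (simp only: mult_ac)
        ultimately have "b \<xi> y \<le> Cb * rho d (\<xi> - \<xi>s) * indicator (ball 0 1 - {0}) x"
          by linarith
        then have "ennreal (b \<xi> y) \<le> ennreal Cb * (ennreal (rho d (\<xi> - \<xi>s)) * indicator (ball 0 1 - {0}) x)"
          using Cb by (auto simp: ennreal_mult[symmetric] ennreal_neg indicator_def intro!: ennreal_leI split: if_splits dest: order_trans)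
        moreover have Zy: "Z \<xi> y = \<xi> + ((- q) *\<^sub>R (\<xi> - \<xi>s) + (\<tau> * rho d (\<xi> - \<xi>s)) *\<^sub>R (x /\<^sub>R norm x))" by (simp add: Z_def y algebra_simps)
        ultimately have "ennreal (b \<xi> y) * f (Z \<xi> y) \<le> ennreal Cb * (ennreal (rho d (\<xi> - \<xi>s)) * indicator (ball 0 1 - {0}) x) * f (\<xi> + ((- q) *\<^sub>R (\<xi> - \<xi>s) + (\<tau> * rho d (\<xi> - \<xi>s)) *\<^sub>R (x /\<^sub>R norm x)))"
          unfolding Zy by (intro mult_right_mono) auto
        also have "\<dots> = F (\<xi> - fst y) (snd y)" unfolding F_def y using ge by (simp add: mult_ac)
        finally show ?thesis by (auto simp: indicator_def split: if_splits)
      qed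
    qed
    also have "\<dots> = (\<integral>\<^sup>+\<xi>s. \<integral>\<^sup>+x. F (\<xi> - \<xi>s) x \<partial>lborel \<partial>lborel)"
      by (subst nn_integral_vel_pair) auto
    also have "\<dots> = (\<integral>\<^sup>+g. \<integral>\<^sup>+x. F g x \<partial>lborel \<partial>lborel)"
      by (rule nn_integral_vel_reflect) measurable
    also have "\<dots> = ennreal Cb * (\<integral>\<^sup>+g. indicator (cball 0 (2 * R)) g * ennreal (rho d g) * nsph (\<lambda>\<omega>. f (\<xi> + ((- q) *\<^sub>R g + (\<tau> * rho d g) *\<^sub>R \<omega>))) \<partial>lborel)"
      unfolding F_def nsph_def by (simp add: nn_integral_cmult)
    finally have "(\<integral>\<^sup>+y. ennreal (b \<xi> y) * indicator (E R) (\<xi>, y) * f (Z \<xi> y) \<partial>lborel)\<^sup>2 \<le> \<dots>\<^sup>2" by (rule power_mono_ennreal)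
    also have "\<dots> = (ennreal Cb)\<^sup>2 * (\<integral>\<^sup>+g. indicator (cball 0 (2 * R)) g * ennreal (rho d g) * nsph (\<lambda>\<omega>. f (\<xi> + ((- q) *\<^sub>R g + (\<tau> * rho d g) *\<^sub>R \<omega>))) \<partial>lborel)\<^sup>2"
      by (rule power_mult_distrib)
    also have "\<dots> \<le> (ennreal Cb)\<^sup>2 * (ennreal K * (\<integral>\<^sup>+z. (f (\<xi> + z))\<^sup>2 \<partial>lborel))"
      by (intro mult_left_mono bd[of "\<lambda>z. f (\<xi> + z)"]) auto
    also have "(\<integral>\<^sup>+z. (f (\<xi> + z))\<^sup>2 \<partial>lborel) = (\<integral>\<^sup>+z. (f z)\<^sup>2 \<partial>lborel)"
      by (rule nn_integral_vel_shift) measurable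
    also have "(ennreal Cb)\<^sup>2 * (ennreal K * (\<integral>\<^sup>+z. (f z)\<^sup>2 \<partial>lborel)) = (ennreal (Cb\<^sup>2 * K) * indicator (cball 0 R) \<xi>) * (\<integral>\<^sup>+x. (f x)\<^sup>2 \<partial>lborel)"
      using Cb K True by (simp add: ennreal_power ennreal_mult mult_ac)
    finally show ?thesis .
  qed
  then show ?thesis using K by (intro exI[of _ "Cb\<^sup>2 * K"]) auto
qed

lemma gain_compact: "compact_kernel b Z"
proof -
  obtain K where K: "K > 0" "\<And>\<xi>. (\<integral>\<^sup>+y. ennreal (b \<xi> y) \<partial>lborel) \<le> ennreal K"
    "\<And>\<xi> R. R \<ge> 0 \<Longrightarrow> (\<integral>\<^sup>+y. ennreal (b \<xi> y) * indicator (- E R) (\<xi>, y) \<partial>lborel) \<le> ennreal (K / (1 + R))"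
    using row_bounds by blast
  obtain K2 where K2: "K2 \<ge> 0" "\<And>f. f\<in>borel_measurable borel \<Longrightarrow>
     (\<integral>\<^sup>+\<xi>. \<integral>\<^sup>+y. ennreal (b \<xi> y) * f (Z \<xi> y) \<partial>lborel \<partial>lborel) \<le> ennreal K2 * (\<integral>\<^sup>+x. f x \<partial>lborel)"
    using col_bound by blast
  interpret schur_kernel b Z K K2
    by unfold_locales (use K K2 b_nonneg in auto)
  show ?thesis
  proof (rule compact_kernelI, goal_cases)
    case e: (1 e)
    define R where "R = max 1 (K / e)"
    have R: "R > 0" "R \<ge> 0" "K / (1 + R) \<le> e"
    proof -
      show "R > 0" "R \<ge> 0" by (auto simp: R_def)
      have "K / e \<le> R" by (simp add: R_def)
      then have "K \<le> e * R" using e by (simp add: field_simps)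
      also have "\<dots> \<le> e * (1 + R)" using e by simp
      finally show "K / (1 + R) \<le> e" using \<open>R > 0\<close> by (simp add: pos_divide_le_eq)
    qed
    obtain K3 where K3: "K3 \<ge> 0" "\<And>\<xi> f. f\<in>borel_measurable borel \<Longrightarrow>
       (\<integral>\<^sup>+y. ennreal (b \<xi> y) * indicator (E R) (\<xi>, y) * f (Z \<xi> y) \<partial>lborel)\<^sup>2 \<le> (ennreal K3 * indicator (cball 0 R) \<xi>) * (\<integral>\<^sup>+x. (f x)\<^sup>2 \<partial>lborel)"
      using functional_bound[OF R(1)] by blast
    show ?case
    proof (intro exI conjI)
      show "E R \<in> sets (borel \<Otimes>\<^sub>M borel)" by (rule E_meas)
      show "(\<lambda>\<xi>::vel. ennreal K3 * indicator (cball 0 R) \<xi>) \<in> borel_measurable borel" by measurable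
      show "(\<integral>\<^sup>+\<xi>. ennreal K3 * indicator (cball (0::vel) R) \<xi> \<partial>lborel) < \<infinity>"
        using R by (simp add: nn_integral_cmult_indicator emeasure_cball ennreal_mult_less_top)
      show "\<forall>x. (\<integral>\<^sup>+y. ennreal (b x y) * indicator (-E R) (x, y) \<partial>lborel) \<le> ennreal e"
        using K(3)[OF R(2)] R(3) by (meson ennreal_leI order_trans)
      show "\<forall>x. \<forall>f \<in> borel_measurable borel.
         (\<integral>\<^sup>+y. ennreal (b x y) * indicator (E R) (x, y) * f (Z x y) \<partial>lborel)\<^sup>2 \<le> (ennreal K3 * indicator (cball 0 R) x) * (\<integral>\<^sup>+x. (f x)\<^sup>2 \<partial>lborel)"
        using K3(2) by blast
    qed
  qed
qed

end

text \<open>Here \<open>h\<close> is evaluated at \<open>fst y\<close> = \<open>\<xi>s\<close>, and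
  there are Gaussians in both incoming velocities, so the weight is dominated by a product of a
  function of \<open>\<xi>\<close> and a function of \<open>\<xi>s\<close>.\<close>

locale loss =
  fixes d c Cb :: real and b :: "vel \<Rightarrow> vel \<times> vel \<Rightarrow> real"
  assumes c: "c > 0" and Cb: "Cb \<ge> 0"
    and b_meas [measurable]: "(\<lambda>(x, y). b x y) \<in> borel_measurable (borel \<Otimes>\<^sub>M borel)"
    and b_nonneg: "b \<xi> y \<ge> 0"
    and b_le: "b \<xi> (\<xi>s, x) \<le> Cb * rho d (\<xi> - \<xi>s) * exp (- c * (norm \<xi>)\<^sup>2) * exp (- c * (norm \<xi>s)\<^sup>2) * indicator (ball 0 1 - {0}) x"
begin

text \<open>The polynomial factor pays for rho, which is at most a constant times (1 + norm \<xi>)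
  (1 + norm \<xi>s).\<close>

definition k :: "vel \<Rightarrow> real" where "k x = (1 + norm x) * exp (- c * (norm x)\<^sup>2)"

lemma k_nonneg: "k x \<ge> 0" by (simp add: k_def)

lemma k_meas [measurable]: "k \<in> borel_measurable borel" unfolding k_def by measurable

lemma b_meas3 [measurable]: "(\<lambda>(x, y). b x y) \<in> borel_measurable (borel \<Otimes>\<^sub>M (borel \<Otimes>\<^sub>M borel))"
  using b_meas by (simp add: borel_prod)

lemma fst_meas: "(\<lambda>(x::vel, y). fst y) \<in> borel_measurable (borel \<Otimes>\<^sub>M (borel :: (vel \<times> vel) measure))"
proof -
  show ?thesis unfolding borel_prod case_prod_beta
    by (intro borel_measurable_continuous_onI continuous_intros)
qed

lemma k_bounds: "\<exists>K>0. (\<forall>x. k x \<le> K) \<and> (\<integral>\<^sup>+x. ennreal (k x) \<partial>lborel) \<le> ennreal K \<and> (\<integral>\<^sup>+x. ennreal ((k x)\<^sup>2) \<partial>lborel) \<le> ennreal K"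
proof -
  obtain M where M: "M > 0" "(\<integral>\<^sup>+(x::vel). ennreal ((1 + norm x)\<^sup>2 * exp (- c * (norm x)\<^sup>2)) \<partial>lborel) \<le> ennreal M"
    using gauss_moment[OF c] by blast
  have k1: "k x \<le> 1 + (1 + 1 / c)" for x
  proof -
    have e: "exp (- (c * (norm x)\<^sup>2)) \<le> 1" using c by simp
    have "(c * (norm x)\<^sup>2) * exp (- (c * (norm x)\<^sup>2)) \<le> 1"
      using pow_exp_le[of "c * (norm x)\<^sup>2" 1] c by simp
    then have e2: "(norm x)\<^sup>2 * exp (- (c * (norm x)\<^sup>2)) \<le> 1 / c" using c by (simp add: field_simps)
    have "norm x \<le> 1 + (norm x)\<^sup>2"
    proof -
      have "2 * norm x \<le> (norm x)\<^sup>2 + 1" using zero_le_power2[of "norm x - 1"] by (simp add: power2_diff)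
      then show ?thesis using zero_le_power2[of "norm x"] norm_ge_zero[of x] by linarith
    qed
    then have "k x \<le> (1 + (1 + (norm x)\<^sup>2)) * exp (- (c * (norm x)\<^sup>2))"
      unfolding k_def by (simp add: mult_right_mono)
    also have "\<dots> = 2 * exp (- (c * (norm x)\<^sup>2)) + (norm x)\<^sup>2 * exp (- (c * (norm x)\<^sup>2))" by (simp add: algebra_simps)
    also have "\<dots> \<le> 1 + (1 + 1 / c)" using e e2 by linarith
    finally show ?thesis .
  qed
  have k2: "k x \<le> M + 1 + (1 + 1 / c)" for x using k1[of x] M(1) by linarith
  have ksq: "(k x)\<^sup>2 \<le> (1 + norm x)\<^sup>2 * exp (- c * (norm x)\<^sup>2)" for x
  proof -
    have "exp (- c * (norm x)\<^sup>2) * exp (- c * (norm x)\<^sup>2) \<le> exp (- c * (norm x)\<^sup>2) * 1"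
      using c by (intro mult_left_mono) auto
    then show ?thesis unfolding k_def power_mult_distrib
      by (intro mult_left_mono) (auto simp: power2_eq_square)
  qed
  have kle: "k x \<le> (1 + norm x)\<^sup>2 * exp (- c * (norm x)\<^sup>2)" for x
    unfolding k_def using mult_left_mono[of 1 "1 + norm x" "1 + norm x"]
    by (intro mult_right_mono) (auto simp: power2_eq_square)
  have "(\<integral>\<^sup>+x. ennreal (k x) \<partial>lborel) \<le> ennreal M"
    by (rule order_trans[OF nn_integral_mono M(2)]) (intro ennreal_leI kle)
  moreover have "(\<integral>\<^sup>+x. ennreal ((k x)\<^sup>2) \<partial>lborel) \<le> ennreal M"
    by (rule order_trans[OF nn_integral_mono M(2)]) (intro ennreal_leI ksq)
  moreover have "ennreal M \<le> ennreal (M + 1 + (1 + 1 / c))" using c by (intro ennreal_leI) simp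
  ultimately show ?thesis
    using k2 M(1) c by (intro exI[of _ "M + 1 + (1 + 1 / c)"]) (auto intro: order_trans simp: add_pos_pos)
qed

lemma int_le:
  assumes f [measurable]: "f \<in> borel_measurable borel"
  shows "(\<integral>\<^sup>+y. ennreal (b \<xi> y) * f (fst y) \<partial>lborel)
    \<le> ennreal (Cb * (1 + sqrt (2 * \<bar>d\<bar>)) * unit_ball_vol 3 * k \<xi>) * (\<integral>\<^sup>+u. ennreal (k u) * f u \<partial>lborel)"
proof -
  define S where "S = 1 + sqrt (2 * \<bar>d\<bar>)"
  have S: "S \<ge> 0" by (simp add: S_def add_nonneg_nonneg)
  have bb: "ennreal (b \<xi> (u, x)) \<le> ennreal (Cb * S * k \<xi>) * (ennreal (k u) * indicator (ball 0 1 - {0}) x)" for u x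
  proof -
    have "(Cb * exp (- c * (norm \<xi>)\<^sup>2) * exp (- c * (norm u)\<^sup>2)) * rho d (\<xi> - u) \<le> (Cb * exp (- c * (norm \<xi>)\<^sup>2) * exp (- c * (norm u)\<^sup>2)) * (S * (1 + norm \<xi>) * (1 + norm u))"
      using Cb unfolding S_def by (intro mult_left_mono rho_le_prod) auto
    then have "Cb * rho d (\<xi> - u) * exp (- c * (norm \<xi>)\<^sup>2) * exp (- c * (norm u)\<^sup>2) \<le> (Cb * S * k \<xi>) * k u"
      unfolding k_def by (simp only: mult_ac)
    then have "(Cb * rho d (\<xi> - u) * exp (- c * (norm \<xi>)\<^sup>2) * exp (- c * (norm u)\<^sup>2)) * indicator (ball 0 1 - {0}) x \<le> ((Cb * S * k \<xi>) * k u) * indicator (ball 0 1 - {0}) x"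
      by (rule mult_right_mono) simp
    with b_le[of \<xi> u x] have "b \<xi> (u, x) \<le> ((Cb * S * k \<xi>) * k u) * indicator (ball 0 1 - {0}) x" by linarith
    then have "ennreal (b \<xi> (u, x)) \<le> ennreal (((Cb * S * k \<xi>) * k u) * indicator (ball 0 1 - {0}) x)" by (rule ennreal_leI)
    also have "\<dots> = ennreal (Cb * S * k \<xi>) * (ennreal (k u) * indicator (ball 0 1 - {0}) x)"
      using Cb S k_nonneg by (auto simp: indicator_def ennreal_mult)
    finally show ?thesis .
  qed
  have "(\<integral>\<^sup>+y. ennreal (b \<xi> y) * f (fst y) \<partial>lborel) = (\<integral>\<^sup>+u. \<integral>\<^sup>+x. ennreal (b \<xi> (u, x)) * f u \<partial>lborel \<partial>lborel)"
    by (subst nn_integral_vel_pair) auto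
  also have "\<dots> \<le> (\<integral>\<^sup>+u. \<integral>\<^sup>+(x::vel). ennreal (Cb * S * k \<xi>) * ((ennreal (k u) * f u) * indicator (ball 0 1 - {0}) x) \<partial>lborel \<partial>lborel)"
  proof (rule nn_integral_mono, rule nn_integral_mono)
    fix u x :: vel
    show "ennreal (b \<xi> (u, x)) * f u \<le> ennreal (Cb * S * k \<xi>) * ((ennreal (k u) * f u) * indicator (ball 0 1 - {0}) x)"
      using mult_right_mono[OF bb[of u x], of "f u"] by (simp add: mult_ac)
  qed
  also have "\<dots> = ennreal (Cb * S * k \<xi>) * ((\<integral>\<^sup>+u. ennreal (k u) * f u \<partial>lborel) * nsph (\<lambda>_. 1))"
    unfolding nsph_def by (simp add: nn_integral_cmult nn_integral_multc)
  also have "\<dots> = ennreal (Cb * S * unit_ball_vol 3 * k \<xi>) * (\<integral>\<^sup>+u. ennreal (k u) * f u \<partial>lborel)"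
    using Cb S k_nonneg by (simp add: nsph_one ennreal_mult mult_ac)
  finally show ?thesis unfolding S_def .
qed

lemma loss_compact: "compact_kernel b (\<lambda>\<xi> y. fst y)"
proof -
  obtain K where K: "K > 0" "\<And>x. k x \<le> K" "(\<integral>\<^sup>+x. ennreal (k x) \<partial>lborel) \<le> ennreal K" "(\<integral>\<^sup>+x. ennreal ((k x)\<^sup>2) \<partial>lborel) \<le> ennreal K"
    using k_bounds by blast
  define D where "D = Cb * (1 + sqrt (2 * \<bar>d\<bar>)) * unit_ball_vol 3"
  have D: "D \<ge> 0" using Cb by (simp add: D_def add_nonneg_nonneg)
  have il: "(\<integral>\<^sup>+y. ennreal (b \<xi> y) * f (fst y) \<partial>lborel) \<le> ennreal (D * k \<xi>) * (\<integral>\<^sup>+u. ennreal (k u) * f u \<partial>lborel)"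
    if "f \<in> borel_measurable borel" for f \<xi>
    unfolding D_def by (rule int_le[OF that])
  interpret schur_kernel b "\<lambda>\<xi> y. fst y" "D * K * K" "D * K * K"
  proof
    show "(\<lambda>(x, y). b x y) \<in> borel_measurable (borel \<Otimes>\<^sub>M borel)" by (rule b_meas)
    show "(\<lambda>(x::vel, y). fst y) \<in> borel_measurable (borel \<Otimes>\<^sub>M (borel :: (vel \<times> vel) measure))" by (rule fst_meas)
    show "b x y \<ge> 0" for x y by (rule b_nonneg)
    show "D * K * K \<ge> 0" using D K(1) by auto
    show "(\<integral>\<^sup>+y. ennreal (b x y) \<partial>lborel) \<le> ennreal (D * K * K)" for x
    proof -
      have "(\<integral>\<^sup>+y. ennreal (b x y) \<partial>lborel) \<le> ennreal (D * k x) * (\<integral>\<^sup>+u. ennreal (k u) \<partial>lborel)"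
        using il[of "\<lambda>_. 1" x] by simp
      also have "\<dots> \<le> ennreal (D * K) * ennreal K"
        using D K by (intro mult_mono ennreal_leI mult_left_mono) auto
      also have "\<dots> = ennreal (D * K * K)" using D K(1) by (intro ennreal_mult[symmetric]) auto
      finally show ?thesis .
    qed
    show "(\<integral>\<^sup>+x. \<integral>\<^sup>+y. ennreal (b x y) * f (fst y) \<partial>lborel \<partial>lborel) \<le> ennreal (D * K * K) * (\<integral>\<^sup>+x. f x \<partial>lborel)"
      if f [measurable]: "f \<in> borel_measurable borel" for f
    proof -
      have "(\<integral>\<^sup>+x. \<integral>\<^sup>+y. ennreal (b x y) * f (fst y) \<partial>lborel \<partial>lborel) \<le> (\<integral>\<^sup>+x. ennreal D * ennreal (k x) * (\<integral>\<^sup>+u. ennreal (k u) * f u \<partial>lborel) \<partial>lborel)"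
        using D k_nonneg by (intro nn_integral_mono order_trans[OF il]) (auto simp: ennreal_mult)
      also have "\<dots> = ennreal D * (\<integral>\<^sup>+x. ennreal (k x) \<partial>lborel) * (\<integral>\<^sup>+u. ennreal (k u) * f u \<partial>lborel)"
        by (simp add: nn_integral_multc nn_integral_cmult)
      also have "(\<integral>\<^sup>+u. ennreal (k u) * f u \<partial>lborel) \<le> (\<integral>\<^sup>+u. ennreal K * f u \<partial>lborel)"
        by (intro nn_integral_mono mult_right_mono ennreal_leI K) simp
      also have "\<dots> = ennreal K * (\<integral>\<^sup>+u. f u \<partial>lborel)" by (simp add: nn_integral_cmult)
      finally have "(\<integral>\<^sup>+x. \<integral>\<^sup>+y. ennreal (b x y) * f (fst y) \<partial>lborel \<partial>lborel) \<le> ennreal D * (\<integral>\<^sup>+x. ennreal (k x) \<partial>lborel) * (ennreal K * (\<integral>\<^sup>+u. f u \<partial>lborel))"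
        by (simp add: mult_left_mono)
      also have "\<dots> \<le> ennreal D * ennreal K * (ennreal K * (\<integral>\<^sup>+u. f u \<partial>lborel))"
        by (intro mult_right_mono mult_left_mono K) auto
      also have "\<dots> = ennreal (D * K * K) * (\<integral>\<^sup>+x. f x \<partial>lborel)"
        using D K(1) by (simp add: ennreal_mult mult_ac)
      finally show ?thesis .
    qed
  qed
  show ?thesis
  proof (rule compact_kernelI, goal_cases)
    case (1 e)
    show ?case
    proof (intro exI conjI)
      \<comment> \<open>No truncation is required: the whole weight is the main part and the
        remainder vanishes.\<close>
      show "UNIV \<in> sets (borel \<Otimes>\<^sub>M (borel :: (vel \<times> vel) measure))"
        by (metis sets.top space_borel space_pair_measure UNIV_Times_UNIV)
      show "(\<lambda>x. ennreal (D\<^sup>2 * K) * ennreal ((k x)\<^sup>2)) \<in> borel_measurable borel" by measurable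
      have "(\<integral>\<^sup>+x. ennreal (D\<^sup>2 * K) * ennreal ((k x)\<^sup>2) \<partial>lborel) = ennreal (D\<^sup>2 * K) * (\<integral>\<^sup>+x. ennreal ((k x)\<^sup>2) \<partial>lborel)"
        by (rule nn_integral_cmult) measurable
      also have "\<dots> \<le> ennreal (D\<^sup>2 * K) * ennreal K" by (intro mult_left_mono K) simp
      also have "\<dots> < \<infinity>" by (simp add: ennreal_mult_less_top)
      finally show "(\<integral>\<^sup>+x. ennreal (D\<^sup>2 * K) * ennreal ((k x)\<^sup>2) \<partial>lborel) < \<infinity>" .
      show "\<forall>x. (\<integral>\<^sup>+y. ennreal (b x y) * indicator (- UNIV) (x, y) \<partial>lborel) \<le> ennreal e" by simp
      show "\<forall>x. \<forall>f \<in> borel_measurable borel.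
         (\<integral>\<^sup>+y. ennreal (b x y) * indicator UNIV (x, y) * f (fst y) \<partial>lborel)\<^sup>2 \<le> (ennreal (D\<^sup>2 * K) * ennreal ((k x)\<^sup>2)) * (\<integral>\<^sup>+x. (f x)\<^sup>2 \<partial>lborel)"
      proof (intro allI ballI)
        fix x and f :: "vel \<Rightarrow> ennreal" assume f [measurable]: "f \<in> borel_measurable borel"
        have "(\<integral>\<^sup>+y. ennreal (b x y) * indicator UNIV (x, y) * f (fst y) \<partial>lborel) \<le> ennreal (D * k x) * (\<integral>\<^sup>+u. ennreal (k u) * f u \<partial>lborel)"
          using il[OF f, of x] by simp
        then have "(\<integral>\<^sup>+y. ennreal (b x y) * indicator UNIV (x, y) * f (fst y) \<partial>lborel)\<^sup>2 \<le> (ennreal (D * k x) * (\<integral>\<^sup>+u. ennreal (k u) * f u \<partial>lborel))\<^sup>2"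
          by (rule power_mono_ennreal)
        also have "\<dots> = (ennreal (D * k x))\<^sup>2 * (\<integral>\<^sup>+u. ennreal (k u) * f u \<partial>lborel)\<^sup>2" by (rule power_mult_distrib)
        also have "\<dots> \<le> (ennreal (D * k x))\<^sup>2 * ((\<integral>\<^sup>+u. (ennreal (k u))\<^sup>2 \<partial>lborel) * (\<integral>\<^sup>+u. (f u)\<^sup>2 \<partial>lborel))"
          by (intro mult_left_mono Cauchy_Schwarz_nn_integral) auto
        also have "(\<integral>\<^sup>+u. (ennreal (k u))\<^sup>2 \<partial>lborel) = (\<integral>\<^sup>+u. ennreal ((k u)\<^sup>2) \<partial>lborel)"
          by (simp add: ennreal_power k_nonneg)
        also have "(ennreal (D * k x))\<^sup>2 * ((\<integral>\<^sup>+u. ennreal ((k u)\<^sup>2) \<partial>lborel) * (\<integral>\<^sup>+u. (f u)\<^sup>2 \<partial>lborel)) \<le> (ennreal (D * k x))\<^sup>2 * (ennreal K * (\<integral>\<^sup>+u. (f u)\<^sup>2 \<partial>lborel))"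
          by (intro mult_left_mono mult_right_mono K) auto
        also have "\<dots> = (ennreal (D\<^sup>2 * K) * ennreal ((k x)\<^sup>2)) * (\<integral>\<^sup>+x. (f x)\<^sup>2 \<partial>lborel)"
          using D K(1) k_nonneg[of x] by (simp add: ennreal_power ennreal_mult power_mult_distrib mult_ac)
        finally show "(\<integral>\<^sup>+y. ennreal (b x y) * indicator UNIV (x, y) * f (fst y) \<partial>lborel)\<^sup>2 \<le> (ennreal (D\<^sup>2 * K) * ennreal ((k x)\<^sup>2)) * (\<integral>\<^sup>+x. (f x)\<^sup>2 \<partial>lborel)" .
      qed
    qed
  qed
qed

end

section \<open>The linearized collision operator\<close>

text \<open>The decomposition of kinetic energy into centre-of-mass and relative parts; the
  hypothesis makes the mixed terms cancel.\<close>

lemma two_body_energy: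
  fixes G z :: vel
  assumes "ma * q = mb * p"
  shows "ma * (norm (G + q *\<^sub>R z))\<^sup>2 + mb * (norm (G - p *\<^sub>R z))\<^sup>2 = (ma + mb) * (norm G)\<^sup>2 + (ma * q\<^sup>2 + mb * p\<^sup>2) * (norm z)\<^sup>2"
proof -
  have 1: "(norm (G + q *\<^sub>R z))\<^sup>2 = (norm G)\<^sup>2 + 2 * q * (G \<bullet> z) + q\<^sup>2 * (norm z)\<^sup>2" for q
    unfolding power2_norm_eq_inner by (simp add: inner_add_left inner_add_right inner_commute power2_eq_square algebra_simps)
  have 2: "(norm (G - p *\<^sub>R z))\<^sup>2 = (norm G)\<^sup>2 - 2 * p * (G \<bullet> z) + p\<^sup>2 * (norm z)\<^sup>2"
    using 1[of "- p"] by simp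
  have "ma * (2 * q * (G \<bullet> z)) = mb * (2 * p * (G \<bullet> z))" using assms by (simp add: mult.assoc[symmetric] mult.commute[of _ 2])
  then show ?thesis unfolding 1 2 by (simp add: algebra_simps)
qed

locale mixture =
  fixes s :: nat and r :: "nat \<Rightarrow> nat" and m nd :: "nat \<Rightarrow> real"
    and Ie phi :: "nat \<Rightarrow> nat \<Rightarrow> real"
    and sig :: "nat \<Rightarrow> nat \<Rightarrow> real \<Rightarrow> real \<Rightarrow> nat \<Rightarrow> nat \<Rightarrow> nat \<Rightarrow> nat \<Rightarrow> real"
    and Cm Cp :: real
  assumes m_pos: "\<And>\<alpha>. \<alpha> < s \<Longrightarrow> m \<alpha> > 0"
    and nd_pos: "\<And>\<alpha>. \<alpha> < s \<Longrightarrow> nd \<alpha> > 0"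
    and phi_pos: "\<And>\<alpha> i. \<alpha> < s \<Longrightarrow> i < r \<alpha> \<Longrightarrow> phi \<alpha> i > 0"
    and sig_meas: "\<And>\<alpha> \<beta> i j k l. \<alpha> < s \<Longrightarrow> \<beta> < s \<Longrightarrow> i < r \<alpha> \<Longrightarrow> k < r \<alpha> \<Longrightarrow>
        j < r \<beta> \<Longrightarrow> l < r \<beta> \<Longrightarrow>
        (\<lambda>p. sig \<alpha> \<beta> (fst p) (snd p) i j k l) \<in> borel_measurable (lborel :: (real \<times> real) measure)"
    and microrev: "\<And>\<alpha> \<beta> i j k l a b c. \<alpha> < s \<Longrightarrow> \<beta> < s \<Longrightarrow> i < r \<alpha> \<Longrightarrow> k < r \<alpha> \<Longrightarrow>
        j < r \<beta> \<Longrightarrow> l < r \<beta> \<Longrightarrow> a > 0 \<Longrightarrow> b > 0 \<Longrightarrow>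
        b\<^sup>2 = a\<^sup>2 - 2 * dItil m Ie \<alpha> \<beta> i j k l \<Longrightarrow> -1 \<le> c \<Longrightarrow> c \<le> 1 \<Longrightarrow>
        phi \<alpha> i * phi \<beta> j * a\<^sup>2 * sig \<alpha> \<beta> a c i j k l
          = phi \<alpha> k * phi \<beta> l * b\<^sup>2 * sig \<alpha> \<beta> b c k l i j"
    and Cm_pos: "0 < Cm" and Cm_le_Cp: "Cm \<le> Cp"
    and sig_bounds: "\<And>\<alpha> \<beta> i j k l a c. \<alpha> < s \<Longrightarrow> \<beta> < s \<Longrightarrow> i < r \<alpha> \<Longrightarrow> k < r \<alpha> \<Longrightarrow>
        j < r \<beta> \<Longrightarrow> l < r \<beta> \<Longrightarrow> a > 0 \<Longrightarrow> -1 \<le> c \<Longrightarrow> c \<le> 1 \<Longrightarrow>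
        a\<^sup>2 > 2 * dItil m Ie \<alpha> \<beta> i j k l \<Longrightarrow>
        Cm * sqrt (a\<^sup>2 - 2 * dItil m Ie \<alpha> \<beta> i j k l) / (a * phi \<alpha> i * phi \<beta> j)
          \<le> sig \<alpha> \<beta> a c i j k l
        \<and> sig \<alpha> \<beta> a c i j k l
          \<le> Cp * sqrt (a\<^sup>2 - 2 * dItil m Ie \<alpha> \<beta> i j k l) / (a * phi \<alpha> i * phi \<beta> j)"
begin

definition mx :: "nat \<Rightarrow> nat \<Rightarrow> vel \<Rightarrow> real" where "mx = maxw r m nd phi Ie"

definition amp :: "nat \<Rightarrow> nat \<Rightarrow> real" where
  "amp \<alpha> i = nd \<alpha> * phi \<alpha> i * m \<alpha> powr (3/2) / ((2 * pi) powr (3/2) * partfun r phi Ie \<alpha>) * exp (- Ie \<alpha> i)"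

lemma maxw_amp: "mx \<alpha> i v = amp \<alpha> i * exp (- (m \<alpha> / 2) * (norm v)\<^sup>2)"
proof -
  have "- m \<alpha> * (norm v)\<^sup>2 / 2 - Ie \<alpha> i = - Ie \<alpha> i + (- (m \<alpha> / 2) * (norm v)\<^sup>2)" by simp
  then show ?thesis unfolding mx_def maxw_def amp_def by (simp only: exp_add mult.assoc)
qed

lemma amp_pos:
  assumes "\<alpha> < s" "i < r \<alpha>"
  shows "amp \<alpha> i > 0"
proof -
  have "{..<r \<alpha>} \<noteq> {}" using assms(2) by auto
  then have "partfun r phi Ie \<alpha> > 0"
    unfolding partfun_def using phi_pos[OF assms(1)] by (intro sum_pos) auto
  then show ?thesis unfolding amp_def using nd_pos[OF assms(1)] phi_pos[OF assms] m_pos[OF assms(1)]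
    by (intro mult_pos_pos divide_pos_pos) auto
qed

lemma maxw_pos: "\<alpha> < s \<Longrightarrow> i < r \<alpha> \<Longrightarrow> mx \<alpha> i v > 0"
  unfolding maxw_amp using amp_pos by simp

lemma maxw_measurable [measurable]: "mx \<alpha> i \<in> borel_measurable borel"
  unfolding maxw_amp[abs_def] by measurable

lemma sqrt_maxw: "sqrt (mx \<alpha> i v) = sqrt (amp \<alpha> i) * exp (- (m \<alpha> / 4) * (norm v)\<^sup>2)"
proof -
  have "exp (- (m \<alpha> / 2) * (norm v)\<^sup>2) = (exp (- (m \<alpha> / 4) * (norm v)\<^sup>2))\<^sup>2"
    by (simp add: power2_eq_square exp_add[symmetric])
  then show ?thesis unfolding maxw_amp by (simp add: real_sqrt_mult)
qed

end

text \<open>One channel of the collision sum. All estimates are made per channel, and the finite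
  sums are taken at the end.\<close>

locale transition = mixture +
  fixes \<alpha> \<beta> i j k l :: nat
  assumes ok: "\<alpha> < s" "\<beta> < s" "i < r \<alpha>" "k < r \<alpha>" "j < r \<beta>" "l < r \<beta>"
begin

definition d where "d = dItil m Ie \<alpha> \<beta> i j k l"
definition p where "p = m \<alpha> / (m \<alpha> + m \<beta>)"
definition q where "q = m \<beta> / (m \<alpha> + m \<beta>)"
text \<open>The square root of a Maxwellian decays at rate m/4; the smaller mass gives one rate
  valid for both species.\<close>

definition c where "c = min (m \<alpha>) (m \<beta>) / 4"

lemma mm: "m \<alpha> > 0" "m \<beta> > 0" using ok m_pos by auto

lemma pq: "p > 0" "q > 0" "p + q = 1"
  using mm by (auto simp: p_def q_def add_divide_distrib[symmetric])

lemma mq: "m \<alpha> * q = m \<beta> * p" by (simp add: p_def q_def)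

lemma c_pos: "c > 0" using mm by (simp add: c_def)

lemma phis: "phi \<alpha> i > 0" "phi \<beta> j > 0" "phi \<alpha> k > 0" "phi \<beta> l > 0" using ok phi_pos by auto

text \<open>Both post-collisional velocities in one formula: the first is \<open>V q\<close>, the
  second \<open>V (- p)\<close>.\<close>

definition V :: "real \<Rightarrow> vel \<Rightarrow> vel \<times> vel \<Rightarrow> vel" where
  "V \<tau> \<xi> y = \<xi> - q *\<^sub>R (\<xi> - fst y) + (\<tau> * rho d (\<xi> - fst y)) *\<^sub>R (snd y /\<^sub>R norm (snd y))"

text \<open>The kernel of \<^const>\<open>collint\<close> after the Dirac deltas have been integrated out, including the
  factor 3 of \<^const>\<open>sphere_int\<close>.\<close>

definition w :: "vel \<Rightarrow> vel \<times> vel \<Rightarrow> real" where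
  "w \<xi> y = (if \<xi> \<noteq> fst y \<and> (norm (\<xi> - fst y))\<^sup>2 > 2 * d \<and> snd y \<in> ball 0 1 - {0} then
     3 * (phi \<alpha> k * phi \<beta> l * (sig \<alpha> \<beta> (rho d (\<xi> - fst y)) (((\<xi> - fst y) \<bullet> (snd y /\<^sub>R norm (snd y))) / norm (\<xi> - fst y)) k l i j
       * (rho d (\<xi> - fst y))\<^sup>2 / norm (\<xi> - fst y))) else 0)"

lemma V_measurable [measurable (raw)]:
  assumes [measurable]: "f \<in> borel_measurable M" "g \<in> borel_measurable M" "h \<in> borel_measurable M"
  shows "(\<lambda>x. V \<tau> (f x) (g x, h x)) \<in> borel_measurable M"
  unfolding V_def by measurable

lemma sig_measurable [measurable (raw)]:
  assumes [measurable]: "f \<in> borel_measurable M" "g \<in> borel_measurable M"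
  shows "(\<lambda>x. sig \<alpha> \<beta> (f x) (g x) k l i j) \<in> borel_measurable M"
proof -
  have "(\<lambda>p. sig \<alpha> \<beta> (fst p) (snd p) k l i j) \<in> borel_measurable (borel \<Otimes>\<^sub>M borel)"
    using sig_meas[of \<alpha> \<beta> k i l j] ok by (simp add: borel_prod)
  from measurable_compose[OF _ this, of "\<lambda>x. (f x, g x)" M] show ?thesis by simp
qed

lemma w_measurable [measurable (raw)]:
  assumes [measurable]: "f \<in> borel_measurable M" "g \<in> borel_measurable M" "h \<in> borel_measurable M"
  shows "(\<lambda>x. w (f x) (g x, h x)) \<in> borel_measurable M"
  unfolding w_def by measurable

text \<open>The weight contains the cross section of the inverse transition at the outgoing speed.
  Microreversibility rewrites phi_k phi_l rho^2 sigma_{kl,ij} / |g| as phi_i phi_j |g|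
  sigma_{ij,kl}, to which the assumed bounds apply; everything except rho then cancels. The 3 is the
  normalization of the sphere integral.\<close>

lemma w_bounds:
  assumes "\<xi> \<noteq> fst y" "(norm (\<xi> - fst y))\<^sup>2 > 2 * d" "snd y \<in> ball 0 1 - {0}"
  shows "3 * Cm * rho d (\<xi> - fst y) \<le> w \<xi> y \<and> w \<xi> y \<le> 3 * Cp * rho d (\<xi> - fst y)"
proof -
  define a where "a = norm (\<xi> - fst y)"
  define b where "b = rho d (\<xi> - fst y)"
  define \<omega> where "\<omega> = snd y /\<^sub>R norm (snd y)"
  define t where "t = ((\<xi> - fst y) \<bullet> \<omega>) / a"
  have a: "a > 0" using assms(1) by (simp add: a_def)
  have b2: "b\<^sup>2 = a\<^sup>2 - 2 * d" and b: "b > 0" and bs: "b = sqrt (a\<^sup>2 - 2 * d)"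
    using assms(2) by (auto simp: b_def a_def rho_def max_def)
  have "norm \<omega> = 1" using assms(3) by (simp add: \<omega>_def)
  then have "\<bar>t\<bar> \<le> 1"
    using Cauchy_Schwarz_ineq2[of "\<xi> - fst y" \<omega>] a by (simp add: t_def a_def abs_divide)
  then have t: "-1 \<le> t" "t \<le> 1" by auto
  have mr: "phi \<alpha> i * phi \<beta> j * a\<^sup>2 * sig \<alpha> \<beta> a t i j k l = phi \<alpha> k * phi \<beta> l * b\<^sup>2 * sig \<alpha> \<beta> b t k l i j"
    by (rule microrev) (use ok a b t b2 in \<open>auto simp: d_def\<close>)
  have weq: "w \<xi> y = 3 * (phi \<alpha> i * phi \<beta> j * a * sig \<alpha> \<beta> a t i j k l)"
  proof -
    have "w \<xi> y = 3 * ((phi \<alpha> k * phi \<beta> l * b\<^sup>2 * sig \<alpha> \<beta> b t k l i j) / a)"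
      using assms unfolding w_def by (simp add: b_def a_def t_def \<omega>_def)
    also have "\<dots> = 3 * (phi \<alpha> i * phi \<beta> j * a * sig \<alpha> \<beta> a t i j k l)"
      unfolding mr[symmetric] using a by (simp add: power2_eq_square)
    finally show ?thesis .
  qed
  have sb: "Cm * b / (a * phi \<alpha> i * phi \<beta> j) \<le> sig \<alpha> \<beta> a t i j k l" "sig \<alpha> \<beta> a t i j k l \<le> Cp * b / (a * phi \<alpha> i * phi \<beta> j)"
    using sig_bounds[of \<alpha> \<beta> i k j l a t] ok a t b2 b unfolding bs d_def by (auto simp: zero_less_power2)
  have pp: "a * phi \<alpha> i * phi \<beta> j > 0" using a phis by simp
  from sb have "Cm * b \<le> phi \<alpha> i * phi \<beta> j * a * sig \<alpha> \<beta> a t i j k l" "phi \<alpha> i * phi \<beta> j * a * sig \<alpha> \<beta> a t i j k l \<le> Cp * b"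
    using pp by (simp_all add: pos_divide_le_eq pos_le_divide_eq mult_ac)
  then show ?thesis unfolding weq b_def by simp
qed

lemma Cp_pos: "Cp > 0" using Cm_pos Cm_le_Cp by linarith

lemma w_nonneg: "w \<xi> y \<ge> 0"
proof (cases "\<xi> \<noteq> fst y \<and> (norm (\<xi> - fst y))\<^sup>2 > 2 * d \<and> snd y \<in> ball 0 1 - {0}")
  case True
  have "0 \<le> 3 * Cm * rho d (\<xi> - fst y)" using Cm_pos by simp
  then show ?thesis using w_bounds[of \<xi> y] True by linarith
next
  case False then show ?thesis unfolding w_def by (simp only: if_False order.refl)
qed

lemma w_le: "w \<xi> (\<xi>s, x) \<le> 3 * Cp * rho d (\<xi> - \<xi>s) * indicator (ball 0 1 - {0}) x"
proof (cases "\<xi> \<noteq> \<xi>s \<and> (norm (\<xi> - \<xi>s))\<^sup>2 > 2 * d \<and> x \<in> ball 0 1 - {0}")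
  case True
  then show ?thesis using w_bounds[of \<xi> "(\<xi>s, x)"] by simp
next
  case False
  then have "w \<xi> (\<xi>s, x) = 0" unfolding w_def fst_conv snd_conv by (simp only: if_False)
  then show ?thesis using Cp_pos by simp
qed

text \<open>The centre of mass is rewritten as \<xi> - q (\<xi> - \<xi>s). The integrands agree
  except perhaps at x = 0, which \<open>w\<close> excludes and \<open>sphere_int\<close> does
  not.\<close>

lemma collint_w:
  assumes [measurable]: "(\<lambda>(u, v). F u v) \<in> borel_measurable (borel \<Otimes>\<^sub>M borel)"
  shows "collint m Ie phi sig \<alpha> \<beta> i j k l \<xi> \<xi>s F = (LINT x|lborel. w \<xi> (\<xi>s, x) * F (V q \<xi> (\<xi>s, x)) (V (- p) \<xi> (\<xi>s, x)))"
proof -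
  define g where "g = \<xi> - \<xi>s"
  define G where "G = (1 / (m \<alpha> + m \<beta>)) *\<^sub>R (m \<alpha> *\<^sub>R \<xi> + m \<beta> *\<^sub>R \<xi>s)"
  have G: "G = \<xi> - q *\<^sub>R (\<xi> - \<xi>s)"
  proof -
    have "\<xi> - q *\<^sub>R (\<xi> - \<xi>s) = p *\<^sub>R \<xi> + q *\<^sub>R \<xi>s"
    proof -
      have p1: "p = 1 - q" using pq by simp
      show ?thesis unfolding p1 by (simp add: algebra_simps)
    qed
    then show ?thesis unfolding G_def p_def q_def by (simp add: scaleR_add_right)
  qed
  show ?thesis
  proof (cases "g \<noteq> 0 \<and> (norm g)\<^sup>2 > 2 * d")
    case False
    then have "w \<xi> (\<xi>s, x) = 0" for x unfolding w_def g_def by auto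
    moreover have "collint m Ie phi sig \<alpha> \<beta> i j k l \<xi> \<xi>s F = 0"
      using False unfolding collint_def Let_def g_def d_def by (simp only: if_False)
    ultimately show ?thesis by simp
  next
    case True
    have rr: "sqrt ((norm g)\<^sup>2 - 2 * d) = rho d g" using True by (simp add: rho_def max_def)
    define H where "H \<omega> = sig \<alpha> \<beta> (rho d g) ((g \<bullet> \<omega>) / norm g) k l i j * (rho d g)\<^sup>2 / norm g
        * F (G + (q * rho d g) *\<^sub>R \<omega>) (G - (p * rho d g) *\<^sub>R \<omega>)" for \<omega>
    have "collint m Ie phi sig \<alpha> \<beta> i j k l \<xi> \<xi>s F = phi \<alpha> k * phi \<beta> l * sphere_int H"
      using True rr unfolding collint_def Let_def g_def[symmetric] d_def[symmetric] G_def[symmetric] p_def[symmetric] q_def[symmetric] H_def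
      by simp
    also have "\<dots> = (LINT x|lborel. phi \<alpha> k * phi \<beta> l * 3 * (indicator (ball 0 1) x * H (x /\<^sub>R norm x)))"
      unfolding sphere_int_def set_lebesgue_integral_def by simp
    also have "\<dots> = (LINT x|lborel. w \<xi> (\<xi>s, x) * F (V q \<xi> (\<xi>s, x)) (V (- p) \<xi> (\<xi>s, x)))"
    proof (rule integral_cong_AE)
      show "(\<lambda>x. phi \<alpha> k * phi \<beta> l * 3 * (indicator (ball 0 1) x * H (x /\<^sub>R norm x))) \<in> borel_measurable lborel"
        unfolding H_def by measurable
      show "(\<lambda>x. w \<xi> (\<xi>s, x) * F (V q \<xi> (\<xi>s, x)) (V (- p) \<xi> (\<xi>s, x))) \<in> borel_measurable lborel"
        by measurable
      show "AE x in lborel. phi \<alpha> k * phi \<beta> l * 3 * (indicator (ball 0 1) x * H (x /\<^sub>R norm x))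
         = w \<xi> (\<xi>s, x) * F (V q \<xi> (\<xi>s, x)) (V (- p) \<xi> (\<xi>s, x))"
        using AE_lborel_singleton[of "0::vel"]
      proof eventually_elim
        case (elim x)
        show ?case
        proof (cases "x \<in> ball 0 1")
          case False
          then show ?thesis by (simp add: w_def)
        next
          case x: True
          have V: "V q \<xi> (\<xi>s, x) = G + (q * rho d g) *\<^sub>R (x /\<^sub>R norm x)" "V (- p) \<xi> (\<xi>s, x) = G - (p * rho d g) *\<^sub>R (x /\<^sub>R norm x)"
            unfolding V_def G g_def by simp_all
          have "w \<xi> (\<xi>s, x) = 3 * (phi \<alpha> k * phi \<beta> l * (sig \<alpha> \<beta> (rho d g) ((g \<bullet> (x /\<^sub>R norm x)) / norm g) k l i j * (rho d g)\<^sup>2 / norm g))"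
            unfolding w_def fst_conv snd_conv g_def[symmetric] using True x elim by (auto simp: g_def)
          then show ?thesis unfolding V H_def using x by simp
        qed
      qed
    qed
    finally show ?thesis .
  qed
qed

section \<open>The two gain kernels and the loss kernel of one channel\<close>

definition Phi where "Phi = phi \<alpha> i * phi \<beta> j * phi \<alpha> k * phi \<beta> l"

lemma Phi_pos: "Phi > 0" unfolding Phi_def using phis by simp

text \<open>Dividing \<open>h\<close> by the square root of its own Maxwellian cancels one of the
  three factors under the root. \<open>b1\<close> belongs to the loss term, \<open>b2\<close> and
  \<open>b3\<close> to the gain terms at the first and second post-collisional velocity.\<close>

definition b1 where "b1 \<xi> y = w \<xi> y * sqrt (mx \<alpha> k (V q \<xi> y) * mx \<beta> l (V (- p) \<xi> y) / Phi)"
definition b2 where "b2 \<xi> y = w \<xi> y * sqrt (mx \<beta> j (fst y) * mx \<beta> l (V (- p) \<xi> y) / Phi)"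
definition b3 where "b3 \<xi> y = w \<xi> y * sqrt (mx \<beta> j (fst y) * mx \<alpha> k (V q \<xi> y) / Phi)"

lemma mx_nonneg [simp]: "mx \<alpha> k v \<ge> 0" "mx \<beta> l v \<ge> 0" "mx \<beta> j v \<ge> 0" "mx \<alpha> i v \<ge> 0"
  using maxw_pos ok by (auto intro: less_imp_le)

lemma b_nonneg: "b1 \<xi> y \<ge> 0" "b2 \<xi> y \<ge> 0" "b3 \<xi> y \<ge> 0"
  unfolding b1_def b2_def b3_def using w_nonneg Phi_pos by simp_all

lemma meas_pair3:
  assumes "(\<lambda>(x, y, z). f x (y, z)) \<in> borel_measurable (borel \<Otimes>\<^sub>M (borel \<Otimes>\<^sub>M borel))"
  shows "(\<lambda>(x, y). f x y) \<in> borel_measurable (borel \<Otimes>\<^sub>M (borel :: ('a::second_countable_topology \<times> 'b::second_countable_topology) measure))"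
proof -
  have "(\<lambda>(x, y). f x y) = (\<lambda>(x, y, z). f x (y, z))" by auto
  then show ?thesis using assms by (simp add: borel_prod)
qed

lemma b_measurable:
  "(\<lambda>(x, y). b1 x y) \<in> borel_measurable (borel \<Otimes>\<^sub>M borel)"
  "(\<lambda>(x, y). b2 x y) \<in> borel_measurable (borel \<Otimes>\<^sub>M borel)"
  "(\<lambda>(x, y). b3 x y) \<in> borel_measurable (borel \<Otimes>\<^sub>M borel)"
proof -
  show "(\<lambda>(x, y). b1 x y) \<in> borel_measurable (borel \<Otimes>\<^sub>M borel)"
    by (rule meas_pair3) (unfold b1_def fst_conv, measurable)
  show "(\<lambda>(x, y). b2 x y) \<in> borel_measurable (borel \<Otimes>\<^sub>M borel)"
    by (rule meas_pair3) (unfold b2_def fst_conv, measurable)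
  show "(\<lambda>(x, y). b3 x y) \<in> borel_measurable (borel \<Otimes>\<^sub>M borel)"
    by (rule meas_pair3) (unfold b3_def fst_conv, measurable)
qed

lemma sqrt_prod_le:
  assumes "e1 \<le> C1" "e2 \<le> C2" "0 \<le> e1" "0 \<le> e2" "0 \<le> A"
  shows "A * (e1 * e2) \<le> A * (C1 * (C2::real))"
  using assms by (intro mult_left_mono mult_mono) auto

lemma exp_c_le: "exp (- (m \<alpha> / 4) * (norm v)\<^sup>2) \<le> exp (- c * (norm (v::vel))\<^sup>2)" "exp (- (m \<beta> / 4) * (norm v)\<^sup>2) \<le> exp (- c * (norm v)\<^sup>2)"
  unfolding c_def by (auto intro!: mult_right_mono)

text \<open>The surviving Maxwellian sits at \<open>V (- p)\<close>, which is the partner velocity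
  of the gain locale because q - 1 = - p. For \<open>gain3\<close> the corresponding identity is - p
  + 1 = q.\<close>

lemma gain2: "compact_kernel b2 (V q)"
proof -
  define A where "A = sqrt (amp \<beta> j) * sqrt (amp \<beta> l) / sqrt Phi"
  have A: "A \<ge> 0" using amp_pos ok Phi_pos by (simp add: A_def less_imp_le)
  interpret gain p q q 1 d c "3 * Cp * A" b2
  proof
    show "b2 \<xi> (\<xi>s, x) \<le> 3 * Cp * A * rho d (\<xi> - \<xi>s) * exp (- c * (norm \<xi>s)\<^sup>2)
       * exp (- c * (norm (\<xi> - q *\<^sub>R (\<xi> - \<xi>s) + ((q - 1) * rho d (\<xi> - \<xi>s)) *\<^sub>R (x /\<^sub>R norm x)))\<^sup>2) * indicator (ball 0 1 - {0}) x" for \<xi> \<xi>s x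
    proof -
      have p1: "- p = q - 1" using pq by simp
      have "b2 \<xi> (\<xi>s, x) = w \<xi> (\<xi>s, x) * (A * (exp (- (m \<beta> / 4) * (norm \<xi>s)\<^sup>2) * exp (- (m \<beta> / 4) * (norm (V (- p) \<xi> (\<xi>s, x)))\<^sup>2)))"
        unfolding b2_def A_def by (simp add: real_sqrt_mult real_sqrt_divide sqrt_maxw)
      also have "\<dots> \<le> w \<xi> (\<xi>s, x) * (A * (exp (- c * (norm \<xi>s)\<^sup>2) * exp (- c * (norm (V (- p) \<xi> (\<xi>s, x)))\<^sup>2)))"
        by (intro mult_left_mono sqrt_prod_le exp_c_le A w_nonneg) auto
      also have "\<dots> \<le> (3 * Cp * rho d (\<xi> - \<xi>s) * indicator (ball 0 1 - {0}) x) * (A * (exp (- c * (norm \<xi>s)\<^sup>2) * exp (- c * (norm (V (- p) \<xi> (\<xi>s, x)))\<^sup>2)))"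
        using A by (intro mult_right_mono w_le) auto
      finally show ?thesis unfolding V_def p1 fst_conv snd_conv by (simp only: mult_ac)
    qed
  qed (use pq c_pos A Cp_pos b_nonneg b_measurable in auto)
  have "Z = V q" by (intro ext) (simp add: Z_def V_def)
  then show ?thesis using gain_compact by simp
qed

lemma gain3: "compact_kernel b3 (V (- p))"
proof -
  define A where "A = sqrt (amp \<beta> j) * sqrt (amp \<alpha> k) / sqrt Phi"
  have A: "A \<ge> 0" using amp_pos ok Phi_pos by (simp add: A_def less_imp_le)
  interpret gain p q "- p" "- 1" d c "3 * Cp * A" b3
  proof
    show "b3 \<xi> (\<xi>s, x) \<le> 3 * Cp * A * rho d (\<xi> - \<xi>s) * exp (- c * (norm \<xi>s)\<^sup>2)
       * exp (- c * (norm (\<xi> - q *\<^sub>R (\<xi> - \<xi>s) + ((- p - - 1) * rho d (\<xi> - \<xi>s)) *\<^sub>R (x /\<^sub>R norm x)))\<^sup>2) * indicator (ball 0 1 - {0}) x" for \<xi> \<xi>s x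
    proof -
      have p1: "- p - - 1 = q" using pq by simp
      have "b3 \<xi> (\<xi>s, x) = w \<xi> (\<xi>s, x) * (A * (exp (- (m \<beta> / 4) * (norm \<xi>s)\<^sup>2) * exp (- (m \<alpha> / 4) * (norm (V q \<xi> (\<xi>s, x)))\<^sup>2)))"
        unfolding b3_def A_def by (simp add: real_sqrt_mult real_sqrt_divide sqrt_maxw)
      also have "\<dots> \<le> w \<xi> (\<xi>s, x) * (A * (exp (- c * (norm \<xi>s)\<^sup>2) * exp (- c * (norm (V q \<xi> (\<xi>s, x)))\<^sup>2)))"
        by (intro mult_left_mono sqrt_prod_le exp_c_le A w_nonneg) auto
      also have "\<dots> \<le> (3 * Cp * rho d (\<xi> - \<xi>s) * indicator (ball 0 1 - {0}) x) * (A * (exp (- c * (norm \<xi>s)\<^sup>2) * exp (- c * (norm (V q \<xi> (\<xi>s, x)))\<^sup>2)))"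
        using A by (intro mult_right_mono w_le) auto
      finally show ?thesis unfolding V_def p1 fst_conv snd_conv by (simp only: mult_ac)
    qed
  qed (use pq c_pos A Cp_pos b_nonneg b_measurable in auto)
  have "Z = V (- p)" by (intro ext) (simp add: Z_def V_def)
  then show ?thesis using gain_compact by simp
qed

text \<open>The coefficient of \<open>2 * d\<close> is the reduced mass, by whose inverse the energy
  gap was scaled in \<open>dItil\<close>; the last term is twice the unscaled gap.\<close>

lemma energy:
  assumes "(norm (\<xi> - fst y))\<^sup>2 > 2 * d" "snd y \<noteq> 0"
  shows "m \<alpha> * (norm (V q \<xi> y))\<^sup>2 + m \<beta> * (norm (V (- p) \<xi> y))\<^sup>2
    = m \<alpha> * (norm \<xi>)\<^sup>2 + m \<beta> * (norm (fst y))\<^sup>2 - (m \<alpha> * q\<^sup>2 + m \<beta> * p\<^sup>2) * (2 * d)"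
proof -
  define g where "g = \<xi> - fst y"
  define G where "G = \<xi> - q *\<^sub>R g"
  define z where "z = rho d g *\<^sub>R (snd y /\<^sub>R norm (snd y))"
  have V: "V q \<xi> y = G + q *\<^sub>R z" "V (- p) \<xi> y = G - p *\<^sub>R z" by (simp_all add: V_def G_def z_def g_def)
  have "(1 - q) = p" using pq by simp
  have x: "\<xi> = G + q *\<^sub>R g" "fst y = G - p *\<^sub>R g"
    unfolding G_def \<open>1 - q = p\<close>[symmetric] by (simp_all add: g_def algebra_simps)
  have z: "(norm z)\<^sup>2 = (norm g)\<^sup>2 - 2 * d"
  proof -
    have "norm (snd y /\<^sub>R norm (snd y)) = 1" using assms(2) by simp
    then have "norm z = rho d g" unfolding z_def norm_scaleR by simp
    then show ?thesis using assms(1) by (simp add: g_def rho_def max_def)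
  qed
  have "m \<alpha> * (norm (V q \<xi> y))\<^sup>2 + m \<beta> * (norm (V (- p) \<xi> y))\<^sup>2 = (m \<alpha> + m \<beta>) * (norm G)\<^sup>2 + (m \<alpha> * q\<^sup>2 + m \<beta> * p\<^sup>2) * (norm z)\<^sup>2"
    unfolding V by (rule two_body_energy[OF mq])
  moreover have "m \<alpha> * (norm \<xi>)\<^sup>2 + m \<beta> * (norm (fst y))\<^sup>2 = (m \<alpha> + m \<beta>) * (norm G)\<^sup>2 + (m \<alpha> * q\<^sup>2 + m \<beta> * p\<^sup>2) * (norm g)\<^sup>2"
    using two_body_energy[OF mq, of G g] x by simp
  ultimately show ?thesis unfolding z by (simp add: algebra_simps)
qed

text \<open>Conservation of energy replaces the outgoing Gaussians by incoming ones. The constant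
  \<open>D\<close> is the exponential of the internal energy gap, weighted by the 1/4 in the
  rates.\<close>

lemma loss1: "compact_kernel b1 (\<lambda>\<xi> y. fst y)"
proof -
  define A where "A = sqrt (amp \<alpha> k) * sqrt (amp \<beta> l) / sqrt Phi"
  have A: "A \<ge> 0" using amp_pos ok Phi_pos by (simp add: A_def less_imp_le)
  define D where "D = exp ((m \<alpha> * q\<^sup>2 + m \<beta> * p\<^sup>2) * d / 2)"
  interpret loss d c "3 * Cp * A * D" b1
  proof
    show "b1 \<xi> (\<xi>s, x) \<le> 3 * Cp * A * D * rho d (\<xi> - \<xi>s) * exp (- c * (norm \<xi>)\<^sup>2) * exp (- c * (norm \<xi>s)\<^sup>2) * indicator (ball 0 1 - {0}) x" for \<xi> \<xi>s x
    proof (cases "(norm (\<xi> - \<xi>s))\<^sup>2 > 2 * d \<and> x \<noteq> 0")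
      case False
      then have "w \<xi> (\<xi>s, x) = 0" unfolding w_def by auto
      then have "b1 \<xi> (\<xi>s, x) = 0" by (simp add: b1_def)
      then show ?thesis using A Cp_pos by (simp add: D_def)
    next
      case True
      have "b1 \<xi> (\<xi>s, x) = w \<xi> (\<xi>s, x) * (A * (exp (- (m \<alpha> / 4) * (norm (V q \<xi> (\<xi>s, x)))\<^sup>2) * exp (- (m \<beta> / 4) * (norm (V (- p) \<xi> (\<xi>s, x)))\<^sup>2)))"
        unfolding b1_def A_def by (simp add: real_sqrt_mult real_sqrt_divide sqrt_maxw)
      also have "exp (- (m \<alpha> / 4) * (norm (V q \<xi> (\<xi>s, x)))\<^sup>2) * exp (- (m \<beta> / 4) * (norm (V (- p) \<xi> (\<xi>s, x)))\<^sup>2)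
        = exp (- (1/4) * (m \<alpha> * (norm (V q \<xi> (\<xi>s, x)))\<^sup>2 + m \<beta> * (norm (V (- p) \<xi> (\<xi>s, x)))\<^sup>2))"
        unfolding exp_add[symmetric] by (simp add: algebra_simps)
      also have "\<dots> = exp (- (1/4) * (m \<alpha> * (norm \<xi>)\<^sup>2 + m \<beta> * (norm \<xi>s)\<^sup>2 - (m \<alpha> * q\<^sup>2 + m \<beta> * p\<^sup>2) * (2 * d)))"
        using True by (subst energy) auto
      also have "\<dots> = D * (exp (- (m \<alpha> / 4) * (norm \<xi>)\<^sup>2) * exp (- (m \<beta> / 4) * (norm \<xi>s)\<^sup>2))"
        unfolding D_def exp_add[symmetric] by (simp add: algebra_simps)
      also have "w \<xi> (\<xi>s, x) * (A * (D * (exp (- (m \<alpha> / 4) * (norm \<xi>)\<^sup>2) * exp (- (m \<beta> / 4) * (norm \<xi>s)\<^sup>2))))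
        \<le> w \<xi> (\<xi>s, x) * (A * (D * (exp (- c * (norm \<xi>)\<^sup>2) * exp (- c * (norm \<xi>s)\<^sup>2))))"
        by (intro mult_left_mono[OF mult_left_mono[OF sqrt_prod_le]] exp_c_le A w_nonneg) (auto simp: D_def)
      also have "\<dots> \<le> (3 * Cp * rho d (\<xi> - \<xi>s) * indicator (ball 0 1 - {0}) x) * (A * (D * (exp (- c * (norm \<xi>)\<^sup>2) * exp (- c * (norm \<xi>s)\<^sup>2))))"
        using A by (intro mult_right_mono w_le) (auto simp: D_def)
      finally show ?thesis by (simp only: mult_ac)
    qed
  qed (use c_pos A Cp_pos b_nonneg b_measurable in \<open>auto simp: D_def\<close>)
  show ?thesis by (rule loss_compact)
qed

end

section \<open>From the channels to the operator \<open>K\<close>\<close>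

context mixture
begin

text \<open>The three places where \<open>h\<close> enters receive independent arguments; in the
  full operator they are different components of one \<open>h\<close>.\<close>

definition termop :: "nat \<Rightarrow> nat \<Rightarrow> nat \<Rightarrow> nat \<Rightarrow> nat \<Rightarrow> nat \<Rightarrow> (vel \<Rightarrow> real) \<Rightarrow> (vel \<Rightarrow> real) \<Rightarrow> (vel \<Rightarrow> real) \<Rightarrow> vel \<Rightarrow> real" where
  "termop \<alpha> \<beta> i j k l hk hl hj \<xi> = (LINT \<xi>s | lborel. collint m Ie phi sig \<alpha> \<beta> i j k l \<xi> \<xi>s
          (\<lambda>\<xi>' \<xi>s'. (hk \<xi>' / sqrt (mx \<alpha> k \<xi>') + hl \<xi>s' / sqrt (mx \<beta> l \<xi>s') - hj \<xi>s / sqrt (mx \<beta> j \<xi>s))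
             * sqrt (mx \<beta> j \<xi>s * mx \<alpha> k \<xi>' * mx \<beta> l \<xi>s' / (phi \<alpha> i * phi \<beta> j * phi \<alpha> k * phi \<beta> l))))"

lemma Kop_termop:
  "Kop s r m nd phi Ie sig h \<alpha> i \<xi> = (\<Sum>\<beta><s. \<Sum>k<r \<alpha>. \<Sum>j<r \<beta>. \<Sum>l<r \<beta>. termop \<alpha> \<beta> i j k l (h \<alpha> k) (h \<beta> l) (h \<beta> j) \<xi>)"
  unfolding Kop_def termop_def mx_def Let_def ..

end

context transition
begin

definition F where
  "F hk hl hj \<xi> y = w \<xi> y * ((hk (V q \<xi> y) / sqrt (mx \<alpha> k (V q \<xi> y)) + hl (V (- p) \<xi> y) / sqrt (mx \<beta> l (V (- p) \<xi> y)) - hj (fst y) / sqrt (mx \<beta> j (fst y)))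
      * sqrt (mx \<beta> j (fst y) * mx \<alpha> k (V q \<xi> y) * mx \<beta> l (V (- p) \<xi> y) / Phi))"

lemma F_eq: "F hk hl hj \<xi> y = b2 \<xi> y * hk (V q \<xi> y) + b3 \<xi> y * hl (V (- p) \<xi> y) - b1 \<xi> y * hj (fst y)"
proof -
  have "mx \<alpha> k (V q \<xi> y) > 0" "mx \<beta> l (V (- p) \<xi> y) > 0" "mx \<beta> j (fst y) > 0"
    using maxw_pos ok by auto
  moreover have "Phi > 0" by (rule Phi_pos)
  \<comment> \<open>Pure algebra, with \<open>A\<close>, \<open>B\<close>, \<open>C\<close>,
    \<open>P\<close> standing for the square roots of the three Maxwellians and of the product of
    weights.\<close>
  moreover have "W * ((x / A + z / B - t / C) * (C * A * B / P)) = W * (C * B / P) * x + W * (C * A / P) * z - W * (A * B / P) * t"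
    if "A > 0" "B > 0" "C > 0" "P > 0" for W x z t A B C P :: real
    using that by (simp add: field_simps)
  ultimately show ?thesis
    unfolding F_def b1_def b2_def b3_def real_sqrt_mult real_sqrt_divide by simp
qed

lemma termop_F:
  assumes [measurable]: "hk \<in> borel_measurable borel" "hl \<in> borel_measurable borel" "hj \<in> borel_measurable borel"
  shows "termop \<alpha> \<beta> i j k l hk hl hj \<xi> = (LINT \<xi>s|lborel. LINT x|lborel. F hk hl hj \<xi> (\<xi>s, x))"
  unfolding termop_def F_def fst_conv Phi_def by (subst collint_w) auto

lemma F_measurable [measurable (raw)]:
  assumes [measurable]: "f \<in> borel_measurable M" "g \<in> borel_measurable M" "h \<in> borel_measurable M"
    and [measurable]: "hk \<in> borel_measurable borel" "hl \<in> borel_measurable borel" "hj \<in> borel_measurable borel"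
  shows "(\<lambda>x. F hk hl hj (f x) (g x, h x)) \<in> borel_measurable M"
  unfolding F_def fst_conv by measurable

lemma termop_measurable [measurable]:
  assumes [measurable]: "hk \<in> borel_measurable borel" "hl \<in> borel_measurable borel" "hj \<in> borel_measurable borel"
  shows "termop \<alpha> \<beta> i j k l hk hl hj \<in> borel_measurable borel"
proof -
  have "termop \<alpha> \<beta> i j k l hk hl hj = (\<lambda>\<xi>. LINT \<xi>s|lborel. LINT x|lborel. F hk hl hj \<xi> (\<xi>s, x))"
    by (rule ext, rule termop_F) measurable
  then show ?thesis by simp
qed

text \<open>At almost every \<open>\<xi>\<close> the three integrands are separately integrable.
  Only there may the integral be split, and only there does Fubini join the iterated integral over
  \<open>\<xi>s\<close> and the direction into one over pairs.\<close>

lemma termop_AE: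
  assumes h: "L2fun hk" "L2fun hl" "L2fun hj"
  shows "AE \<xi> in lborel. (LINT y|lborel. b2 \<xi> y * hk (V q \<xi> y)) + (LINT y|lborel. b3 \<xi> y * hl (V (- p) \<xi> y)) - (LINT y|lborel. b1 \<xi> y * hj (fst y))
     = termop \<alpha> \<beta> i j k l hk hl hj \<xi>"
proof -
  note [measurable] = h[THEN L2fun_measurable]
  have "AE \<xi> in lborel. integrable lborel (\<lambda>y. b2 \<xi> y * hk (V q \<xi> y))"
    "AE \<xi> in lborel. integrable lborel (\<lambda>y. b3 \<xi> y * hl (V (- p) \<xi> y))"
    "AE \<xi> in lborel. integrable lborel (\<lambda>y. b1 \<xi> y * hj (fst y))"
    using gain2 gain3 loss1 h unfolding compact_kernel_def by blast+
  then show ?thesis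
  proof eventually_elim
    case (elim \<xi>)
    have i: "integrable lborel (F hk hl hj \<xi>)"
      unfolding F_eq[abs_def] using elim by (intro Bochner_Integration.integrable_diff Bochner_Integration.integrable_add)
    have "termop \<alpha> \<beta> i j k l hk hl hj \<xi> = (LINT \<xi>s|lborel. LINT x|lborel. F hk hl hj \<xi> (\<xi>s, x))"
      by (rule termop_F) measurable
    also have "\<dots> = (LINT y|(lborel \<Otimes>\<^sub>M lborel). F hk hl hj \<xi> y)"
      using i by (intro lborel_pair.integral_fst') (simp add: lborel_prod)
    also have "\<dots> = (LINT y|lborel. F hk hl hj \<xi> y)" by (simp add: lborel_prod)
    also have "\<dots> = (LINT y|lborel. b2 \<xi> y * hk (V q \<xi> y)) + (LINT y|lborel. b3 \<xi> y * hl (V (- p) \<xi> y)) - (LINT y|lborel. b1 \<xi> y * hj (fst y))"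
      unfolding F_eq using elim by simp
    finally show ?case by simp
  qed
qed

lemma termop_L2fun:
  assumes h: "L2fun hk" "L2fun hl" "L2fun hj"
  shows "L2fun (termop \<alpha> \<beta> i j k l hk hl hj)"
proof (rule L2fun_cong_AE[OF _ _ termop_AE[OF h]])
  note [measurable] = h[THEN L2fun_measurable]
  show "termop \<alpha> \<beta> i j k l hk hl hj \<in> borel_measurable borel" by measurable
  show "L2fun (\<lambda>\<xi>. (LINT y|lborel. b2 \<xi> y * hk (V q \<xi> y)) + (LINT y|lborel. b3 \<xi> y * hl (V (- p) \<xi> y)) - (LINT y|lborel. b1 \<xi> y * hj (fst y)))"
    using gain2 gain3 loss1 h unfolding compact_kernel_def by (intro L2fun_diff L2fun_add) blast+
qed

lemma termop_L2Cauchy: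
  assumes h: "L2weak hk" "L2weak hl" "L2weak hj"
  shows "L2Cauchy (\<lambda>n. termop \<alpha> \<beta> i j k l (hk n) (hl n) (hj n))"
proof (rule L2Cauchy_cong_AE[OF _ _ termop_AE])
  show L2: "L2fun (hk n)" "L2fun (hl n)" "L2fun (hj n)" for n using h by (auto simp: L2weak_def)
  note [measurable] = L2[THEN L2fun_measurable]
  show "termop \<alpha> \<beta> i j k l (hk n) (hl n) (hj n) \<in> borel_measurable borel" for n by measurable
  have "L2Cauchy (\<lambda>n \<xi>. LINT y|lborel. b2 \<xi> y * hk n (V q \<xi> y))"
    "L2Cauchy (\<lambda>n \<xi>. LINT y|lborel. b3 \<xi> y * hl n (V (- p) \<xi> y))"
    "L2Cauchy (\<lambda>n \<xi>. LINT y|lborel. b1 \<xi> y * hj n (fst y))"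
    using gain2 gain3 loss1 h unfolding compact_kernel_def by blast+
  from L2Cauchy_add[OF L2Cauchy_add[OF this(1,2)] L2Cauchy_uminus[OF this(3)]]
  show "L2Cauchy (\<lambda>n \<xi>. (LINT y|lborel. b2 \<xi> y * hk n (V q \<xi> y)) + (LINT y|lborel. b3 \<xi> y * hl n (V (- p) \<xi> y)) - (LINT y|lborel. b1 \<xi> y * hj n (fst y)))"
    by simp
qed

end

context mixture
begin

lemma transitionI: "\<alpha> < s \<Longrightarrow> \<beta> < s \<Longrightarrow> i < r \<alpha> \<Longrightarrow> k < r \<alpha> \<Longrightarrow> j < r \<beta> \<Longrightarrow> l < r \<beta> \<Longrightarrow>
  transition s r m nd Ie phi sig Cm Cp \<alpha> \<beta> i j k l"
  by (intro transition.intro transition_axioms.intro mixture_axioms)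

lemma Kop_L2fun:
  assumes h: "L2vec s r h" and ai: "\<alpha> < s" "i < r \<alpha>"
  shows "L2fun (Kop s r m nd phi Ie sig h \<alpha> i)"
  unfolding Kop_termop[abs_def]
proof (intro L2fun_sum)
  fix \<beta> k j l assume *: "\<beta> \<in> {..<s}" "k \<in> {..<r \<alpha>}" "j \<in> {..<r \<beta>}" "l \<in> {..<r \<beta>}"
  then interpret transition s r m nd Ie phi sig Cm Cp \<alpha> \<beta> i j k l using ai by (intro transitionI) auto
  show "L2fun (termop \<alpha> \<beta> i j k l (h \<alpha> k) (h \<beta> l) (h \<beta> j))"
    using h * ai by (intro termop_L2fun) (auto simp: L2vec_def)
qed

lemma Kop_L2Cauchy:
  assumes h: "\<And>\<alpha> i. \<alpha> < s \<Longrightarrow> i < r \<alpha> \<Longrightarrow> L2weak (\<lambda>n. h n \<alpha> i)" and ai: "\<alpha> < s" "i < r \<alpha>"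
  shows "L2Cauchy (\<lambda>n. Kop s r m nd phi Ie sig (h n) \<alpha> i)"
  unfolding Kop_termop[abs_def]
proof (intro L2Cauchy_sum)
  fix \<beta> k j l assume *: "\<beta> \<in> {..<s}" "k \<in> {..<r \<alpha>}" "j \<in> {..<r \<beta>}" "l \<in> {..<r \<beta>}"
  then interpret transition s r m nd Ie phi sig Cm Cp \<alpha> \<beta> i j k l using ai by (intro transitionI) auto
  show "L2Cauchy (\<lambda>n. termop \<alpha> \<beta> i j k l (h n \<alpha> k) (h n \<beta> l) (h n \<beta> j))"
    using h * ai by (intro termop_L2Cauchy) auto
qed

text \<open>A norm bound on the vector bounds every component, so one subsequence makes all
  components weakly convergent. Their images are Cauchy, and completeness supplies the limit
  component by component.\<close>

lemma Kop_compact: "compact_L2op s r (Kop s r m nd phi Ie sig)"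
  unfolding compact_L2op_def
proof (intro conjI allI impI)
  fix h assume "L2vec s r h"
  then show "L2vec s r (Kop s r m nd phi Ie sig h)" unfolding L2vec_def using Kop_L2fun[unfolded L2vec_def] by blast
next
  fix hs :: "nat \<Rightarrow> nat \<Rightarrow> nat \<Rightarrow> vel \<Rightarrow> real" and B :: real
  assume hs: "\<forall>n. L2vec s r (hs n) \<and> L2norm s r (hs n) \<le> B"
  define I where "I = Sigma {..<s} (\<lambda>\<alpha>. {..<r \<alpha>})"
  have fI: "finite I" by (simp add: I_def)
  have L2: "L2fun (hs n \<alpha> i)" if "\<alpha> < s" "i < r \<alpha>" for n \<alpha> i using hs that by (auto simp: L2vec_def)
  have bound: "(LINT x|lborel. (hs n \<alpha> i x)\<^sup>2) \<le> B\<^sup>2" if ai: "\<alpha> < s" "i < r \<alpha>" for n \<alpha> i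
  proof -
    let ?S = "\<Sum>\<alpha><s. \<Sum>i<r \<alpha>. LINT x | lborel. (hs n \<alpha> i x)\<^sup>2"
    have nn: "(LINT x | lborel. (hs n \<alpha> i x)\<^sup>2) \<ge> 0" for \<alpha> i by (rule integral_nonneg_AE) simp
    have "(LINT x|lborel. (hs n \<alpha> i x)\<^sup>2) \<le> (\<Sum>i<r \<alpha>. LINT x | lborel. (hs n \<alpha> i x)\<^sup>2)"
      using ai nn by (intro member_le_sum) auto
    also have "\<dots> \<le> ?S"
      using ai nn by (intro member_le_sum[of \<alpha> _ "\<lambda>\<alpha>. \<Sum>i<r \<alpha>. LINT x | lborel. (hs n \<alpha> i x)\<^sup>2"] sum_nonneg) auto
    also have "\<dots> \<le> B\<^sup>2"
    proof -
      have S0: "?S \<ge> 0" by (intro sum_nonneg nn)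
      have "sqrt ?S \<le> B" using hs unfolding L2norm_def by blast
      then have "(sqrt ?S)\<^sup>2 \<le> B\<^sup>2" using S0 by (intro power_mono) auto
      then show ?thesis using S0 by simp
    qed
    finally show ?thesis .
  qed
  have "\<exists>sub. strict_mono sub \<and> (\<forall>\<iota>\<in>I. L2weak (\<lambda>n. (\<lambda>n \<iota>. hs n (fst \<iota>) (snd \<iota>)) (sub n) \<iota>))"
    by (rule L2weak_subsequence_finite[OF fI, of _ "B\<^sup>2"]) (auto simp: I_def L2 bound)
  then obtain sub where sub: "strict_mono sub" "\<And>\<alpha> i. \<alpha> < s \<Longrightarrow> i < r \<alpha> \<Longrightarrow> L2weak (\<lambda>n. hs (sub n) \<alpha> i)"
    unfolding I_def by fastforce
  have ex: "\<exists>g. L2fun g \<and> (\<lambda>n. LINT x|lborel. (Kop s r m nd phi Ie sig (hs (sub n)) \<alpha> i x - g x)\<^sup>2) \<longlonglongrightarrow> 0"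
    if "\<alpha> < s" "i < r \<alpha>" for \<alpha> i
    by (rule L2Cauchy_complete, rule Kop_L2Cauchy[OF sub(2) that])
  define g where "g \<alpha> i = (SOME g. L2fun g \<and>
      (\<lambda>n. LINT x|lborel. (Kop s r m nd phi Ie sig (hs (sub n)) \<alpha> i x - g x)\<^sup>2) \<longlonglongrightarrow> 0)" for \<alpha> i
  have g: "L2fun (g \<alpha> i)"
    "(\<lambda>n. LINT x|lborel. (Kop s r m nd phi Ie sig (hs (sub n)) \<alpha> i x - g \<alpha> i x)\<^sup>2) \<longlonglongrightarrow> 0"
    if "\<alpha> < s" "i < r \<alpha>" for \<alpha> i
    using someI_ex[OF ex[OF that]] unfolding g_def by blast+
  have "(\<lambda>n. sqrt (\<Sum>\<alpha><s. \<Sum>i<r \<alpha>. LINT x|lborel. (Kop s r m nd phi Ie sig (hs (sub n)) \<alpha> i x - g \<alpha> i x)\<^sup>2)) \<longlonglongrightarrow> sqrt (\<Sum>\<alpha><s. \<Sum>i<r \<alpha>. 0)"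
    by (intro tendsto_real_sqrt tendsto_sum g) auto
  then have "(\<lambda>n. L2norm s r (\<lambda>\<alpha> i x. Kop s r m nd phi Ie sig (hs (sub n)) \<alpha> i x - g \<alpha> i x)) \<longlonglongrightarrow> 0"
    by (simp add: L2norm_def)
  then show "\<exists>sub g. strict_mono sub \<and> L2vec s r g \<and>
           (\<lambda>n. L2norm s r (\<lambda>\<alpha> i x. Kop s r m nd phi Ie sig (hs (sub n)) \<alpha> i x - g \<alpha> i x)) \<longlonglongrightarrow> 0"
    using sub(1) g(1) by (intro exI[of _ sub] exI[of _ g]) (auto simp: L2vec_def)
qed

end

section \<open>The collision frequency\<close>

lemma integral_orthogonal:
  fixes U :: "vel \<Rightarrow> vel" and f :: "vel \<Rightarrow> real"
  assumes U: "orthogonal_transformation U" and f [measurable]: "f \<in> borel_measurable borel"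
  shows "(LINT x|lborel. f (U x)) = (LINT x|lborel. f x)"
proof -
  have "bounded_linear U" using U by (simp add: orthogonal_transformation_linear linear_conv_bounded_linear[symmetric])
  then have [measurable]: "U \<in> borel_measurable borel"
    by (intro borel_measurable_continuous_onI linear_continuous_on)
  have "(LINT x|lborel. f x) = (LINT x|distr lborel borel U. f x)" by (simp only: lborel_distr_orthogonal[OF U])
  also have "\<dots> = (LINT x|lborel. f (U x))" by (rule integral_distr) measurable
  finally show ?thesis by simp
qed

lemma gauss_integrable:
  assumes a: "a > 0"
  shows "integrable lborel (\<lambda>x::vel. (1 + norm x) * exp (- a * (norm x)\<^sup>2))"
proof (rule integrableI_bounded)
  obtain K where K: "(\<integral>\<^sup>+(x::vel). ennreal ((1 + norm x)\<^sup>2 * exp (- a * (norm x)\<^sup>2)) \<partial>lborel) \<le> ennreal K"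
    using gauss_moment[OF a] by blast
  have "(\<integral>\<^sup>+(x::vel). ennreal (norm ((1 + norm x) * exp (- a * (norm x)\<^sup>2))) \<partial>lborel) \<le> (\<integral>\<^sup>+(x::vel). ennreal ((1 + norm x)\<^sup>2 * exp (- a * (norm x)\<^sup>2)) \<partial>lborel)"
  proof (intro nn_integral_mono ennreal_leI)
    fix x :: vel
    have "(1 + norm x) * 1 \<le> (1 + norm x) * (1 + norm x)" by (intro mult_left_mono) auto
    then have "(1 + norm x) * exp (- a * (norm x)\<^sup>2) \<le> (1 + norm x)\<^sup>2 * exp (- a * (norm x)\<^sup>2)"
      by (intro mult_right_mono) (auto simp: power2_eq_square)
    then show "norm ((1 + norm x) * exp (- a * (norm x)\<^sup>2)) \<le> (1 + norm x)\<^sup>2 * exp (- a * (norm x)\<^sup>2)" by simp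
  qed
  also note K
  also have "ennreal K < \<infinity>" by simp
  finally show "(\<integral>\<^sup>+(x::vel). ennreal (norm ((1 + norm x) * exp (- a * (norm x)\<^sup>2))) \<partial>lborel) < \<infinity>" .
qed measurable

text \<open>Averaging over the reflection of the integration variable gives the lower bound, since
  $|\xi - x| + |\xi + x| \ge 2\max(|\xi|,|x|)$.\<close>

lemma gauss_dist_lower:
  assumes a: "a > 0"
  shows "\<exists>c>0. \<forall>\<xi>::vel. integrable lborel (\<lambda>x. exp (- a * (norm x)\<^sup>2) * norm (\<xi> - x)) \<and>
    c * (1 + norm \<xi>) \<le> (LINT x|lborel. exp (- a * (norm x)\<^sup>2) * norm (\<xi> - x))"
proof -
  define e where "e x = exp (- a * (norm x)\<^sup>2)" for x :: vel
  have [measurable]: "e \<in> borel_measurable borel" unfolding e_def by measurable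
  have e: "e x > 0" for x by (simp add: e_def)
  have gi: "integrable lborel (\<lambda>x. (1 + norm x) * e x)" unfolding e_def by (rule gauss_integrable[OF a])
  have i0: "integrable lborel e"
    by (rule Bochner_Integration.integrable_bound[OF gi]) (auto simp: e less_imp_le intro!: mult_le_cancel_right1[THEN iffD2])
  have i1: "integrable lborel (\<lambda>x. norm x * e x)"
    by (rule Bochner_Integration.integrable_bound[OF gi]) (auto simp: e less_imp_le abs_mult intro!: mult_right_mono)
  have nz: "AE x in lborel. (x::vel) \<noteq> 0" by (rule AE_lborel_singleton)
  \<comment> \<open>If such an integral were 0, the function would vanish almost everywhere, and
    together with the null set of the origin all of velocity space would be null.\<close>
  have pos: "(LINT x|lborel. f x) > 0" if f: "integrable lborel f" "\<And>x. f x \<ge> 0" "\<And>x. x \<noteq> 0 \<Longrightarrow> f x > 0" for f :: "vel \<Rightarrow> real"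
  proof -
    have "(LINT x|lborel. f x) \<noteq> 0"
    proof
      assume "(LINT x|lborel. f x) = 0"
      then have "AE x in lborel. f x = 0" using f by (subst (asm) integral_nonneg_eq_0_iff_AE) auto
      with nz have "AE x in (lborel :: vel measure). False"
        by eventually_elim (use f(3) in force)
      then have "(UNIV :: vel set) \<in> null_sets lborel" using AE_iff_null[of lborel "\<lambda>x::vel. False"] by simp
      then have "emeasure lborel (UNIV :: vel set) = 0" by (rule null_setsD1)
      then show False by (simp add: emeasure_lborel_UNIV)
    qed
    moreover have "(LINT x|lborel. f x) \<ge> 0" using f by (intro integral_nonneg_AE) auto
    ultimately show ?thesis by linarith
  qed
  define W0 where "W0 = (LINT x|lborel. e x)"
  define W1 where "W1 = (LINT x|lborel. norm x * e x)"
  have W: "W0 > 0" "W1 > 0" unfolding W0_def W1_def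
    by (intro pos i0 i1; simp add: e less_imp_le)+
  \<comment> \<open>Averaging with the reflected integral yields norm \<xi> * W0 + W1 as a lower
    bound for twice the integral, hence the half.\<close>
  define c where "c = min W0 W1 / 2"
  have "integrable lborel (\<lambda>x. e x * norm (\<xi> - x)) \<and> c * (1 + norm \<xi>) \<le> (LINT x|lborel. e x * norm (\<xi> - x))" for \<xi>
  proof -
    have idist: "integrable lborel (\<lambda>x. e x * norm (\<zeta> + s *\<^sub>R x))" if "\<bar>s\<bar> = 1" for s and \<zeta> :: vel
    proof (rule Bochner_Integration.integrable_bound)
      show "integrable lborel (\<lambda>x. norm \<zeta> * e x + norm x * e x)" using i0 i1 by simp
      show "AE x in lborel. norm (e x * norm (\<zeta> + s *\<^sub>R x)) \<le> norm (norm \<zeta> * e x + norm x * e x)"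
      proof (rule AE_I2)
        fix x :: vel
        have "e x * norm (\<zeta> + s *\<^sub>R x) \<le> e x * (norm \<zeta> + norm x)"
          using e[of x] norm_triangle_ineq[of \<zeta> "s *\<^sub>R x"] that by (intro mult_left_mono) auto
        then show "norm (e x * norm (\<zeta> + s *\<^sub>R x)) \<le> norm (norm \<zeta> * e x + norm x * e x)"
          using e[of x] by (simp add: abs_mult algebra_simps)
      qed
    qed measurable
    have im: "integrable lborel (\<lambda>x. e x * norm (\<xi> - x))" using idist[of "-1" \<xi>] by simp
    have ip: "integrable lborel (\<lambda>x. e x * norm (\<xi> + x))" using idist[of 1 \<xi>] by simp
    have "orthogonal_transformation (\<lambda>x::vel. - x)"
      by (simp only: orthogonal_transformation_neg orthogonal_transformation_id)
    from integral_orthogonal[OF this, of "\<lambda>x. e x * norm (\<xi> - x)"]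
    have refl: "(LINT x|lborel. e x * norm (\<xi> + x)) = (LINT x|lborel. e x * norm (\<xi> - x))" by (simp add: e_def)
    have "norm \<xi> * W0 + W1 = (LINT x|lborel. norm \<xi> * e x + norm x * e x)"
      unfolding W0_def W1_def using i0 i1 by simp
    also have "\<dots> \<le> (LINT x|lborel. e x * norm (\<xi> - x) + e x * norm (\<xi> + x))"
    proof (rule integral_mono)
      show "integrable lborel (\<lambda>x. norm \<xi> * e x + norm x * e x)" using i0 i1 by simp
      show "integrable lborel (\<lambda>x. e x * norm (\<xi> - x) + e x * norm (\<xi> + x))" using im ip by simp
      fix x
      have "norm ((\<xi> - x) + (\<xi> + x)) \<le> norm (\<xi> - x) + norm (\<xi> + x)" by (rule norm_triangle_ineq)
      moreover have "norm ((\<xi> + x) - (\<xi> - x)) \<le> norm (\<xi> + x) + norm (\<xi> - x)" by (rule norm_triangle_ineq4)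
      moreover have "(\<xi> - x) + (\<xi> + x) = 2 *\<^sub>R \<xi>" "(\<xi> + x) - (\<xi> - x) = 2 *\<^sub>R x" by (simp_all add: scaleR_2)
      ultimately have "norm \<xi> + norm x \<le> norm (\<xi> - x) + norm (\<xi> + x)" by simp
      then have "e x * (norm \<xi> + norm x) \<le> e x * (norm (\<xi> - x) + norm (\<xi> + x))" using e[of x] by (intro mult_left_mono) auto
      then show "norm \<xi> * e x + norm x * e x \<le> e x * norm (\<xi> - x) + e x * norm (\<xi> + x)" by (simp add: algebra_simps)
    qed
    also have "\<dots> = 2 * (LINT x|lborel. e x * norm (\<xi> - x))" using im ip refl by simp
    finally have "norm \<xi> * W0 + W1 \<le> 2 * (LINT x|lborel. e x * norm (\<xi> - x))" .
    moreover have "2 * c * norm \<xi> \<le> norm \<xi> * W0" "2 * c \<le> W1" unfolding c_def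
      by (auto simp: mult.commute[of _ "norm \<xi>"] intro!: mult_left_mono)
    ultimately show ?thesis using im by (simp add: algebra_simps)
  qed
  moreover have "c > 0" using W by (simp add: c_def)
  ultimately show ?thesis unfolding e_def by blast
qed

section \<open>Contribution of one channel to the collision frequency\<close>

context mixture
begin

definition nuterm :: "nat \<Rightarrow> nat \<Rightarrow> nat \<Rightarrow> nat \<Rightarrow> nat \<Rightarrow> nat \<Rightarrow> vel \<Rightarrow> real" where
  "nuterm \<alpha> \<beta> i j k l \<xi> = (LINT \<xi>s | lborel. mx \<beta> j \<xi>s / (phi \<alpha> i * phi \<beta> j)
           * collint m Ie phi sig \<alpha> \<beta> i j k l \<xi> \<xi>s (\<lambda>_ _. 1))"

lemma collfreq_nuterm: "collfreq s r m nd phi Ie sig \<alpha> i \<xi> = (\<Sum>\<beta><s. \<Sum>k<r \<alpha>. \<Sum>j<r \<beta>. \<Sum>l<r \<beta>. nuterm \<alpha> \<beta> i j k l \<xi>)"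
  unfolding collfreq_def nuterm_def mx_def ..

end

context transition
begin

text \<open>The total rate of the channel at given incoming velocities, comparable with rho when the
  channel is open.\<close>

definition lam :: "vel \<Rightarrow> vel \<Rightarrow> real" where "lam \<xi> \<xi>s = (LINT x|lborel. w \<xi> (\<xi>s, x))"

lemma collint_lam: "collint m Ie phi sig \<alpha> \<beta> i j k l \<xi> \<xi>s (\<lambda>_ _. 1) = lam \<xi> \<xi>s"
  unfolding lam_def by (subst collint_w) simp_all

lemma lam_measurable [measurable (raw)]:
  assumes [measurable]: "f \<in> borel_measurable M" "g \<in> borel_measurable M"
  shows "(\<lambda>x. lam (f x) (g x)) \<in> borel_measurable M"
  unfolding lam_def by measurable

lemma w_integrable: "integrable lborel (\<lambda>x. w \<xi> (\<xi>s, x))"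
proof (rule Bochner_Integration.integrable_bound)
  have "integrable lborel (indicator (ball 0 1) :: vel \<Rightarrow> real)"
    by (intro integrable_real_indicator emeasure_lborel_ball_finite) simp
  then show "integrable lborel (\<lambda>x::vel. 3 * Cp * rho d (\<xi> - \<xi>s) * indicator (ball 0 1) x)" by simp
  show "AE x in lborel. norm (w \<xi> (\<xi>s, x)) \<le> norm (3 * Cp * rho d (\<xi> - \<xi>s) * indicator (ball 0 1) x)"
  proof (rule AE_I2)
    fix x
    have "w \<xi> (\<xi>s, x) \<le> 3 * Cp * rho d (\<xi> - \<xi>s) * indicator (ball 0 1 - {0}) x" by (rule w_le)
    also have "\<dots> \<le> 3 * Cp * rho d (\<xi> - \<xi>s) * indicator (ball 0 1) x"
      using Cp_pos by (intro mult_left_mono) (auto simp: indicator_def)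
    finally show "norm (w \<xi> (\<xi>s, x)) \<le> norm (3 * Cp * rho d (\<xi> - \<xi>s) * indicator (ball 0 1) x)"
      using w_nonneg[of \<xi> "(\<xi>s, x)"] by simp
  qed
qed measurable

lemma lam_nonneg: "lam \<xi> \<xi>s \<ge> 0"
  unfolding lam_def by (intro integral_nonneg_AE AE_I2 w_nonneg)

lemma ball_integral: "integrable lborel (\<lambda>x::vel. K * indicator (ball 0 1 - {0}) x)"
  "(LINT x|lborel. K * indicator (ball 0 1 - {0}) (x::vel)) = K * unit_ball_vol 3"
proof -
  have e: "emeasure lborel (ball (0::vel) 1 - {0}) = ennreal (unit_ball_vol 3)"
    using nsph_one unfolding nsph_def by simp
  then have "measure lborel (ball (0::vel) 1 - {0}) = unit_ball_vol 3" by (simp add: measure_def)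
  moreover have "integrable lborel (indicator (ball 0 1 - {0}) :: vel \<Rightarrow> real)"
    by (intro integrable_real_indicator) (auto simp: e)
  ultimately show "integrable lborel (\<lambda>x::vel. K * indicator (ball 0 1 - {0}) x)"
    "(LINT x|lborel. K * indicator (ball 0 1 - {0}) (x::vel)) = K * unit_ball_vol 3" by simp_all
qed

lemma lam_le: "lam \<xi> \<xi>s \<le> 3 * Cp * rho d (\<xi> - \<xi>s) * unit_ball_vol 3"
  unfolding lam_def ball_integral(2)[symmetric]
  by (intro integral_mono w_integrable ball_integral w_le)

lemma lam_ge:
  assumes "\<xi> \<noteq> \<xi>s" "(norm (\<xi> - \<xi>s))\<^sup>2 > 2 * d"
  shows "3 * Cm * rho d (\<xi> - \<xi>s) * unit_ball_vol 3 \<le> lam \<xi> \<xi>s"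
  unfolding lam_def ball_integral(2)[symmetric]
proof (intro integral_mono w_integrable ball_integral)
  fix x :: vel
  show "3 * Cm * rho d (\<xi> - \<xi>s) * indicator (ball 0 1 - {0}) x \<le> w \<xi> (\<xi>s, x)"
  proof (cases "x \<in> ball 0 1 - {0}")
    case True
    then show ?thesis using w_bounds[of \<xi> "(\<xi>s, x)"] assms by simp
  next
    case False then show ?thesis using w_nonneg[of \<xi> "(\<xi>s, x)"] by simp
  qed
qed

text \<open>The weight depends on the velocities and the direction only through norms and inner
  products, so rotating all three arguments changes nothing; the rotation of the integration
  variable is then undone.\<close>

lemma lam_rotate:
  assumes U: "orthogonal_transformation U"
  shows "lam (U \<xi>) (U \<xi>s) = lam \<xi> \<xi>s"
proof -
  have lin: "linear U" and n: "norm (U x) = norm x" for x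
    using U by (auto simp: orthogonal_transformation)
  have inn: "U x \<bullet> U y = x \<bullet> y" for x y
    using U by (simp add: orthogonal_transformation_def)
  have D: "U \<xi> - U \<xi>s = U (\<xi> - \<xi>s)" by (simp add: linear_diff[OF lin])
  have r: "rho d (U v) = rho d v" for v by (simp add: rho_def n)
  have z: "U v = 0 \<longleftrightarrow> v = 0" for v using n[of v] by (metis norm_eq_zero)
  have eq: "U \<xi> = U \<xi>s \<longleftrightarrow> \<xi> = \<xi>s" using z[of "\<xi> - \<xi>s"] unfolding D[symmetric] by simp
  have "w (U \<xi>) (U \<xi>s, U x) = w \<xi> (\<xi>s, x)" for x
  proof -
    have a: "U (\<xi> - \<xi>s) \<bullet> (U x /\<^sub>R norm x) = (\<xi> - \<xi>s) \<bullet> (x /\<^sub>R norm x)" by (simp add: inn)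
    have "U x \<in> ball 0 1 - {0} \<longleftrightarrow> x \<in> ball 0 1 - {0}" by (simp add: n z)
    then show ?thesis unfolding w_def fst_conv snd_conv D eq r n a by (simp only:)
  qed
  then have "lam \<xi> \<xi>s = (LINT x|lborel. w (U \<xi>) (U \<xi>s, U x))" unfolding lam_def by simp
  also have "\<dots> = lam (U \<xi>) (U \<xi>s)" unfolding lam_def by (rule integral_orthogonal[OF U]) measurable
  finally show ?thesis by simp
qed

lemma nuterm_lam: "nuterm \<alpha> \<beta> i j k l \<xi> = (LINT \<xi>s | lborel. mx \<beta> j \<xi>s / (phi \<alpha> i * phi \<beta> j) * lam \<xi> \<xi>s)"
  unfolding nuterm_def collint_lam ..

lemma nuterm_rotate:
  assumes U: "orthogonal_transformation U"
  shows "nuterm \<alpha> \<beta> i j k l (U \<xi>) = nuterm \<alpha> \<beta> i j k l \<xi>"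
proof -
  have n: "norm (U x) = norm x" for x using U by (auto simp: orthogonal_transformation)
  have "nuterm \<alpha> \<beta> i j k l (U \<xi>) = (LINT \<xi>s | lborel. mx \<beta> j (U \<xi>s) / (phi \<alpha> i * phi \<beta> j) * lam (U \<xi>) (U \<xi>s))"
    unfolding nuterm_lam by (rule integral_orthogonal[OF U, symmetric]) measurable
  also have "\<dots> = nuterm \<alpha> \<beta> i j k l \<xi>"
    unfolding nuterm_lam lam_rotate[OF U] maxw_amp n ..
  finally show ?thesis .
qed

lemma nuterm_nonneg: "nuterm \<alpha> \<beta> i j k l \<xi> \<ge> 0"
  unfolding nuterm_lam using phis lam_nonneg by (intro integral_nonneg_AE AE_I2) simp

lemma nu_integrand_le:
  "mx \<beta> j \<xi>s / (phi \<alpha> i * phi \<beta> j) * lam \<xi> \<xi>s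
    \<le> (amp \<beta> j / (phi \<alpha> i * phi \<beta> j) * (3 * Cp * unit_ball_vol 3 * (1 + sqrt (2 * \<bar>d\<bar>))) * (1 + norm \<xi>)) * ((1 + norm \<xi>s) * exp (- (m \<beta> / 2) * (norm \<xi>s)\<^sup>2))"
proof -
  have A: "amp \<beta> j / (phi \<alpha> i * phi \<beta> j) * exp (- (m \<beta> / 2) * (norm \<xi>s)\<^sup>2) \<ge> 0"
    using amp_pos[of \<beta> j] ok phis by simp
  have "lam \<xi> \<xi>s \<le> 3 * Cp * unit_ball_vol 3 * rho d (\<xi> - \<xi>s)" using lam_le[of \<xi> \<xi>s] by (simp add: mult_ac)
  also have "\<dots> \<le> 3 * Cp * unit_ball_vol 3 * ((1 + sqrt (2 * \<bar>d\<bar>)) * (1 + norm \<xi>) * (1 + norm \<xi>s))"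
    using Cp_pos by (intro mult_left_mono rho_le_prod) auto
  finally have "(amp \<beta> j / (phi \<alpha> i * phi \<beta> j) * exp (- (m \<beta> / 2) * (norm \<xi>s)\<^sup>2)) * lam \<xi> \<xi>s
    \<le> (amp \<beta> j / (phi \<alpha> i * phi \<beta> j) * exp (- (m \<beta> / 2) * (norm \<xi>s)\<^sup>2)) * (3 * Cp * unit_ball_vol 3 * ((1 + sqrt (2 * \<bar>d\<bar>)) * (1 + norm \<xi>) * (1 + norm \<xi>s)))"
    using A by (rule mult_left_mono)
  then show ?thesis unfolding maxw_amp by (simp add: mult_ac)
qed

lemma nu_integrand_nonneg: "mx \<beta> j \<xi>s / (phi \<alpha> i * phi \<beta> j) * lam \<xi> \<xi>s \<ge> 0"
  using phis lam_nonneg by simp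

lemma nu_integrable: "integrable lborel (\<lambda>\<xi>s. mx \<beta> j \<xi>s / (phi \<alpha> i * phi \<beta> j) * lam \<xi> \<xi>s)"
proof (rule Bochner_Integration.integrable_bound)
  show "integrable lborel (\<lambda>\<xi>s. (amp \<beta> j / (phi \<alpha> i * phi \<beta> j) * (3 * Cp * unit_ball_vol 3 * (1 + sqrt (2 * \<bar>d\<bar>))) * (1 + norm \<xi>)) * ((1 + norm \<xi>s) * exp (- (m \<beta> / 2) * (norm (\<xi>s::vel))\<^sup>2)))"
    using mm by (intro integrable_mult_right gauss_integrable) simp
  show "AE \<xi>s in lborel. norm (mx \<beta> j \<xi>s / (phi \<alpha> i * phi \<beta> j) * lam \<xi> \<xi>s) \<le> norm ((amp \<beta> j / (phi \<alpha> i * phi \<beta> j) * (3 * Cp * unit_ball_vol 3 * (1 + sqrt (2 * \<bar>d\<bar>))) * (1 + norm \<xi>)) * ((1 + norm \<xi>s) * exp (- (m \<beta> / 2) * (norm (\<xi>s::vel))\<^sup>2)))"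
  proof (rule AE_I2)
    fix \<xi>s :: vel
    show "norm (mx \<beta> j \<xi>s / (phi \<alpha> i * phi \<beta> j) * lam \<xi> \<xi>s) \<le> norm ((amp \<beta> j / (phi \<alpha> i * phi \<beta> j) * (3 * Cp * unit_ball_vol 3 * (1 + sqrt (2 * \<bar>d\<bar>))) * (1 + norm \<xi>)) * ((1 + norm \<xi>s) * exp (- (m \<beta> / 2) * (norm (\<xi>s::vel))\<^sup>2)))"
      using nu_integrand_le[of \<xi>s \<xi>] nu_integrand_nonneg[of \<xi>s \<xi>] unfolding real_norm_def by linarith
  qed
qed measurable

lemma nuterm_upper: "\<exists>C\<ge>0. \<forall>\<xi>. nuterm \<alpha> \<beta> i j k l \<xi> \<le> C * (1 + norm \<xi>)"
proof -
  define M where "M = (LINT \<xi>s|lborel. (1 + norm \<xi>s) * exp (- (m \<beta> / 2) * (norm (\<xi>s::vel))\<^sup>2))"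
  have M: "M \<ge> 0" unfolding M_def by (intro integral_nonneg_AE) simp
  define A where "A = amp \<beta> j / (phi \<alpha> i * phi \<beta> j) * (3 * Cp * unit_ball_vol 3 * (1 + sqrt (2 * \<bar>d\<bar>)))"
  have A: "A \<ge> 0" unfolding A_def using amp_pos[of \<beta> j] ok phis Cp_pos
    by (intro mult_nonneg_nonneg divide_nonneg_nonneg add_nonneg_nonneg) auto
  have "nuterm \<alpha> \<beta> i j k l \<xi> \<le> (A * M) * (1 + norm \<xi>)" for \<xi>
  proof -
    have gi: "integrable lborel (\<lambda>\<xi>s::vel. (1 + norm \<xi>s) * exp (- (m \<beta> / 2) * (norm \<xi>s)\<^sup>2))"
      using mm by (intro gauss_integrable) simp
    have "nuterm \<alpha> \<beta> i j k l \<xi> \<le> (LINT \<xi>s|lborel. (A * (1 + norm \<xi>)) * ((1 + norm \<xi>s) * exp (- (m \<beta> / 2) * (norm (\<xi>s::vel))\<^sup>2)))"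
      unfolding nuterm_lam A_def by (intro integral_mono nu_integrable integrable_mult_right gi nu_integrand_le)
    also have "\<dots> = (A * (1 + norm \<xi>)) * M" unfolding M_def by simp
    finally show ?thesis by (simp add: mult_ac)
  qed
  then show ?thesis using A M by (intro exI[of _ "A * M"]) auto
qed

text \<open>At zero energy gap rho equals |\<xi> - \<xi>s| and the channel is open for every pair of
  distinct velocities, so the Gaussian average of the distance gives the bound.\<close>

lemma nuterm_lower:
  assumes d0: "d = 0"
  shows "\<exists>C>0. \<forall>\<xi>. C * (1 + norm \<xi>) \<le> nuterm \<alpha> \<beta> i j k l \<xi>"
proof -
  obtain c0 where c0: "c0 > 0" "\<And>\<xi>::vel. integrable lborel (\<lambda>x. exp (- (m \<beta> / 2) * (norm x)\<^sup>2) * norm (\<xi> - x))"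
    "\<And>\<xi>::vel. c0 * (1 + norm \<xi>) \<le> (LINT x|lborel. exp (- (m \<beta> / 2) * (norm x)\<^sup>2) * norm (\<xi> - x))"
    using gauss_dist_lower[of "m \<beta> / 2"] mm by auto
  define A where "A = amp \<beta> j / (phi \<alpha> i * phi \<beta> j) * (3 * Cm * unit_ball_vol 3)"
  have A: "A > 0" unfolding A_def using amp_pos[of \<beta> j] ok phis Cm_pos by simp
  have "A * c0 * (1 + norm \<xi>) \<le> nuterm \<alpha> \<beta> i j k l \<xi>" for \<xi>
  proof -
    have "A * (c0 * (1 + norm \<xi>)) \<le> A * (LINT x|lborel. exp (- (m \<beta> / 2) * (norm x)\<^sup>2) * norm (\<xi> - x))"
      using A by (intro mult_left_mono c0) simp
    also have "\<dots> = (LINT x|lborel. A * (exp (- (m \<beta> / 2) * (norm x)\<^sup>2) * norm (\<xi> - x)))" by simp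
    also have "\<dots> \<le> nuterm \<alpha> \<beta> i j k l \<xi>"
      unfolding nuterm_lam
    proof (intro integral_mono nu_integrable integrable_mult_right c0)
      fix x :: vel
      have r: "rho d (\<xi> - x) = norm (\<xi> - x)" by (simp add: rho_def d0)
      have "3 * Cm * norm (\<xi> - x) * unit_ball_vol 3 \<le> lam \<xi> x"
      proof (cases "\<xi> = x")
        case True then show ?thesis using lam_nonneg by simp
      next
        case False then show ?thesis using lam_ge[of \<xi> x] d0 r by simp
      qed
      then have "(amp \<beta> j / (phi \<alpha> i * phi \<beta> j) * exp (- (m \<beta> / 2) * (norm x)\<^sup>2)) * (3 * Cm * norm (\<xi> - x) * unit_ball_vol 3)
        \<le> (amp \<beta> j / (phi \<alpha> i * phi \<beta> j) * exp (- (m \<beta> / 2) * (norm x)\<^sup>2)) * lam \<xi> x"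
        using amp_pos[of \<beta> j] ok phis by (intro mult_left_mono) auto
      then show "A * (exp (- (m \<beta> / 2) * (norm x)\<^sup>2) * norm (\<xi> - x)) \<le> mx \<beta> j x / (phi \<alpha> i * phi \<beta> j) * lam \<xi> x"
        unfolding A_def maxw_amp by (simp add: mult_ac)
    qed
    finally show ?thesis by (simp add: mult_ac)
  qed
  then show ?thesis using A c0(1) by (intro exI[of _ "A * c0"]) auto
qed

end

section \<open>Bounds uniform over species and internal states\<close>

lemma sum_linear_bound:
  fixes f :: "'i \<Rightarrow> vel \<Rightarrow> real"
  assumes "finite I" "\<And>x. x \<in> I \<Longrightarrow> \<exists>C\<ge>0. \<forall>\<xi>. f x \<xi> \<le> C * (1 + norm \<xi>)"
  shows "\<exists>C\<ge>0. \<forall>\<xi>. (\<Sum>x\<in>I. f x \<xi>) \<le> C * (1 + norm \<xi>)"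
  using assms
proof (induction I)
  case empty then show ?case by (intro exI[of _ 0]) simp
next
  case (insert a I)
  then obtain C D where "C \<ge> 0" "\<And>\<xi>. (\<Sum>x\<in>I. f x \<xi>) \<le> C * (1 + norm \<xi>)" "D \<ge> 0" "\<And>\<xi>. f a \<xi> \<le> D * (1 + norm \<xi>)"
    by (metis insertCI)
  then have "(\<Sum>x\<in>insert a I. f x \<xi>) \<le> (C + D) * (1 + norm \<xi>)" for \<xi>
    using insert.hyps add_mono[of "f a \<xi>" "D * (1 + norm \<xi>)" "\<Sum>x\<in>I. f x \<xi>" "C * (1 + norm \<xi>)"]
    by (simp add: distrib_right add.commute)
  then show ?case using \<open>C \<ge> 0\<close> \<open>D \<ge> 0\<close> by (intro exI[of _ "C + D"]) auto
qed

lemma uniform_linear_bounds: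
  fixes f :: "'i \<Rightarrow> vel \<Rightarrow> real"
  assumes "finite I" "\<And>x. x \<in> I \<Longrightarrow> \<exists>C\<ge>0. \<forall>\<xi>. f x \<xi> \<le> C * (1 + norm \<xi>)"
    "\<And>x. x \<in> I \<Longrightarrow> \<exists>C>0. \<forall>\<xi>. C * (1 + norm \<xi>) \<le> f x \<xi>"
  shows "\<exists>\<nu>m \<nu>p. 0 < \<nu>m \<and> \<nu>m < \<nu>p \<and> (\<forall>x\<in>I. \<forall>\<xi>. \<nu>m * (1 + norm \<xi>) \<le> f x \<xi> \<and> f x \<xi> \<le> \<nu>p * (1 + norm \<xi>))"
  using assms
proof (induction I)
  \<comment> \<open>Any strictly ordered positive pair will do; minimum and maximum preserve the
    strict order in the induction step.\<close>
  case empty then show ?case by (intro exI[of _ 1] exI[of _ 2]) simp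
next
  case (insert a I)
  then obtain u v where uv: "0 < u" "u < v" "\<And>x \<xi>. x \<in> I \<Longrightarrow> u * (1 + norm \<xi>) \<le> f x \<xi> \<and> f x \<xi> \<le> v * (1 + norm \<xi>)"
    by (metis insertCI)
  obtain C where C: "C \<ge> 0" "\<And>\<xi>. f a \<xi> \<le> C * (1 + norm \<xi>)" using insert.prems(1)[of a] by auto
  obtain D where D: "D > 0" "\<And>\<xi>. D * (1 + norm \<xi>) \<le> f a \<xi>" using insert.prems(2)[of a] by auto
  have le: "y * (1 + norm \<xi>) \<le> z * (1 + norm \<xi>)" if "y \<le> z" for y z :: real and \<xi> :: vel
    using that by (intro mult_right_mono) auto
  have "min u D * (1 + norm \<xi>) \<le> f x \<xi> \<and> f x \<xi> \<le> max v C * (1 + norm \<xi>)" if "x \<in> insert a I" for x \<xi>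
  proof (cases "x = a")
    case True
    then show ?thesis using C(2)[of \<xi>] D(2)[of \<xi>] le[of "min u D" D \<xi>] le[of C "max v C" \<xi>] by simp
  next
    case False
    then show ?thesis using uv(3)[of x \<xi>] that le[of "min u D" u \<xi>] le[of v "max v C" \<xi>] by fastforce
  qed
  moreover have "0 < min u D" "min u D < max v C" using uv D by auto
  ultimately show ?case by blast
qed

context mixture
begin

text \<open>Vectors of equal norm are related by an orthogonal transformation, and every channel is
  invariant under it.\<close>

lemma collfreq_radial:
  assumes ai: "\<alpha> < s" "i < r \<alpha>" and n: "norm \<xi> = norm \<eta>"
  shows "collfreq s r m nd phi Ie sig \<alpha> i \<xi> = collfreq s r m nd phi Ie sig \<alpha> i \<eta>"
proof -
  obtain U :: "vel \<Rightarrow> vel" where U: "orthogonal_transformation U" "U \<xi> = \<eta>"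
    using n by (rule orthogonal_transformation_exists)
  show ?thesis unfolding collfreq_nuterm
  proof (intro sum.cong refl)
    fix \<beta> k j l assume *: "\<beta> \<in> {..<s}" "k \<in> {..<r \<alpha>}" "j \<in> {..<r \<beta>}" "l \<in> {..<r \<beta>}"
    then interpret transition s r m nd Ie phi sig Cm Cp \<alpha> \<beta> i j k l using ai by (intro transitionI) auto
    show "nuterm \<alpha> \<beta> i j k l \<xi> = nuterm \<alpha> \<beta> i j k l \<eta>" using nuterm_rotate[OF U(1), of \<xi>] U(2) by simp
  qed
qed

lemma collfreq_upper:
  assumes ai: "\<alpha> < s" "i < r \<alpha>"
  shows "\<exists>C\<ge>0. \<forall>\<xi>. collfreq s r m nd phi Ie sig \<alpha> i \<xi> \<le> C * (1 + norm \<xi>)"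
  unfolding collfreq_nuterm
proof (intro sum_linear_bound finite_lessThan)
  fix \<beta> k j l assume *: "\<beta> \<in> {..<s}" "k \<in> {..<r \<alpha>}" "j \<in> {..<r \<beta>}" "l \<in> {..<r \<beta>}"
  then interpret transition s r m nd Ie phi sig Cm Cp \<alpha> \<beta> i j k l using ai by (intro transitionI) auto
  show "\<exists>C\<ge>0. \<forall>\<xi>. nuterm \<alpha> \<beta> i j k l \<xi> \<le> C * (1 + norm \<xi>)" by (rule nuterm_upper)
qed

lemma collfreq_lower:
  assumes ai: "\<alpha> < s" "i < r \<alpha>"
  shows "\<exists>C>0. \<forall>\<xi>. C * (1 + norm \<xi>) \<le> collfreq s r m nd phi Ie sig \<alpha> i \<xi>"
proof -
  \<comment> \<open>This channel exists for every species and state and has energy gap 0, which is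
    what the lower bound needs.\<close>
  interpret T: transition s r m nd Ie phi sig Cm Cp \<alpha> \<alpha> i i i i using ai by (intro transitionI) auto
  have "T.d = 0" by (simp add: T.d_def dItil_def)
  from T.nuterm_lower[OF this] obtain C where C: "C > 0" "\<And>\<xi>. C * (1 + norm \<xi>) \<le> nuterm \<alpha> \<alpha> i i i i \<xi>" by blast
  have nn: "nuterm \<alpha> \<beta> i j k l \<xi> \<ge> 0" if "\<beta> < s" "k < r \<alpha>" "j < r \<beta>" "l < r \<beta>" for \<beta> k j l \<xi>
  proof -
    interpret transition s r m nd Ie phi sig Cm Cp \<alpha> \<beta> i j k l using ai that by (intro transitionI) auto
    show ?thesis by (rule nuterm_nonneg)
  qed
  have "nuterm \<alpha> \<alpha> i i i i \<xi> \<le> collfreq s r m nd phi Ie sig \<alpha> i \<xi>" for \<xi>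
  proof -
    have "nuterm \<alpha> \<alpha> i i i i \<xi> \<le> (\<Sum>l<r \<alpha>. nuterm \<alpha> \<alpha> i i i l \<xi>)"
      using ai nn by (intro member_le_sum) auto
    also have "\<dots> \<le> (\<Sum>j<r \<alpha>. \<Sum>l<r \<alpha>. nuterm \<alpha> \<alpha> i j i l \<xi>)"
      using ai nn by (intro member_le_sum[of i _ "\<lambda>j. \<Sum>l<r \<alpha>. nuterm \<alpha> \<alpha> i j i l \<xi>"] sum_nonneg) auto
    also have "\<dots> \<le> (\<Sum>k<r \<alpha>. \<Sum>j<r \<alpha>. \<Sum>l<r \<alpha>. nuterm \<alpha> \<alpha> i j k l \<xi>)"
      using ai nn by (intro member_le_sum[of i _ "\<lambda>k. \<Sum>j<r \<alpha>. \<Sum>l<r \<alpha>. nuterm \<alpha> \<alpha> i j k l \<xi>"] sum_nonneg) auto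
    also have "\<dots> \<le> (\<Sum>\<beta><s. \<Sum>k<r \<alpha>. \<Sum>j<r \<beta>. \<Sum>l<r \<beta>. nuterm \<alpha> \<beta> i j k l \<xi>)"
      using ai nn by (intro member_le_sum[of \<alpha> _ "\<lambda>\<beta>. \<Sum>k<r \<alpha>. \<Sum>j<r \<beta>. \<Sum>l<r \<beta>. nuterm \<alpha> \<beta> i j k l \<xi>"] sum_nonneg) auto
    finally show ?thesis unfolding collfreq_nuterm .
  qed
  with C show ?thesis by (meson order_trans)
qed

lemma collfreq_bounds:
  "\<exists>\<nu>m \<nu>p. 0 < \<nu>m \<and> \<nu>m < \<nu>p \<and> (\<forall>\<alpha><s. \<forall>i<r \<alpha>. \<forall>\<xi>.
     \<nu>m * (1 + norm \<xi>) \<le> collfreq s r m nd phi Ie sig \<alpha> i \<xi> \<and> collfreq s r m nd phi Ie sig \<alpha> i \<xi> \<le> \<nu>p * (1 + norm \<xi>))"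
proof -
  define I where "I = Sigma {..<s} (\<lambda>\<alpha>. {..<r \<alpha>})"
  have "\<exists>\<nu>m \<nu>p. 0 < \<nu>m \<and> \<nu>m < \<nu>p \<and> (\<forall>\<iota>\<in>I. \<forall>\<xi>. \<nu>m * (1 + norm \<xi>) \<le> collfreq s r m nd phi Ie sig (fst \<iota>) (snd \<iota>) \<xi>
      \<and> collfreq s r m nd phi Ie sig (fst \<iota>) (snd \<iota>) \<xi> \<le> \<nu>p * (1 + norm \<xi>))"
    by (rule uniform_linear_bounds) (auto simp: I_def intro: collfreq_upper collfreq_lower)
  then show ?thesis unfolding I_def by fastforce
qed

end

text \<open>The decomposition of the linearized operator is the definition of \<open>Lop\<close>;
  what remains to be proved are compactness, radial dependence and the two-sided bound.\<close>

theorem theorem2: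
  fixes s :: nat and r :: "nat \<Rightarrow> nat" and m nd :: "nat \<Rightarrow> real"
    and Ie phi :: "nat \<Rightarrow> nat \<Rightarrow> real"
    and sig :: "nat \<Rightarrow> nat \<Rightarrow> real \<Rightarrow> real \<Rightarrow> nat \<Rightarrow> nat \<Rightarrow> nat \<Rightarrow> nat \<Rightarrow> real"
    and Cm Cp :: real
  assumes s_pos: "s \<ge> 1"
    and r_pos: "\<And>\<alpha>. \<alpha> < s \<Longrightarrow> r \<alpha> \<ge> 1"
    and m_pos: "\<And>\<alpha>. \<alpha> < s \<Longrightarrow> m \<alpha> > 0"
    and nd_pos: "\<And>\<alpha>. \<alpha> < s \<Longrightarrow> nd \<alpha> > 0"
    and Ie_nonneg: "\<And>\<alpha> i. \<alpha> < s \<Longrightarrow> i < r \<alpha> \<Longrightarrow> Ie \<alpha> i \<ge> 0"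
    and phi_pos: "\<And>\<alpha> i. \<alpha> < s \<Longrightarrow> i < r \<alpha> \<Longrightarrow> phi \<alpha> i > 0"
    and sig_meas: "\<And>\<alpha> \<beta> i j k l. \<alpha> < s \<Longrightarrow> \<beta> < s \<Longrightarrow> i < r \<alpha> \<Longrightarrow> k < r \<alpha> \<Longrightarrow>
        j < r \<beta> \<Longrightarrow> l < r \<beta> \<Longrightarrow>
        (\<lambda>p. sig \<alpha> \<beta> (fst p) (snd p) i j k l) \<in> borel_measurable (lborel :: (real \<times> real) measure)"
    and sig_nonneg: "\<And>\<alpha> \<beta> i j k l a c. \<alpha> < s \<Longrightarrow> \<beta> < s \<Longrightarrow> i < r \<alpha> \<Longrightarrow> k < r \<alpha> \<Longrightarrow>
        j < r \<beta> \<Longrightarrow> l < r \<beta> \<Longrightarrow> a \<ge> 0 \<Longrightarrow> -1 \<le> c \<Longrightarrow> c \<le> 1 \<Longrightarrow>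
        sig \<alpha> \<beta> a c i j k l \<ge> 0"
    and sig_pos_ae: "\<And>\<alpha> \<beta> i j k l. \<alpha> < s \<Longrightarrow> \<beta> < s \<Longrightarrow> i < r \<alpha> \<Longrightarrow> k < r \<alpha> \<Longrightarrow>
        j < r \<beta> \<Longrightarrow> l < r \<beta> \<Longrightarrow>
        AE p in (lborel :: (real \<times> real) measure). fst p \<ge> 0 \<longrightarrow> -1 \<le> snd p \<longrightarrow> snd p \<le> 1
           \<longrightarrow> sig \<alpha> \<beta> (fst p) (snd p) i j k l > 0"
    and microrev: "\<And>\<alpha> \<beta> i j k l a b c. \<alpha> < s \<Longrightarrow> \<beta> < s \<Longrightarrow> i < r \<alpha> \<Longrightarrow> k < r \<alpha> \<Longrightarrow>
        j < r \<beta> \<Longrightarrow> l < r \<beta> \<Longrightarrow> a > 0 \<Longrightarrow> b > 0 \<Longrightarrow>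
        b\<^sup>2 = a\<^sup>2 - 2 * dItil m Ie \<alpha> \<beta> i j k l \<Longrightarrow> -1 \<le> c \<Longrightarrow> c \<le> 1 \<Longrightarrow>
        phi \<alpha> i * phi \<beta> j * a\<^sup>2 * sig \<alpha> \<beta> a c i j k l
          = phi \<alpha> k * phi \<beta> l * b\<^sup>2 * sig \<alpha> \<beta> b c k l i j"
    and sym_species: "\<And>\<alpha> \<beta> i j k l a c. \<alpha> < s \<Longrightarrow> \<beta> < s \<Longrightarrow> i < r \<alpha> \<Longrightarrow> k < r \<alpha> \<Longrightarrow>
        j < r \<beta> \<Longrightarrow> l < r \<beta> \<Longrightarrow> sig \<alpha> \<beta> a c k l i j = sig \<beta> \<alpha> a c l k j i"
    and sym_angle: "\<And>\<alpha> i j k l a c. \<alpha> < s \<Longrightarrow> i < r \<alpha> \<Longrightarrow> j < r \<alpha> \<Longrightarrow> k < r \<alpha> \<Longrightarrow>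
        l < r \<alpha> \<Longrightarrow> sig \<alpha> \<alpha> a (- c) i j k l = sig \<alpha> \<alpha> a c i j k l"
    and sym_swap1: "\<And>\<alpha> i j k l a c. \<alpha> < s \<Longrightarrow> i < r \<alpha> \<Longrightarrow> j < r \<alpha> \<Longrightarrow> k < r \<alpha> \<Longrightarrow>
        l < r \<alpha> \<Longrightarrow> sig \<alpha> \<alpha> a c i j k l = sig \<alpha> \<alpha> a c j i k l"
    and sym_swap2: "\<And>\<alpha> i j k l a c. \<alpha> < s \<Longrightarrow> i < r \<alpha> \<Longrightarrow> j < r \<alpha> \<Longrightarrow> k < r \<alpha> \<Longrightarrow>
        l < r \<alpha> \<Longrightarrow> sig \<alpha> \<alpha> a c i j k l = sig \<alpha> \<alpha> a c j i l k"
    and Cm_pos: "0 < Cm" and Cm_le_Cp: "Cm \<le> Cp"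
    and sig_bounds: "\<And>\<alpha> \<beta> i j k l a c. \<alpha> < s \<Longrightarrow> \<beta> < s \<Longrightarrow> i < r \<alpha> \<Longrightarrow> k < r \<alpha> \<Longrightarrow>
        j < r \<beta> \<Longrightarrow> l < r \<beta> \<Longrightarrow> a > 0 \<Longrightarrow> -1 \<le> c \<Longrightarrow> c \<le> 1 \<Longrightarrow>
        a\<^sup>2 > 2 * dItil m Ie \<alpha> \<beta> i j k l \<Longrightarrow>
        Cm * sqrt (a\<^sup>2 - 2 * dItil m Ie \<alpha> \<beta> i j k l) / (a * phi \<alpha> i * phi \<beta> j)
          \<le> sig \<alpha> \<beta> a c i j k l
        \<and> sig \<alpha> \<beta> a c i j k l
          \<le> Cp * sqrt (a\<^sup>2 - 2 * dItil m Ie \<alpha> \<beta> i j k l) / (a * phi \<alpha> i * phi \<beta> j)"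
  shows "compact_L2op s r (Kop s r m nd phi Ie sig)
    \<and> (\<forall>\<alpha><s. \<forall>i<r \<alpha>. \<forall>\<xi> \<eta>. norm \<xi> = norm \<eta> \<longrightarrow>
          collfreq s r m nd phi Ie sig \<alpha> i \<xi> = collfreq s r m nd phi Ie sig \<alpha> i \<eta>)
    \<and> (\<exists>\<nu>m \<nu>p. 0 < \<nu>m \<and> \<nu>m < \<nu>p \<and>
          (\<forall>\<alpha><s. \<forall>i<r \<alpha>. \<forall>\<xi>.
             \<nu>m * (1 + norm \<xi>) \<le> collfreq s r m nd phi Ie sig \<alpha> i \<xi>
             \<and> collfreq s r m nd phi Ie sig \<alpha> i \<xi> \<le> \<nu>p * (1 + norm \<xi>)))"
proof -
  interpret mixture s r m nd Ie phi sig Cm Cp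
    by (unfold_locales; (rule m_pos nd_pos phi_pos sig_meas microrev Cm_pos Cm_le_Cp sig_bounds; assumption)?)
  show ?thesis
    using Kop_compact collfreq_radial collfreq_bounds by blast
qed

end
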